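(* Let $\Sigma$ be a closed minimal $k$-dimensional submanifold of the unit sphere $S^n$ with $k$-volume $A$. Then $\Sigma$ is $\epsilon(A,k)$-antipodal. More generally, if $\Sigma$ contains a point $p$ with density $m$, then $\Sigma$ cannot avoid the (closed) ball of radius $\epsilon\left(\frac Am,k\right)$ centred at the antipodal point $p'$ of $p$, i.e. $\operatorname{dist}(p',\Sigma)\le\epsilon\left(\frac Am,k\right)$.
   Context: Closed means compact without boundary; submanifolds may be immersed, with volume counted with multiplicity, and the density $m$ of $\Sigma$ at $p$ is its multiplicity there (number of sheets through $p$). Distances are geodesic distances in $S^n$. A subset $X\subset S^n$ is $\epsilon$-antipodal if the antipodal point of any point of $X$ is at distance at most $\epsilon$ from $X$. $\omega_j$ is the volume of the unit $j$-sphere. For $A\ge\omega_k$, $\epsilon(A,k)$ is the unique solution $\epsilon\in[0,\frac\pi2)$ of $$\int_\epsilon^{\pi/2}\sin^{k-1}t\,dt+\frac{(1-\cos^2\epsilon)^{k/2}}{k\cos\epsilon}=\omega_{k-1}^{-1}\left(A-\frac{\omega_k}{2}\right).$$ The function $\epsilon(\cdot,k)$ is strictly increasing on $[\omega_k,+\infty)$ with $\epsilon(\omega_k,k)=0$ and limit $\frac\pi2$ at $+\infty$. (That $A\ge\omega_k$, respectively $A/m\ge\omega_k$, so that $\epsilon$ is defined, is part of the assertion.) *)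

theory Defs
  imports "HOL-Analysis.Analysis"
begin

section \<open>Smooth maps\<close>

primrec Ck_on :: "nat \<Rightarrow> ('a::real_normed_vector \<Rightarrow> 'b::real_normed_vector) \<Rightarrow> 'a set \<Rightarrow> bool" where
  "Ck_on 0 f S \<longleftrightarrow> continuous_on S f"
| "Ck_on (Suc r) f S \<longleftrightarrow>
     (\<forall>x\<in>S. f differentiable at x) \<and> (\<forall>v. Ck_on r (\<lambda>x. frechet_derivative f (at x) v) S)"

(* Used for open S only. *)
definition smooth_on :: "('a::real_normed_vector \<Rightarrow> 'b::real_normed_vector) \<Rightarrow> 'a set \<Rightarrow> bool" where
  "smooth_on f S \<longleftrightarrow> (\<forall>r. Ck_on r f S)"


section \<open>Closed manifolds\<close>

(* An atlas is a set of local parametrizations (V, \<psi>), where V is an open subset of the model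
   space R^k and \<psi> maps V homeomorphically onto an open subset of M; the values of \<psi> outside V
   are irrelevant. The dimension is k = CARD('k), hence k \<ge> 1. *)
type_synonym ('k, 'm) atlas = "((real ^ 'k) set \<times> (real ^ 'k \<Rightarrow> 'm)) set"

definition smooth_atlas :: "'m::t2_space set \<Rightarrow> ('k::finite, 'm) atlas \<Rightarrow> bool" where
  "smooth_atlas M \<A> \<longleftrightarrow>
     (\<forall>(V, \<psi>)\<in>\<A>. open V \<and> openin (top_of_set M) (\<psi> ` V) \<and>
                    (\<exists>\<phi>. homeomorphism V (\<psi> ` V) \<psi> \<phi>)) \<and>
     (\<Union>(V, \<psi>)\<in>\<A>. \<psi> ` V) = M \<and>
     (\<forall>(V, \<psi>)\<in>\<A>. \<forall>(W, \<xi>)\<in>\<A>. smooth_on (inv_into W \<xi> \<circ> \<psi>) (V \<inter> \<psi> -` (\<xi> ` W)))"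

(* Closed: compact, without boundary. Connectedness is not required. Second countability follows
   from compactness. *)
definition closed_manifold :: "'m::t2_space set \<Rightarrow> ('k::finite, 'm) atlas \<Rightarrow> bool" where
  "closed_manifold M \<A> \<longleftrightarrow> M \<noteq> {} \<and> compact M \<and> smooth_atlas M \<A>"


section \<open>Immersions into the unit sphere\<close>

text \<open>The unit sphere \<open>S\<^sup>n\<close> is \<open>sphere 0 1\<close> in a Euclidean space \<open>'a\<close> of dimension \<open>n + 1\<close>.\<close>

definition immersion_into_sphere ::
  "'m::t2_space set \<Rightarrow> ('k::finite, 'm) atlas \<Rightarrow> ('m \<Rightarrow> 'a::euclidean_space) \<Rightarrow> bool" where
  "immersion_into_sphere M \<A> f \<longleftrightarrow>
     f ` M \<subseteq> sphere 0 1 \<and>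
     (\<forall>(V, \<psi>)\<in>\<A>. smooth_on (f \<circ> \<psi>) V \<and>
                    (\<forall>y\<in>V. inj (frechet_derivative (f \<circ> \<psi>) (at y))))"

definition pderiv_at ::
  "(real ^ 'k::finite \<Rightarrow> 'a::euclidean_space) \<Rightarrow> 'k \<Rightarrow> real ^ 'k \<Rightarrow> 'a" where
  "pderiv_at F i y = frechet_derivative F (at y) (axis i 1)"

(* First fundamental form of the local immersion F. *)
definition first_ff ::
  "(real ^ 'k::finite \<Rightarrow> 'a::euclidean_space) \<Rightarrow> real ^ 'k \<Rightarrow> real ^ 'k ^ 'k" where
  "first_ff F y = (\<chi> i j. pderiv_at F i y \<bullet> pderiv_at F j y)"

(* Normal space within the sphere: F y spans the normal line of the sphere at F y, so this is the
   orthogonal complement of the tangent space of the submanifold in that of the sphere. *)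
definition normal_space ::
  "(real ^ 'k::finite \<Rightarrow> 'a::euclidean_space) \<Rightarrow> real ^ 'k \<Rightarrow> 'a set" where
  "normal_space F y = (span (insert (F y) (range (\<lambda>i. pderiv_at F i y))))\<^sup>\<bottom>"

(* Second fundamental form with respect to the sphere; closest_point is here the orthogonal
   projection onto the linear subspace normal_space F y. *)
definition second_ff ::
  "(real ^ 'k::finite \<Rightarrow> 'a::euclidean_space) \<Rightarrow> 'k \<Rightarrow> 'k \<Rightarrow> real ^ 'k \<Rightarrow> 'a" where
  "second_ff F i j y = closest_point (normal_space F y) (pderiv_at (pderiv_at F i) j y)"

(* Unnormalised: the trace of the second fundamental form, not divided by k. *)
definition mean_curvature ::
  "(real ^ 'k::finite \<Rightarrow> 'a::euclidean_space) \<Rightarrow> real ^ 'k \<Rightarrow> 'a" where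
  "mean_curvature F y =
     (\<Sum>i\<in>UNIV. \<Sum>j\<in>UNIV. (matrix_inv (first_ff F y) $ i $ j) *\<^sub>R second_ff F i j y)"

definition minimal_immersion ::
  "'m::t2_space set \<Rightarrow> ('k::finite, 'm) atlas \<Rightarrow> ('m \<Rightarrow> 'a::euclidean_space) \<Rightarrow> bool" where
  "minimal_immersion M \<A> f \<longleftrightarrow>
     immersion_into_sphere M \<A> f \<and> (\<forall>(V, \<psi>)\<in>\<A>. \<forall>y\<in>V. mean_curvature (f \<circ> \<psi>) y = 0)"

(* Riemannian measure of the metric on M induced by f: the Borel measure on M which is
   sqrt(det g) dy in each chart. *)
definition riemannian_measure ::
  "'m::t2_space set \<Rightarrow> ('k::finite, 'm) atlas \<Rightarrow> ('m \<Rightarrow> 'a::euclidean_space) \<Rightarrow> 'm measure" where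
  "riemannian_measure M \<A> f =
     (THE \<mu>. sets \<mu> = sets (restrict_space borel M) \<and>
        (\<forall>(V, \<psi>)\<in>\<A>. \<forall>B\<in>sets borel. B \<subseteq> V \<longrightarrow>
           emeasure \<mu> (\<psi> ` B) = (\<integral>\<^sup>+y\<in>B. ennreal (sqrt (det (first_ff (f \<circ> \<psi>) y))) \<partial>lborel)))"

(* Computed on M, so points of the image are counted with multiplicity. *)
definition immersed_volume ::
  "'m::t2_space set \<Rightarrow> ('k::finite, 'm) atlas \<Rightarrow> ('m \<Rightarrow> 'a::euclidean_space) \<Rightarrow> real" where
  "immersed_volume M \<A> f = measure (riemannian_measure M \<A> f) M"

(* Number of sheets through p; the fibres of an immersion of a compact manifold are finite. *)
definition point_density :: "'m set \<Rightarrow> ('m \<Rightarrow> 'a) \<Rightarrow> 'a \<Rightarrow> nat" where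
  "point_density M f p = card {x\<in>M. f x = p}"


section \<open>Geodesic distance in the unit sphere\<close>

definition sdist :: "'a::euclidean_space \<Rightarrow> 'a \<Rightarrow> real" where
  "sdist x y = arccos (x \<bullet> y)"

(* Used for nonempty X only. *)
definition sdist_set :: "'a::euclidean_space \<Rightarrow> 'a set \<Rightarrow> real" where
  "sdist_set x X = (INF y\<in>X. sdist x y)"

definition scball :: "'a::euclidean_space \<Rightarrow> real \<Rightarrow> 'a set" where
  "scball x r = {y \<in> sphere 0 1. sdist x y \<le> r}"

definition antipodal_within :: "real \<Rightarrow> 'a::euclidean_space set \<Rightarrow> bool" where
  "antipodal_within \<epsilon> X \<longleftrightarrow> (\<forall>x\<in>X. sdist_set (- x) X \<le> \<epsilon>)"


section \<open>The function epsilon\<close>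

(* Volume of the unit j-sphere. *)
definition omega :: "nat \<Rightarrow> real" where
  "omega j = 2 * pi powr ((real j + 1) / 2) / Gamma ((real j + 1) / 2)"

lemma omega_unit_ball_vol: "omega j = (real j + 1) * unit_ball_vol (real j + 1)"
proof -
  define x where "x = (real j + 1) / 2"
  have x: "x > 0" and j: "real j + 1 = 2 * x"
    by (simp_all add: x_def)
  have "Gamma (x + 1) = x * Gamma x"
    by (rule Gamma_plus1) (use x in \<open>auto elim!: nonpos_Ints_cases\<close>)
  moreover have "Gamma x > 0"
    using x by (rule Gamma_real_pos)
  ultimately show ?thesis
    unfolding omega_def unit_ball_vol_def j using x by simp
qed

(* The power k/2 is a real exponent; 0 powr (k/2) = 0 covers \<epsilon> = 0. *)
definition eps :: "real \<Rightarrow> nat \<Rightarrow> real" where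
  "eps A k = (THE \<epsilon>. \<epsilon> \<in> {0..<pi / 2} \<and>
     integral {\<epsilon>..pi / 2} (\<lambda>t. sin t ^ (k - 1))
       + (1 - (cos \<epsilon>)\<^sup>2) powr (real k / 2) / (real k * cos \<epsilon>)
     = inverse (omega (k - 1)) * (A - omega k / 2))"

end

theory Submission
  imports Defs
begin

text \<open>Let \<open>u = \<langle>f, p\<rangle>\<close> be the height function and \<open>X\<close> its gradient, the tangential part of \<open>p\<close>.
  Minimality gives \<open>div X = - k u\<close>, so for \<open>h\<close> with \<open>h' \<ge> 0\<close> the divergence theorem applied to
  \<open>h(u) X\<close> and \<open>|X|\<^sup>2 \<le> 1 - u\<^sup>2\<close> yield \<open>0 \<le> \<integral> (h'(u) (1 - u\<^sup>2) - k u h(u))\<close>. Take for \<open>h\<close> the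
  solution of \<open>h' (1 - u\<^sup>2) - k u h = 1\<close> with \<open>h' = 0\<close> at \<open>u = - cos t\<close>, continued by a constant to the
  left and essentially by a constant close to \<open>u = 1\<close>. It blows up like \<open>C (1 - u\<^sup>2) powr (- k / 2)\<close> at \<open>u = 1\<close>,
  where \<open>C\<close> is the left-hand side of the equation defining \<open>eps\<close> at \<open>t\<close> plus \<open>\<integral>\<^sub>0\<^sup>\<pi>\<^sup>/\<^sup>2 sin\<^sup>k\<^sup>-\<^sup>1\<close>. Since the
  \<open>m\<close> sheets through \<open>p\<close> have asymptotically at least the volume of \<open>m\<close> flat balls, the inequality
  becomes \<open>m \<omega>\<^sub>k\<^sub>-\<^sub>1 C \<le> A\<close> whenever \<open>u \<ge> - cos t\<close>, and \<open>m \<omega>\<^sub>k\<^sub>-\<^sub>1 C \<le> A / cos t\<close> in general.\<close>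

section \<open>The function \<open>eps\<close>\<close>

text \<open>The differential equation is dictated by the great spheres through \<open>p\<close>:
  there the square of \<open>|X|\<close> equals 1 - u^2, so the estimate loses nothing. The one free
  constant of its solutions is spent on h' = 0 at u = - cos t, which lets h continue to the left as
  a constant with h' still continuous. That constant is 1 / (k cos t), whence the factor 1 / cos t
  in the general inequality. The two inequalities have different jobs. The general one, with t
  tending to 0, gives A / m >= omega_k, since C then tends to twice the integral of sin^(k-1) over
  [0, pi/2]. The sharper one applies to every t up to the distance of the image from the antipode of
  \<open>p\<close>, and compares that distance with \<open>eps\<close>. The singularity of h at u =
  1 is the obstacle to integrating by parts. So h follows the solution up to u = 1 - d only, and h'
  descends to 0 on an interval of length d^2. As d^2 is small compared with d, the region where h
  has become constant is asymptotically as large as the region u >= 1 - d, and nothing is lost as d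
  tends to 0.\<close>

definition sin_int :: "nat \<Rightarrow> real \<Rightarrow> real" where
  "sin_int k x = integral {0..x} (\<lambda>t. sin t ^ (k - 1))"

text \<open>The left-hand side of the equation for \<open>eps\<close>. Times
  \<open>omega (k - 1)\<close>, the first term is the volume of a hemisphere of the k-sphere minus a
  concentric geodesic ball of radius x, the second the volume of a flat k-ball of radius sin x
  divided by cos x.\<close>

definition cap_fun :: "nat \<Rightarrow> real \<Rightarrow> real" where
  "cap_fun k x = integral {x..pi/2} (\<lambda>t. sin t ^ (k - 1))
       + (1 - (cos x)\<^sup>2) powr (real k / 2) / (real k * cos x)"

lemma sin_power_integrable: "(\<lambda>t. sin t ^ j) integrable_on {a..b::real}"
  by (intro integrable_continuous_interval continuous_intros)

lemma sin_int_add: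
  assumes "0 \<le> a" "a \<le> b"
  shows "integral {a..b} (\<lambda>t. sin t ^ (k - 1)) = sin_int k b - sin_int k a"
  using Henstock_Kurzweil_Integration.integral_combine[OF assms sin_power_integrable[of "k-1" 0 b]]
  by (simp add: sin_int_def)

lemma sin_int_fun: "sin_int k = (\<lambda>x. integral {0..x} (\<lambda>t. sin t ^ (k - 1)))"
  by (simp add: sin_int_def fun_eq_iff)

lemma sin_int_deriv:
  assumes "0 < x"
  shows "(sin_int k has_real_derivative sin x ^ (k - 1)) (at x)"
proof -
  have "(sin_int k has_real_derivative sin x ^ (k - 1)) (at x within {0..x+1})"
    unfolding sin_int_fun
  proof (rule integral_has_real_derivative)
    show "continuous_on {0..x+1} (\<lambda>t. sin t ^ (k - 1))" by (intro continuous_intros)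
  qed (use assms in auto)
  then show ?thesis
    using assms at_within_Icc_at[of 0 x "x+1"] by simp
qed

lemma sin_int_cont: "continuous_on {0..b} (sin_int k)"
  unfolding sin_int_fun
  by (rule indefinite_integral_continuous_1) (rule sin_power_integrable)

lemma sin_int_0 [simp]: "sin_int k 0 = 0"
  by (simp add: sin_int_def)

text \<open>The sine is symmetric about pi/2, so \<open>sin_int k (pi - x) + sin_int k x\<close> has
  derivative zero.\<close>

lemma sin_int_reflect:
  assumes "0 \<le> x" "x \<le> pi"
  shows "sin_int k (pi - x) = sin_int k pi - sin_int k x"
proof (cases "x = 0")
  case True then show ?thesis by simp
next
  case False
  have "(\<lambda>x. sin_int k (pi - x) + sin_int k x) x = (\<lambda>x. sin_int k (pi - x) + sin_int k x) 0"
  proof (rule DERIV_isconst2[of 0 pi])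
    show "0 < pi" "0 \<le> x" "x \<le> pi" using assms by auto
    show "continuous_on {0..pi} (\<lambda>x. sin_int k (pi - x) + sin_int k x)"
      by (intro continuous_intros continuous_on_compose2[OF sin_int_cont[of pi]]) auto
  next
    fix x :: real assume x: "0 < x" "x < pi"
    show "((\<lambda>x. sin_int k (pi - x) + sin_int k x) has_real_derivative 0) (at x)"
      using x by (auto intro!: derivative_eq_intros DERIV_chain2[OF sin_int_deriv] sin_int_deriv)
  qed
  then show ?thesis by simp
qed

lemma sin_int_pi: "sin_int k pi = 2 * sin_int k (pi/2)"
  using sin_int_reflect[of "pi/2" k] by simp

lemma sin_int_mono:
  assumes "0 \<le> a" "a \<le> b" "b \<le> pi"
  shows "sin_int k a \<le> sin_int k b"
proof -
  have "integral {a..b} (\<lambda>t. sin t ^ (k - 1)) \<ge> 0"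
    by (rule Henstock_Kurzweil_Integration.integral_nonneg[OF sin_power_integrable])
       (use assms in \<open>auto intro!: zero_le_power sin_ge_zero\<close>)
  then show ?thesis using sin_int_add[of a b k] assms by simp
qed

text \<open>As sin x >= 0 on this range, the real power of 1 - cos^2 is the natural power sin^k,
  which is easier to differentiate.\<close>

lemma cap_fun_eq:
  assumes "1 \<le> k" "0 \<le> x" "x < pi/2"
  shows "cap_fun k x = sin_int k (pi/2) - sin_int k x + sin x ^ k / (real k * cos x)"
proof -
  have s: "sin x \<ge> 0" using assms by (intro sin_ge_zero) auto
  have e: "1 - (cos x)\<^sup>2 = (sin x)\<^sup>2" by (simp add: sin_squared_eq)
  have "((sin x)\<^sup>2) powr (real k / 2) = sin x ^ k"
  \<comment> \<open>At base 0 the real power is 0 by convention, which matches \<open>0 ^ k\<close>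
    because \<open>k\<close> is positive.\<close>
  proof (cases "sin x = 0")
    case True then show ?thesis using assms(1) by simp
  next
    case False
    then have "((sin x)\<^sup>2) powr (real k / 2) = (sin x powr 2) powr (real k / 2)"
      using s by simp
    also have "\<dots> = sin x powr real k"
      by (simp only: powr_powr) simp
    also have "\<dots> = sin x ^ k"
      using s False by (simp add: powr_realpow)
    finally show ?thesis .
  qed
  then show ?thesis
    unfolding cap_fun_def e using sin_int_add[of x "pi/2" k] assms by simp
qed

lemma cap_fun_cont:
  assumes "1 \<le> k" "b < pi/2"
  shows "continuous_on {0..b} (cap_fun k)"
proof -
  have "cos x \<noteq> 0" if "x \<in> {0..b}" for x
    using cos_gt_zero_pi[of x] that assms by auto
  then have "continuous_on {0..b} (\<lambda>x. sin_int k (pi/2) - sin_int k x + sin x ^ k / (real k * cos x))"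
    using assms by (intro continuous_intros sin_int_cont) auto
  then show ?thesis
    by (rule continuous_on_eq) (use assms cap_fun_eq[of k] in auto)
qed

text \<open>In the derivative the integral cancels against the numerator sin^k. Only the
  contribution of 1 / cos survives, namely sin^(k+1) / (k cos^2) > 0.\<close>

lemma cap_fun_strict_mono:
  assumes k: "1 \<le> k" and ab: "0 \<le> a" "a < b" "b < pi/2"
  shows "cap_fun k a < cap_fun k b"
proof -
  obtain j where j: "k = Suc j" using k by (cases k) auto
  define G where "G = (\<lambda>x. sin_int k (pi/2) - sin_int k x + sin x ^ k / (real k * cos x))"
  have "G a < G b"
  proof (rule DERIV_pos_imp_increasing_open[OF ab(2)])
    show "continuous_on {a..b} G"
      using cap_fun_cont[OF k, of b] ab
      by (intro continuous_on_eq[of _ "cap_fun k" G] continuous_on_subset[OF cap_fun_cont[OF k, of b]])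
         (auto simp: G_def cap_fun_eq[OF k])
    fix x assume x: "a < x" "x < b"
    have c: "cos x > 0" and s: "sin x > 0"
      using x ab by (auto intro!: cos_gt_zero_pi sin_gt_zero)
    have "(G has_real_derivative - (sin x ^ j) +
        (real k * (sin x ^ j * cos x) * (real k * cos x) + sin x ^ k * (real k * sin x)) / (real k * cos x)\<^sup>2) (at x)"
      unfolding G_def
      by (rule DERIV_cong[OF DERIV_add[OF DERIV_diff[OF DERIV_const sin_int_deriv]
            DERIV_divide[OF DERIV_power[OF DERIV_sin] DERIV_cmult[OF DERIV_cos]]]])
         (use x ab c k in \<open>auto simp: j power2_eq_square\<close>)
    moreover have "- (sin x ^ j) +
        (real k * (sin x ^ j * cos x) * (real k * cos x) + sin x ^ k * (real k * sin x)) / (real k * cos x)\<^sup>2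
        = sin x ^ (k+1) / (real k * (cos x)\<^sup>2)"
    proof -
      \<comment> \<open>With sin^(k-1) and sin^k as variables S and T, linked only by T = s * S,
        this is plain arithmetic of fractions.\<close>
      have "- S + (K * (S * c) * (K * c) + T * (K * s)) / (K * c)\<^sup>2 = s * T / (K * c\<^sup>2)"
        if "K \<noteq> 0" "c \<noteq> 0" "T = s * S" for K S c s T :: real
        using that by (simp add: field_simps power2_eq_square)
      from this[of "real k" "cos x" "sin x ^ k" "sin x" "sin x ^ j"] show ?thesis
        using c k by (simp add: j)
    qed
    moreover have "sin x ^ (k+1) / (real k * (cos x)\<^sup>2) > 0"
      using c s k by simp
    ultimately show "\<exists>y. DERIV G x :> y \<and> 0 < y" by metis
  qed
  then show ?thesis using cap_fun_eq[OF k] ab by (simp add: G_def)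
qed

lemma cap_fun_mono:
  assumes "1 \<le> k" "0 \<le> a" "a \<le> b" "b < pi/2"
  shows "cap_fun k a \<le> cap_fun k b"
  using cap_fun_strict_mono[of k a b] assms by (cases "a = b") auto

lemma cap_fun_0: "1 \<le> k \<Longrightarrow> cap_fun k 0 = sin_int k (pi/2)"
  by (subst cap_fun_eq) auto

text \<open>The term sin^k / (k cos) tends to infinity as cos decreases to 0. The bound
  \<open>d\<close> lets the witness be kept away from 0 when a positive angle is required.\<close>

lemma cap_fun_unbounded:
  assumes k: "1 \<le> k" and d: "d < pi/2"
  shows "\<exists>x. 0 \<le> x \<and> d \<le> x \<and> x < pi/2 \<and> C < cap_fun k x"
proof -
  have "filterlim (\<lambda>x. sin x ^ k / real k * inverse (cos x)) at_top (at_left (pi/2))"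
  proof (rule filterlim_tendsto_pos_mult_at_top)
    show "((\<lambda>x. sin x ^ k / real k) \<longlongrightarrow> sin (pi/2) ^ k / real k) (at_left (pi/2))"
      by (intro tendsto_intros) (use k in auto)
    show "0 < sin (pi/2) ^ k / real k" using k by simp
    show "filterlim (\<lambda>x. inverse (cos x)) at_top (at_left (pi/2))"
    proof (rule filterlim_inverse_at_top)
      have "(cos \<longlongrightarrow> cos (pi/2)) (at_left (pi/2))" by (intro tendsto_intros)
      then show "(cos \<longlongrightarrow> 0) (at_left (pi/2))" by simp
      show "\<forall>\<^sub>F x in at_left (pi/2). 0 < cos x"
        using eventually_at_left_real[OF pi_half_gt_zero]
        by (rule eventually_mono) (auto intro!: cos_gt_zero)
    qed
  qed
  then have "\<forall>\<^sub>F x in at_left (pi/2). C < sin x ^ k / real k * inverse (cos x)"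
    by (simp add: filterlim_at_top_dense)
  moreover have "\<forall>\<^sub>F x in at_left (pi/2). x \<in> {max 0 d<..<pi/2}"
    by (rule eventually_at_left_real) (use d in \<open>auto simp: max_def\<close>)
  ultimately have "\<forall>\<^sub>F x in at_left (pi/2). C < sin x ^ k / real k * inverse (cos x) \<and> x \<in> {max 0 d<..<pi/2}"
    by eventually_elim auto
  then obtain x where x: "C < sin x ^ k / real k * inverse (cos x)" "0 < x" "d < x" "x < pi/2"
    using eventually_happens'[of "at_left (pi/2)"] by force
  have "cap_fun k x \<ge> sin x ^ k / real k * inverse (cos x)"
  proof -
    have "sin x ^ k / real k * inverse (cos x) = sin x ^ k / (real k * cos x)"
      by (simp add: divide_inverse)
    then show ?thesis using cap_fun_eq[OF k, of x] sin_int_mono[of x "pi/2" k] x by linarith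
  qed
  with x show ?thesis by (intro exI[of _ x]) auto
qed

section \<open>Volumes of unit spheres\<close>

lemma omega_pos: "omega j > 0"
proof -
  have "Gamma ((real j + 1)/2) > 0" by (rule Gamma_real_pos) auto
  then show ?thesis by (simp add: omega_def)
qed

text \<open>Two dimensions more raise the argument of Gamma by one.\<close>

lemma omega_rec: "omega (j + 2) = 2 * pi / (real j + 1) * omega j"
proof -
  define x where "x = (real j + 1) / 2"
  have x: "x > 0" by (simp add: x_def)
  have e: "(real (j + 2) + 1) / 2 = x + 1" by (simp add: x_def field_simps)
  have G: "Gamma (x + 1) = x * Gamma x"
    by (rule Gamma_plus1) (use x in \<open>auto elim!: nonpos_Ints_cases\<close>)
  have p: "pi powr (x + 1) = pi powr x * pi" by (simp add: powr_add)
  have "Gamma x > 0"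
    using x by (rule Gamma_real_pos)
  then have "2 * (pi powr x * pi) / (x * Gamma x) = 2 * pi / (2 * x) * (2 * pi powr x / Gamma x)"
    using x by (simp add: field_simps)
  also have "2 * x = real j + 1" by (simp add: x_def)
  finally show ?thesis unfolding omega_def e G p x_def[symmetric] .
qed

text \<open>The function sin^(j+1) cos vanishes at 0 and pi/2, and its derivative is (j+1) sin^j -
  (j+2) sin^(j+2). Indices are shifted by one because \<open>sin_int k\<close> integrates
  sin^(k-1).\<close>

lemma sin_int_half_rec:
  "real (j + 2) * sin_int (j + 3) (pi/2) = real (j+1) * sin_int (j + 1) (pi/2)"
proof -
  have "((\<lambda>t. real (j+1) * sin t ^ j - real (j+2) * sin t ^ (j+2)) has_integral
        (sin (pi/2) ^ (j+1) * cos (pi/2) - sin 0 ^ (j+1) * cos 0)) {0..pi/2}"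
  proof (rule fundamental_theorem_of_calculus)
    fix x :: real
    have c: "cos x * cos x = 1 - sin x * sin x"
      by (metis add_diff_cancel_right' sin_cos_squared_add3)
    have "((\<lambda>a. sin a ^ (j + 1)) has_real_derivative real (j+1) * (cos x * sin x ^ j)) (at x within {0..pi/2})"
      using DERIV_power[OF DERIV_subset[OF DERIV_sin subset_UNIV], where n="j+1"] by simp
    from DERIV_mult[OF this DERIV_subset[OF DERIV_cos subset_UNIV]]
    have "((\<lambda>a. sin a ^ (j + 1) * cos a) has_real_derivative
        real (j+1) * sin x ^ j * (cos x * cos x) - sin x ^ (j+1) * sin x) (at x within {0..pi/2})"
      by (rule DERIV_cong) (simp add: algebra_simps)
    also have "real (j+1) * sin x ^ j * (cos x * cos x) - sin x ^ (j+1) * sin x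
       = real (j+1) * sin x ^ j - real (j+2) * sin x ^ (j+2)"
      unfolding c by (simp add: algebra_simps)
    finally show "((\<lambda>a. sin a ^ (j + 1) * cos a) has_vector_derivative
        real (j+1) * sin x ^ j - real (j+2) * sin x ^ (j+2)) (at x within {0..pi/2})"
      by (simp add: has_real_derivative_iff_has_vector_derivative)
  qed auto
  then have "integral {0..pi/2} (\<lambda>t. real (j+1) * sin t ^ j - real (j+2) * sin t ^ (j+2)) = 0"
    by (simp add: integral_unique)
  moreover have "integral {0..pi/2} (\<lambda>t. real (j+1) * sin t ^ j - real (j+2) * sin t ^ (j+2)) =
      real (j+1) * integral {0..pi/2} (\<lambda>t. sin t ^ j) - real (j+2) * integral {0..pi/2} (\<lambda>t. sin t ^ (j+2))"
    by (subst integral_diff)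
       (auto intro!: integrable_on_mult_right sin_power_integrable simp del: power_Suc of_nat_Suc of_nat_add)
  ultimately have "real (j+1) * integral {0..pi/2} (\<lambda>t. sin t ^ j) = real (j+2) * integral {0..pi/2} (\<lambda>t. sin t ^ (j+2))"
    by linarith
  then show ?thesis by (simp add: sin_int_def numeral_eq_Suc)
qed

text \<open>This is the volume of a sphere sliced into spheres of latitude. Both sides obey the same
  recursion of step two, hence the two base cases.\<close>

lemma omega_sin_int: "omega (Suc j) = 2 * omega j * sin_int (Suc j) (pi/2)"
proof (induction j rule: induct_nat_012)
  case 0
  have "sin_int (Suc 0) (pi/2) = pi/2" by (simp add: sin_int_def)
  then show ?case by (simp add: omega_def Gamma_one_half_real powr_half_sqrt)
next
  case 1
  have g: "Gamma (3/2 :: real) = sqrt pi / 2"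
  proof -
    have "(1/2 :: real) \<notin> \<int>\<^sub>\<le>\<^sub>0"
      by (meson half_gt_zero nonpos_Ints_nonpos not_le zero_less_one)
    then show ?thesis using Gamma_plus1[of "1/2 :: real"] by (simp add: Gamma_one_half_real)
  qed
  have "((\<lambda>t. sin t) has_integral (- cos (pi/2) - (- cos 0))) {0..pi/2}"
    by (rule fundamental_theorem_of_calculus)
       (auto intro!: derivative_eq_intros simp: has_real_derivative_iff_has_vector_derivative[symmetric])
  then have "sin_int (Suc (Suc 0)) (pi/2) = 1"
    by (simp add: sin_int_def integral_unique)
  moreover have "pi powr (3/2) = pi * sqrt pi"
    using powr_add[of pi 1 "1/2"] by (simp add: powr_half_sqrt)
  ultimately show ?case by (simp add: omega_def g)
next
  case (ge2 j)
  have 1: "omega (Suc (Suc (Suc j))) = 2 * pi / (real j + 2) * omega (Suc j)"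
    using omega_rec[of "Suc j"] by (simp add: algebra_simps)
  have 2: "omega (Suc (Suc j)) = 2 * pi / (real j + 1) * omega j"
    using omega_rec[of j] by (simp add: algebra_simps)
  have 3: "(real j + 2) * sin_int (Suc (Suc (Suc j))) (pi/2) = (real j + 1) * sin_int (Suc j) (pi/2)"
    using sin_int_half_rec[of j] by (simp add: numeral_eq_Suc algebra_simps)
  have 4: "sin_int (Suc (Suc (Suc j))) (pi/2) = (real j + 1) / (real j + 2) * sin_int (Suc j) (pi/2)"
    using 3 by (simp add: field_simps)
  have "2 * pi / (J + 2) * (2 * w * S) = 2 * (2 * pi / (J + 1) * w) * ((J + 1) / (J + 2) * S)"
    if "J \<ge> 0" for J w S :: real
    using that by (simp add: divide_simps)
  then show ?case unfolding 1 2 4 ge2.IH(1) by simp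
qed

text \<open>Existence is the intermediate value theorem up to a point where \<open>cap_fun\<close>
  exceeds the target; uniqueness is strict monotonicity.\<close>

lemma eps_ex1:
  assumes k: "1 \<le> k" and a: "omega k \<le> a"
  shows "\<exists>!x. x \<in> {0..<pi/2} \<and> cap_fun k x = inverse (omega (k - 1)) * (a - omega k / 2)"
proof -
  let ?R = "inverse (omega (k - 1)) * (a - omega k / 2)"
  obtain j where j: "k = Suc j" using k by (cases k) auto
  have pos: "omega (k - 1) > 0" by (rule omega_pos)
  \<comment> \<open>The value at 0 is the target belonging to a = omega_k, so the hypothesis on
    \<open>a\<close> says that the target is not too small.\<close>
  have "cap_fun k 0 = inverse (omega (k - 1)) * (omega k / 2)"
    using omega_sin_int[of j] pos cap_fun_0[OF k] by (simp add: j)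
  also have "\<dots> \<le> ?R" using pos a by (intro mult_left_mono) auto
  finally have lo: "cap_fun k 0 \<le> ?R" .
  obtain b where b: "0 \<le> b" "b < pi/2" "?R < cap_fun k b"
    using cap_fun_unbounded[OF k, of 0 ?R] by auto
  obtain x where x: "0 \<le> x" "x \<le> b" "cap_fun k x = ?R"
    using IVT'[of "cap_fun k" 0 ?R b] lo b cap_fun_cont[OF k b(2)] by auto
  show ?thesis
  proof (rule ex1I[of _ x])
    show "x \<in> {0..<pi/2} \<and> cap_fun k x = ?R" using x b by auto
    fix y assume y: "y \<in> {0..<pi/2} \<and> cap_fun k y = ?R"
    show "y = x"
      using cap_fun_strict_mono[OF k, of x y] cap_fun_strict_mono[OF k, of y x] x y b
      by (cases x y rule: linorder_cases) auto
  qed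
qed

lemma eps_spec:
  assumes "1 \<le> k" "omega k \<le> a"
  shows "0 \<le> eps a k" "eps a k < pi/2"
    "cap_fun k (eps a k) = inverse (omega (k - 1)) * (a - omega k / 2)"
  using theI'[OF eps_ex1[OF assms]] unfolding eps_def cap_fun_def by auto

text \<open>The form in which a distance is compared with \<open>eps\<close>: by strict monotonicity
  it suffices to bound \<open>cap_fun\<close> at that distance.\<close>

lemma le_eps:
  assumes "1 \<le> k" "omega k \<le> a" "0 \<le> d" "d < pi/2"
    and "cap_fun k d \<le> inverse (omega (k - 1)) * (a - omega k / 2)"
  shows "d \<le> eps a k"
  using cap_fun_strict_mono[OF assms(1), of "eps a k" d] eps_spec[OF assms(1,2)] assms by force

lemma eps_mono:
  assumes "1 \<le> k" "omega k \<le> a" "a \<le> b"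
  shows "eps a k \<le> eps b k"
proof (rule le_eps)
  show "cap_fun k (eps a k) \<le> inverse (omega (k - 1)) * (b - omega k / 2)"
    using eps_spec(3)[OF assms(1,2)] omega_pos[of "k-1"] assms by (auto intro!: mult_left_mono)
qed (use assms eps_spec[OF assms(1,2)] in auto)

section \<open>The test function\<close>

text \<open>The general solution g of g' (1 - u^2) - k u g = 1. The integrating factor (1 -
  u^2)^(k/2) turns the equation into the derivative of g (1 - u^2)^(k/2) being (1 - u^2)^(k/2 - 1),
  and u = cos r turns the right side into the derivative of \<open>- sin_int k (arccos u)\<close>.
  \<open>C\<close> is the constant of integration.\<close>

definition profile :: "nat \<Rightarrow> real \<Rightarrow> real \<Rightarrow> real" where
  "profile k C u = (C - sin_int k (arccos u)) / sqrt (1 - u\<^sup>2) ^ k"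

lemma profile_deriv:
  assumes k: "1 \<le> k" and u: "-1 < u" "u < 1"
  shows "(profile k C has_real_derivative (1 + real k * u * profile k C u) / (1 - u\<^sup>2)) (at u)"
proof -
  define s where "s = sqrt (1 - u\<^sup>2)"
  define N where "N = C - sin_int k (arccos u)"
  obtain j where j: "k = Suc j" using k by (cases k) auto
  have u2: "u\<^sup>2 < 1" using u by (simp add: abs_square_less_1)
  then have s: "s > 0" by (simp add: s_def)
  have s2: "s * s = 1 - u\<^sup>2" using u2 by (simp add: s_def)
  have sa: "sin (arccos u) = s" using u by (simp add: sin_arccos s_def)
  have "arccos u > 0" using u arccos_lt_bounded by auto
  then have d1: "((\<lambda>u. sin_int k (arccos u)) has_real_derivative s ^ j * inverse (- s)) (at u)"
    using DERIV_chain2[OF sin_int_deriv DERIV_arccos[OF u], of k] by (simp add: sa j s_def)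
  have d2: "((\<lambda>u. sqrt (1 - u\<^sup>2)) has_real_derivative (- (u / s))) (at u)"
    using u2 by (auto intro!: derivative_eq_intros simp: s_def field_simps)
  have "(profile k C has_real_derivative
     ((0 - s ^ j * inverse (- s)) * s ^ k - N * (real k * (- (u / s) * s ^ (k - Suc 0)))) / (s ^ k * s ^ k)) (at u)"
    unfolding profile_def [abs_def] N_def s_def
    by (rule DERIV_divide[OF DERIV_diff[OF DERIV_const d1[unfolded s_def]] DERIV_power[OF d2[unfolded s_def]], of k])
       (use u2 in auto)
  moreover have "((0 - S * inverse (- s)) * T - N * (K * (- (u / s) * S))) / (T * T)
       = (1 + K * u * (N / T)) / (s * s)" if "T = s * S" "S \<noteq> 0" for S T K
    using s that by (simp add: field_simps)
  from this[of "s ^ k" "s ^ j" "real k"] s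
  have "((0 - s ^ j * inverse (- s)) * s ^ k - N * (real k * (- (u / s) * s ^ (k - Suc 0)))) / (s ^ k * s ^ k)
       = (1 + real k * u * (N / s ^ k)) / (s * s)" by (simp add: j)
  ultimately show ?thesis by (simp add: profile_def N_def s_def[symmetric] s2)
qed

lemma sin_int_nonneg: "0 \<le> x \<Longrightarrow> x \<le> pi \<Longrightarrow> 0 \<le> sin_int k x"
  using sin_int_mono[of 0 x k] by simp

text \<open>\<open>C\<close> is chosen for this value: it makes 1 + k u g(u) vanish at u = - cos t,
  and with it the derivative of the profile.\<close>

lemma profile_left:
  assumes k: "1 \<le> k" and t: "0 < t" "t < pi/2" and C: "C = cap_fun k t + sin_int k (pi/2)"
  shows "profile k C (- cos t) = 1 / (real k * cos t)"
proof -
  have s: "sin t > 0" using t by (intro sin_gt_zero) auto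
  have "arccos (- cos t) = pi - t" using t arccos_cos[of "pi - t"] by simp
  moreover have "sqrt (1 - (- cos t)\<^sup>2) = sin t" using s by (simp add: sin_squared_eq[symmetric])
  moreover have "C - sin_int k (pi - t) = sin t ^ k / (real k * cos t)"
    using sin_int_reflect[of t k] sin_int_pi[of k] cap_fun_eq[OF k, of t] t by (simp add: C)
  ultimately show ?thesis using s by (simp add: profile_def)
qed

text \<open>This is the numerator of the derivative of the profile. For u >= 0 the profile itself is
  nonnegative. For u = - cos r < 0 one has r >= t, and replacing \<open>cap_fun k t\<close> by the
  larger \<open>cap_fun k r\<close> bounds the profile by 1 / (k cos r), the value that
  \<open>profile_left\<close> gives for r.\<close>

lemma profile_nonneg:
  assumes k: "1 \<le> k" and t: "0 < t" "t < pi/2" and C: "C = cap_fun k t + sin_int k (pi/2)"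
    and u: "- cos t \<le> u" "u < 1"
  shows "0 \<le> 1 + real k * u * profile k C u"
proof -
  define s where "s = sqrt (1 - u\<^sup>2)"
  have ct: "0 < cos t" "cos t < 1" using t cos_gt_zero_pi[of t] cos_monotone_0_pi[of 0 t] by auto
  have u1: "-1 < u" using u ct by simp
  have u2: "u\<^sup>2 < 1" using u u1 by (simp add: abs_square_less_1)
  then have s: "s > 0" by (simp add: s_def)
  show ?thesis
  proof (cases "u \<ge> 0")
    case True
    have "sin_int k (arccos u) \<le> sin_int k (pi/2)"
      using True u by (intro sin_int_mono arccos_lbound arccos_le_pi2) auto
    moreover have "cap_fun k t \<ge> 0"
      using cap_fun_mono[OF k, of 0 t] cap_fun_0[OF k] sin_int_nonneg[of "pi/2" k] t by simp
    ultimately have "profile k C u \<ge> 0" using s by (simp add: profile_def C s_def)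
    then show ?thesis using True by simp
  next
    case False
    define r where "r = pi - arccos u"
    have c: "cos r = - u" using u u1 by (simp add: r_def)
    have sr: "sin r = s" using u u1 by (simp add: r_def sin_arccos s_def)
    have "arccos u \<le> arccos (- cos t)" using u ct by (intro arccos_le_arccos) auto
    also have "arccos (- cos t) = pi - t" using t arccos_cos[of "pi - t"] by simp
    finally have rt: "t \<le> r" by (simp add: r_def)
    have "arccos 0 < arccos u" using False u1 u by (intro arccos_less_arccos) auto
    then have rp: "r < pi/2" by (simp add: r_def)
    have "sin_int k (arccos u) = sin_int k pi - sin_int k r"
      using sin_int_reflect[of r k] rt rp t by (simp add: r_def)
    then have N: "C - sin_int k (arccos u) = cap_fun k t - sin_int k (pi/2) + sin_int k r"
      using sin_int_pi[of k] by (simp add: C)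
    have "cap_fun k t \<le> cap_fun k r" using t rt rp by (intro cap_fun_mono[OF k]) auto
    then have "C - sin_int k (arccos u) \<le> s ^ k / (real k * (- u))"
      using cap_fun_eq[OF k, of r] rt t rp unfolding N by (simp add: sr c)
    then have "profile k C u \<le> s ^ k / (real k * (- u)) / s ^ k"
      unfolding profile_def s_def[symmetric] using s by (intro divide_right_mono) auto
    also have "\<dots> = 1 / (real k * (- u))" using s by simp
    finally have le: "profile k C u \<le> 1 / (real k * (- u))" .
    have "0 \<le> real k * (- u)" using False by (intro mult_nonneg_nonneg) auto
    from mult_left_mono[OF le this]
    have "real k * (- u) * profile k C u \<le> real k * (- u) * (1 / (real k * (- u)))" .
    moreover have "real k * (- u) * (1 / (real k * (- u))) = 1" using False k by simp
    ultimately show ?thesis by simp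
  qed
qed

text \<open>The derivative is designed first and integrated afterwards: zero up to - cos t, the
  derivative of the profile up to \<open>b\<close>, then a descent to zero on [b, b + e]. Its
  continuity makes the test function admissible for integration by parts.\<close>

lemma test_function:
  assumes k: "1 \<le> k" and t: "0 < t" "t < pi/2" and C: "C = cap_fun k t + sin_int k (pi/2)"
    and b: "0 < b" "b < 1" and e: "0 < e" "b + e \<le> 1"
  obtains h h' where
    "\<And>u. -1 \<le> u \<Longrightarrow> u \<le> 1 \<Longrightarrow> (h has_real_derivative h' u) (at u)"
    "continuous_on UNIV h'" "\<And>u. 0 \<le> h' u"
    "\<And>u. -1 \<le> u \<Longrightarrow> u \<le> 1 \<Longrightarrow> h' u * (1 - u\<^sup>2) - real k * u * h u \<le> 1 / cos t"
    "\<And>u. - cos t \<le> u \<Longrightarrow> u \<le> 1 \<Longrightarrow> h' u * (1 - u\<^sup>2) - real k * u * h u \<le> 1"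
    "\<And>u. b + e \<le> u \<Longrightarrow> u \<le> 1 \<Longrightarrow> h' u * (1 - u\<^sup>2) - real k * u * h u \<le> - real k * b * profile k C b"
proof -
  define a where "a = - cos t"
  have ct: "0 < cos t" "cos t < 1" using t cos_gt_zero_pi[of t] cos_monotone_0_pi[of 0 t] by auto
  have a: "-1 < a" "a < 0" using ct by (auto simp: a_def)
  define g where "g = profile k C"
  define g' where "g' = (\<lambda>u. (1 + real k * u * g u) / (1 - u\<^sup>2))"
  have gd: "(g has_real_derivative g' u) (at u)" if "-1 < u" "u < 1" for u
    unfolding g_def g'_def by (rule profile_deriv[OF k that])
  have sq: "u\<^sup>2 < 1" if "-1 < u" "u < 1" for u :: real
    using that by (simp add: abs_square_less_1)
  have gc: "continuous_on {a..b} g"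
    by (intro continuous_at_imp_continuous_on ballI DERIV_isCont[OF gd]) (use a b in auto)
  have gc': "continuous_on {a..b} g'"
    unfolding g'_def
  proof (intro continuous_intros gc ballI)
    fix u assume "u \<in> {a..b}"
    then show "1 - u\<^sup>2 \<noteq> 0" using sq[of u] a b by auto
  qed
  have gnn: "0 \<le> g' u" if "a \<le> u" "u < 1" for u
    unfolding g'_def g_def using that a sq[of u]
    by (intro divide_nonneg_pos profile_nonneg[OF k t C]) (auto simp: a_def)
  have ga: "g a = 1 / (real k * cos t)" unfolding g_def a_def by (rule profile_left[OF k t C])
  have ga': "g' a = 0" using k ct unfolding g'_def ga by (simp add: a_def)
  \<comment> \<open>The pieces fit together: \<open>g'\<close> vanishes at \<open>a\<close>, and the
    ramp starts at \<open>g' b\<close> and is held at 0 by the maximum from b + e on.\<close>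
  define q where "q = (\<lambda>u. if u \<le> a then 0 else if u \<le> b then g' u else g' b * max 0 (1 - (u - b) / e))"
  have q1: "continuous_on {b..} (\<lambda>u. g' b * max 0 (1 - (u - b) / e))"
    using e by (intro continuous_intros) auto
  have q2: "continuous_on ({a..b} \<union> {b..}) (\<lambda>u. if u \<le> b then g' u else g' b * max 0 (1 - (u - b) / e))"
    by (rule continuous_on_cases[OF _ _ gc' q1]) auto
  have e1: "{a..b} \<union> {b..} = {a..}" using a b by auto
  have "continuous_on ({..a} \<union> {a..}) (\<lambda>u. if u \<le> a then 0 else if u \<le> b then g' u else g' b * max 0 (1 - (u - b) / e))"
    by (rule continuous_on_cases[OF _ _ _ q2[unfolded e1]]) (use a b ga' in auto)
  moreover have "{..a} \<union> {a..} = UNIV" by auto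
  ultimately have qc: "continuous_on UNIV q" by (simp add: q_def)
  have qnn: "0 \<le> q u" for u
    using gnn[of u] gnn[of b] a b by (auto simp: q_def)
  \<comment> \<open>The lower limit -2 leaves room for a two-sided derivative at -1. As
    \<open>q\<close> is zero up to \<open>a\<close>, the function equals \<open>g a\<close>
    there.\<close>
  define h where "h = (\<lambda>u. g a + integral {-2..u} q)"
  have hd: "(h has_real_derivative q u) (at u)" if "-2 < u" "u < 2" for u
  proof -
    have "((\<lambda>u. integral {-2..u} q) has_real_derivative q u) (at u within {-2..2})"
      by (rule integral_has_real_derivative) (use that continuous_on_subset[OF qc] in auto)
    then have "((\<lambda>u. integral {-2..u} q) has_real_derivative q u) (at u)"
      using that at_within_Icc_at[of "-2" u 2] by simp
    then show ?thesis unfolding h_def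
      using DERIV_add[OF DERIV_const] by fastforce
  qed
  have hl: "h u = g a" if "u \<le> a" for u
  proof -
    have "integral {-2..u} q = integral {-2..u} (\<lambda>_. 0)"
      by (rule Henstock_Kurzweil_Integration.integral_cong) (use that in \<open>auto simp: q_def\<close>)
    then show ?thesis by (simp add: h_def)
  qed
  have hm: "h u = g u" if "a \<le> u" "u \<le> b" for u
  proof -
    have "(\<lambda>u. h u - g u) u = (\<lambda>u. h u - g u) a"
    proof (rule DERIV_isconst2[of a b])
      show "a < b" "a \<le> u" "u \<le> b" using a b that by auto
      show "continuous_on {a..b} (\<lambda>u. h u - g u)"
        by (intro continuous_on_diff gc continuous_at_imp_continuous_on ballI DERIV_isCont[OF hd]) (use a b in auto)
      fix x assume "a < x" "x < b"
      then show "((\<lambda>u. h u - g u) has_real_derivative 0) (at x)"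
        using DERIV_diff[OF hd[of x] gd[of x]] a b by (simp add: q_def)
    qed
    then show ?thesis by (simp add: hl)
  qed
  have hr: "g b \<le> h u" if "b \<le> u" "u \<le> 1" for u
  proof -
    have "h b \<le> h u"
      by (rule DERIV_nonneg_imp_nondecreasing[OF that(1)]) (use hd qnn that a b in force)
    then show ?thesis using hm[of b] a b by simp
  qed
  have gb: "0 \<le> g b"
  proof -
    have "h a \<le> h b"
      by (rule DERIV_nonneg_imp_nondecreasing) (use hd qnn a b in force)+
    then have "1 / (real k * cos t) \<le> g b" using hm[of b] hm[of a] a b ga by simp
    moreover have "0 \<le> 1 / (real k * cos t)" using ct by simp
    ultimately show ?thesis by linarith
  qed
  have ode: "g' u * (1 - u\<^sup>2) - real k * u * g u = 1" if "-1 < u" "u < 1" for u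
    using sq[OF that] by (simp add: g'_def)
  \<comment> \<open>For u >= b > 0 the factor 1 - u^2 only shrinks while u h(u) only grows, so both
    may be frozen at \<open>b\<close>.\<close>
  have right: "q u * (1 - u\<^sup>2) - real k * u * h u \<le> q u * (1 - b\<^sup>2) - real k * b * g b"
    if "b \<le> u" "u \<le> 1" for u
  proof -
    have "b\<^sup>2 \<le> u\<^sup>2" using that b by (intro power_mono) auto
    then have "q u * (1 - u\<^sup>2) \<le> q u * (1 - b\<^sup>2)" using qnn by (intro mult_left_mono) auto
    moreover have "b * g b \<le> u * h u" using that b gb hr[OF that] by (intro mult_mono) auto
    then have "real k * (b * g b) \<le> real k * (u * h u)" by (rule mult_left_mono) auto
    ultimately show ?thesis by (simp add: mult.assoc)
  qed
  have main: "q u * (1 - u\<^sup>2) - real k * u * h u \<le> 1" if "a \<le> u" "u \<le> 1" for u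
  proof (cases "u \<le> b")
    case True
    have "q u = g' u" using that True ga' by (auto simp: q_def)
    then show ?thesis using ode[of u] hm[of u] that True a b by simp
  next
    case False
    have "q u = g' b * max 0 (1 - (u - b) / e)" using False a b by (simp add: q_def)
    also have "\<dots> \<le> g' b * 1" using False e gnn[of b] a b by (intro mult_left_mono) auto
    finally have "q u * (1 - b\<^sup>2) \<le> g' b * (1 - b\<^sup>2)" using sq[of b] b by (intro mult_right_mono) auto
    then show ?thesis using right[of u] ode[of b] False that b by simp
  qed
  have left: "q u * (1 - u\<^sup>2) - real k * u * h u \<le> 1 / cos t" if "-1 \<le> u" "u \<le> 1" for u
  proof (cases "a \<le> u")
    case True
    then have "q u * (1 - u\<^sup>2) - real k * u * h u \<le> 1" using main that by simp
    also have "1 \<le> 1 / cos t" using ct by simp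
    finally show ?thesis .
  next
    case False
    \<comment> \<open>Left of \<open>a\<close> the function is the constant 1 / (k cos t); this is
      where the weaker bound 1 / cos t comes from.\<close>
    then have "q u * (1 - u\<^sup>2) - real k * u * h u = - u / cos t"
      using hl[of u] ga k by (simp add: q_def)
    also have "\<dots> \<le> 1 / cos t" using that ct by (intro divide_right_mono) auto
    finally show ?thesis .
  qed
  have far: "q u * (1 - u\<^sup>2) - real k * u * h u \<le> - real k * b * g b" if "b + e \<le> u" "u \<le> 1" for u
  proof -
    have "q u = 0" using that e a b by (auto simp: q_def max_def field_simps)
    then show ?thesis using right[of u] that e by simp
  qed
  show thesis
    by (rule that[of h q]) (use hd qc qnn left main far in \<open>auto simp: a_def g_def\<close>)
qed

section \<open>Gram determinants\<close>

text \<open>In the Leibniz formula a permutation other than the identity moves at least two indices.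
  Differentiating one factor therefore leaves an off-diagonal entry of the identity, which is 0, and
  only the diagonal product contributes.\<close>

lemma det_has_derivative_at_id:
  fixes A :: "'b::real_normed_vector \<Rightarrow> real^'n^'n"
  assumes d: "\<And>i j. ((\<lambda>y. A y $ i $ j) has_derivative (\<lambda>h. A' h $ i $ j)) (at x)"
    and I: "A x = mat 1"
  shows "((\<lambda>y. det (A y)) has_derivative (\<lambda>h. trace (A' h))) (at x)"
proof -
  let ?P = "{p. p permutes (UNIV :: 'n set)}"
  have "((\<lambda>y. det (A y)) has_derivative
      (\<lambda>h. \<Sum>p\<in>?P. of_int (sign p) * (\<Sum>i\<in>UNIV. A' h $ i $ p i * (\<Prod>j\<in>UNIV - {i}. A x $ j $ p j)))) (at x)"
    unfolding det_def
    by (intro has_derivative_sum has_derivative_mult_right has_derivative_prod d)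
  moreover have "(\<Sum>p\<in>?P. of_int (sign p) * (\<Sum>i\<in>UNIV. A' h $ i $ p i * (\<Prod>j\<in>UNIV - {i}. A x $ j $ p j))) = trace (A' h)" for h
  proof -
    have "(\<Sum>i\<in>UNIV. A' h $ i $ p i * (\<Prod>j\<in>UNIV - {i}. A x $ j $ p j)) = 0"
      if p: "p permutes UNIV" "p \<noteq> id" for p :: "'n \<Rightarrow> 'n"
    proof (rule sum.neutral, rule ballI)
      fix i :: 'n
      have "\<exists>j. j \<noteq> i \<and> p j \<noteq> j"
      proof (rule ccontr)
        assume "\<not> ?thesis"
        then have a: "\<And>j. j \<noteq> i \<Longrightarrow> p j = j" by auto
        then have "p i = i" using p(1) by (metis permutes_def)
        then show False using a p(2) by (metis eq_id_iff)
      qed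
      then obtain j where "j \<noteq> i" "p j \<noteq> j" by auto
      then have "\<exists>j\<in>UNIV - {i}. A x $ j $ p j = 0" by (intro bexI[of _ j]) (auto simp: I mat_def)
      then have "(\<Prod>j\<in>UNIV - {i}. A x $ j $ p j) = 0" by (auto simp: prod_zero_iff)
      then show "A' h $ i $ p i * (\<Prod>j\<in>UNIV - {i}. A x $ j $ p j) = 0" by simp
    qed
    then have "(\<Sum>p\<in>?P. of_int (sign p) * (\<Sum>i\<in>UNIV. A' h $ i $ p i * (\<Prod>j\<in>UNIV - {i}. A x $ j $ p j)))
      = (\<Sum>p\<in>{id}. of_int (sign p) * (\<Sum>i\<in>UNIV. A' h $ i $ p i * (\<Prod>j\<in>UNIV - {i}. A x $ j $ p j)))"
      by (intro sum.mono_neutral_right) (auto simp: finite_permutations permutes_id)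
    also have "\<dots> = trace (A' h)"
      by (simp add: trace_def I mat_def)
    finally show ?thesis .
  qed
  ultimately show ?thesis by simp
qed

lemma matrix_inv:
  fixes A :: "real^'n^'n"
  assumes "invertible A"
  shows "matrix_inv A ** A = mat 1" "A ** matrix_inv A = mat 1"
proof -
  have "A ** matrix_inv A = mat 1 \<and> matrix_inv A ** A = mat 1"
    unfolding matrix_inv_def by (rule someI_ex) (use assms in \<open>simp add: invertible_def\<close>)
  then show "matrix_inv A ** A = mat 1" "A ** matrix_inv A = mat 1" by auto
qed

text \<open>Jacobi's formula. The previous lemma applies to \<open>matrix_inv (A x) ** A y\<close>,
  which is the identity at y = x.\<close>

lemma det_has_derivative:
  fixes A :: "'b::real_normed_vector \<Rightarrow> real^'n^'n"
  assumes d: "\<And>i j. ((\<lambda>y. A y $ i $ j) has_derivative (\<lambda>h. A' h $ i $ j)) (at x)"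
    and inv: "invertible (A x)"
  shows "((\<lambda>y. det (A y)) has_derivative (\<lambda>h. det (A x) * trace (matrix_inv (A x) ** A' h))) (at x)"
proof -
  let ?B = "matrix_inv (A x)"
  have l: "?B ** A x = mat 1" "A x ** ?B = mat 1"
    using inv by (auto simp: matrix_inv)
  have "((\<lambda>y. det (?B ** A y)) has_derivative (\<lambda>h. trace (?B ** A' h))) (at x)"
  proof (rule det_has_derivative_at_id)
    show "((\<lambda>y. (?B ** A y) $ i $ j) has_derivative (\<lambda>h. (?B ** A' h) $ i $ j)) (at x)" for i j
      by (auto simp: matrix_matrix_mult_def intro!: has_derivative_sum has_derivative_mult_right d)
  qed (rule l)
  then have "((\<lambda>y. det (A x) * det (?B ** A y)) has_derivative (\<lambda>h. det (A x) * trace (?B ** A' h))) (at x)"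
    by (rule has_derivative_mult_right)
  moreover have "det (A x) * det (?B ** A y) = det (A y)" for y
    by (metis det_mul l(2) matrix_mul_assoc matrix_mul_lid)
  ultimately show ?thesis by simp
qed

text \<open>The first fundamental form of a linear map. For injective \<open>L\<close> the square
  root of its determinant is the factor by which \<open>L\<close> scales k-dimensional
  volume.\<close>

definition gram :: "(real^'k::finite \<Rightarrow> 'a::euclidean_space) \<Rightarrow> real^'k^'k" where
  "gram L = (\<chi> i j. L (axis i 1) \<bullet> L (axis j 1))"

lemma linear_axis_expand:
  fixes L :: "real^'k::finite \<Rightarrow> 'a::real_vector"
  assumes "linear L"
  shows "L x = (\<Sum>i\<in>UNIV. (x $ i) *\<^sub>R L (axis i 1))"
proof -
  have "x = (\<Sum>i\<in>UNIV. (x $ i) *\<^sub>R axis i 1)"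
    by (simp add: vec_eq_iff axis_def if_distrib cong: if_cong)
  then have "L x = L (\<Sum>i\<in>UNIV. (x $ i) *\<^sub>R axis i 1)" by simp
  also have "\<dots> = (\<Sum>i\<in>UNIV. (x $ i) *\<^sub>R L (axis i 1))"
    using assms by (simp add: linear_sum linear_scale)
  finally show ?thesis .
qed

lemma gram_inner:
  assumes "linear L"
  shows "L x \<bullet> L y = x \<bullet> (gram L *v y)"
proof -
  have "L x \<bullet> L y = (\<Sum>j\<in>UNIV. \<Sum>i\<in>UNIV. x $ i * (y $ j * (L (axis i 1) \<bullet> L (axis j 1))))"
    unfolding linear_axis_expand[OF assms, of x] linear_axis_expand[OF assms, of y]
    by (simp add: inner_sum_left inner_sum_right sum_distrib_left mult_ac)
  also have "\<dots> = (\<Sum>i\<in>UNIV. \<Sum>j\<in>UNIV. x $ i * (y $ j * (L (axis i 1) \<bullet> L (axis j 1))))"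
    by (rule sum.swap)
  also have "\<dots> = x \<bullet> (gram L *v y)"
    by (simp add: gram_def matrix_vector_mult_def inner_vec_def sum_distrib_left mult_ac)
  finally show ?thesis .
qed

lemma gram_compose:
  fixes L :: "real^'k::finite \<Rightarrow> 'a::euclidean_space" and B :: "real^'k \<Rightarrow> real^'k"
  assumes L: "linear L" and B: "linear B"
  shows "gram (L \<circ> B) = transpose (matrix B) ** gram L ** matrix B"
proof -
  have "L (B (axis i 1)) \<bullet> L (B (axis j 1)) = (transpose (matrix B) ** gram L ** matrix B) $ i $ j" for i j
  proof -
    have "L (B (axis i 1)) \<bullet> L (B (axis j 1)) = (matrix B *v axis i 1) \<bullet> (gram L *v (matrix B *v axis j 1))"
      using gram_inner[OF L] B by (simp add: matrix_works)
    also have "\<dots> = axis i 1 \<bullet> ((transpose (matrix B) ** gram L ** matrix B) *v axis j 1)"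
      by (metis dot_lmul_matrix matrix_vector_mul_assoc vector_transpose_matrix)
    also have "\<dots> = (transpose (matrix B) ** gram L ** matrix B) $ i $ j"
      by (simp add: inner_axis' matrix_vector_mult_basis column_def)
    finally show ?thesis .
  qed
  then show ?thesis by (simp add: gram_def vec_eq_iff)
qed

lemma det_gram_compose:
  fixes L :: "real^'k::finite \<Rightarrow> 'a::euclidean_space" and B :: "real^'k \<Rightarrow> real^'k"
  assumes "linear L" "linear B"
  shows "det (gram (L \<circ> B)) = (det (matrix B))\<^sup>2 * det (gram L)"
  by (simp add: gram_compose[OF assms] det_mul det_transpose power2_eq_square)

text \<open>The range of \<open>L\<close> has dimension k and is thus isometric to the model space.
  Composing with such an isometry gives a square map with the same Gram matrix, so that determinants
  and volumes of \<open>L\<close> become those of \<open>Q\<close>.\<close>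

lemma isometric_model:
  fixes L :: "real^'k::finite \<Rightarrow> 'a::euclidean_space"
  assumes L: "linear L" and inj: "inj L"
  obtains Q :: "real^'k \<Rightarrow> real^'k" where "linear Q" "inj Q" "\<And>x. norm (Q x) = norm (L x)"
    "det (gram L) = (det (matrix Q))\<^sup>2" "det (matrix Q) \<noteq> 0"
proof -
  have "dim (range L) = dim (UNIV :: (real^'k) set)"
    using L inj by (intro dim_image_eq) auto
  moreover have "subspace (range L)" using L by (simp add: linear_subspace_image)
  ultimately obtain T :: "'a \<Rightarrow> real^'k" where T: "linear T" "\<And>x. x \<in> range L \<Longrightarrow> norm (T x) = norm x"
    using isometries_subspaces[of "range L" "UNIV :: (real^'k) set"] by (metis subspace_UNIV)
  define Q where "Q = T \<circ> L"
  have lQ: "linear Q" unfolding Q_def by (rule linear_compose[OF L T(1)])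
  have n: "norm (Q x) = norm (L x)" for x using T(2)[of "L x"] by (simp add: Q_def)
  have iQ: "inj Q"
  proof -
    have "Q x = 0 \<Longrightarrow> x = 0" for x
      using n[of x] linear_injective_0[OF L] inj by auto
    then show ?thesis using linear_injective_0[OF lQ] by auto
  qed
  \<comment> \<open>Polarization: equal norms force equal inner products.\<close>
  have pol: "Q x \<bullet> Q y = L x \<bullet> L y" for x y
  proof -
    have "Q x \<bullet> Q y = ((norm (Q (x + y)))\<^sup>2 - (norm (Q x))\<^sup>2 - (norm (Q y))\<^sup>2) / 2"
      by (simp add: linear_add[OF lQ] power2_norm_eq_inner inner_simps inner_commute)
    moreover have "L x \<bullet> L y = ((norm (L (x + y)))\<^sup>2 - (norm (L x))\<^sup>2 - (norm (L y))\<^sup>2) / 2"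
      by (simp add: linear_add[OF L] power2_norm_eq_inner inner_simps inner_commute)
    ultimately show ?thesis by (simp add: n)
  qed
  have "gram L = gram Q" by (simp add: gram_def pol)
  also have "gram Q = gram (id \<circ> Q)" by simp
  also have "det \<dots> = (det (matrix Q))\<^sup>2 * det (gram (id :: real^'k \<Rightarrow> _))"
    by (rule det_gram_compose[OF linear_id lQ])
  also have "gram (id :: real^'k \<Rightarrow> _) = mat 1"
    by (simp add: gram_def mat_def vec_eq_iff inner_axis_axis)
  finally have "det (gram L) = (det (matrix Q))\<^sup>2" by simp
  moreover have "det (matrix Q) \<noteq> 0"
    using iQ lQ det_nz_iff_inj by blast
  ultimately show thesis using that lQ iQ n by blast
qed

lemma det_gram_pos:
  assumes "linear L" "inj L"
  shows "det (gram L) > 0"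
  by (rule isometric_model[OF assms]) auto

lemma invertible_gram:
  assumes "linear L" "inj L"
  shows "invertible (gram L)"
  using det_gram_pos[OF assms] by (simp add: invertible_det_nz)

section \<open>Change of variables\<close>

text \<open>The library proves the change of variables formula for index types of class \<open>wellorder\<close>
  only; a well-ordered copy of the index type removes that restriction.\<close>

typedef 'a wo = "UNIV :: 'a set" by simp

text \<open>The chosen injection does not depend on \<open>x\<close>, so all elements are compared
  through one and the same map.\<close>

definition wo_code :: "'a::finite wo \<Rightarrow> nat" where
  "wo_code x = (SOME f. inj f) (Rep_wo x)"

lemma inj_wo_code: "inj (wo_code :: 'a::finite wo \<Rightarrow> nat)"
proof -
  have "\<exists>f :: 'a \<Rightarrow> nat. inj f"
    using finite_imp_inj_to_nat_seg[OF finite[of "UNIV :: 'a set"]] by blast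
  then have i: "inj (SOME f :: 'a \<Rightarrow> nat. inj f)" by (rule someI_ex)
  show ?thesis
  proof (rule injI)
    fix x y :: "'a wo" assume "wo_code x = wo_code y"
    then have "Rep_wo x = Rep_wo y" using injD[OF i] by (simp add: wo_code_def)
    then show "x = y" by (simp add: Rep_wo_inject)
  qed
qed

lemma bij_Rep_wo: "bij Rep_wo"
  by (metis Abs_wo_inverse UNIV_I bijI' Rep_wo_inject)

instance wo :: (finite) finite
proof
  show "finite (UNIV :: 'a wo set)"
    using bij_Rep_wo by (metis finite bij_betw_finite)
qed

instantiation wo :: (finite) wellorder
begin

definition less_eq_wo :: "'a wo \<Rightarrow> 'a wo \<Rightarrow> bool" where "x \<le> y \<longleftrightarrow> wo_code x \<le> wo_code y"
definition less_wo :: "'a wo \<Rightarrow> 'a wo \<Rightarrow> bool" where "x < y \<longleftrightarrow> wo_code x < wo_code y"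

instance
proof
  fix P :: "'a wo \<Rightarrow> bool" and a :: "'a wo"
  assume step: "\<And>x. (\<And>y. y < x \<Longrightarrow> P y) \<Longrightarrow> P x"
  show "P a"
    by (induction a rule: measure_induct_rule[of wo_code]) (auto intro: step simp: less_wo_def)
qed (auto simp: less_eq_wo_def less_wo_def dest: injD[OF inj_wo_code])

end

definition to_wo :: "real^'k::finite \<Rightarrow> real^'k wo" where "to_wo x = (\<chi> i. x $ Rep_wo i)"
definition of_wo :: "real^'k::finite wo \<Rightarrow> real^'k" where "of_wo x = (\<chi> i. x $ Abs_wo i)"

lemma of_to_wo [simp]: "of_wo (to_wo x) = x"
  by (simp add: of_wo_def to_wo_def Abs_wo_inverse)

lemma to_of_wo [simp]: "to_wo (of_wo x) = x"
  by (simp add: of_wo_def to_wo_def Rep_wo_inverse)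

lemma linear_to_wo: "linear to_wo"
  by (rule linearI) (auto simp: to_wo_def vec_eq_iff)

lemma linear_of_wo: "linear of_wo"
  by (rule linearI) (auto simp: of_wo_def vec_eq_iff)

lemma bij_Abs_wo: "bij Abs_wo"
  by (metis Abs_wo_inverse Rep_wo_inverse UNIV_I bijI')

text \<open>Relabelling rows and columns by the same bijection conjugates the permutations in the
  Leibniz formula, and conjugation preserves signs.\<close>

lemma det_wo_conj:
  fixes B :: "real^'k::finite \<Rightarrow> real^'k"
  shows "det (matrix (to_wo \<circ> B \<circ> of_wo)) = det (matrix B)"
proof -
  define C where "C = matrix B"
  have ax: "of_wo (axis j 1) = axis (Rep_wo j) (1::real)" for j
    by (auto simp: of_wo_def axis_def vec_eq_iff Abs_wo_inverse Rep_wo_inverse)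
  have e: "matrix (to_wo \<circ> B \<circ> of_wo) $ i $ j = C $ Rep_wo i $ Rep_wo j" for i j
    by (simp add: matrix_def to_wo_def ax C_def)
  let ?m = "\<lambda>p :: 'k \<Rightarrow> 'k. Abs_wo \<circ> p \<circ> Rep_wo"
  have [simp]: "Rep_wo \<circ> Abs_wo = id" "Abs_wo \<circ> Rep_wo = id"
    by (auto simp: fun_eq_iff Abs_wo_inverse Rep_wo_inverse)
  have bb: "bij_betw ?m {p. p permutes (UNIV :: 'k set)} {p. p permutes (UNIV :: 'k wo set)}"
  proof (rule bij_betw_byWitness[where f' = "\<lambda>q. Rep_wo \<circ> q \<circ> Abs_wo"])
    have "?m p permutes UNIV" if "p permutes UNIV" for p
      using that bij_Abs_wo bij_Rep_wo by (intro bij_imp_permutes bij_comp) (auto dest: permutes_bij)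
    then show "?m ` {p. p permutes UNIV} \<subseteq> {p. p permutes UNIV}" by auto
    have "Rep_wo \<circ> q \<circ> Abs_wo permutes UNIV" if "q permutes UNIV" for q :: "'k wo \<Rightarrow> 'k wo"
      using that bij_Abs_wo bij_Rep_wo by (intro bij_imp_permutes bij_comp) (auto dest: permutes_bij)
    then show "(\<lambda>q. Rep_wo \<circ> q \<circ> Abs_wo) ` {p. p permutes UNIV} \<subseteq> {p. p permutes (UNIV :: 'k set)}" by auto
  qed (auto simp: fun_eq_iff Abs_wo_inverse Rep_wo_inverse)
  have "det (matrix (to_wo \<circ> B \<circ> of_wo)) =
    (\<Sum>p\<in>{p. p permutes (UNIV :: 'k wo set)}. of_int (sign p) * (\<Prod>i\<in>UNIV. C $ Rep_wo i $ Rep_wo (p i)))"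
    by (simp add: det_def e)
  also have "\<dots> = (\<Sum>p\<in>{p. p permutes (UNIV :: 'k set)}. of_int (sign (?m p)) * (\<Prod>i\<in>UNIV. C $ Rep_wo i $ Rep_wo (?m p i)))"
    by (rule sum.reindex_bij_betw[OF bb, symmetric])
  also have "\<dots> = det C"
    unfolding det_def
  proof (rule sum.cong)
    fix p assume "p \<in> {p. p permutes (UNIV :: 'k set)}"
    then have p: "p permutes UNIV" by simp
    have "inv Abs_wo = (Rep_wo :: 'k wo \<Rightarrow> 'k)"
      by (rule inv_equality) (auto simp: Abs_wo_inverse Rep_wo_inverse)
    moreover have "range (Abs_wo :: 'k \<Rightarrow> 'k wo) = UNIV" by (rule bij_is_surj[OF bij_Abs_wo])
    ultimately have "map_permutation UNIV Abs_wo p = ?m p"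
      by (simp add: map_permutation_def restrict_id_def fun_eq_iff)
    moreover have "sign (map_permutation UNIV Abs_wo p) = sign p"
      by (rule sign_map_permutation) (use p bij_Abs_wo in \<open>auto simp: bij_def\<close>)
    ultimately have 1: "sign (?m p) = sign p" by simp
    have "(\<Prod>i\<in>UNIV. C $ Rep_wo i $ Rep_wo (?m p i)) = (\<Prod>i\<in>UNIV. C $ Rep_wo i $ p (Rep_wo i))"
      by (simp add: Abs_wo_inverse)
    also have "\<dots> = (\<Prod>i\<in>UNIV. C $ i $ p i)"
      using prod.reindex_bij_betw[OF bij_Rep_wo[where 'a='k], of "\<lambda>i. C $ i $ p i"] .
    finally show "of_int (sign (?m p)) * (\<Prod>i\<in>UNIV. C $ Rep_wo i $ Rep_wo (?m p i)) =
        of_int (sign p) * (\<Prod>i\<in>UNIV. C $ i $ p i)" by (simp add: 1)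
  qed simp
  finally show ?thesis by (simp add: C_def)
qed

lemma borel_measurable_linear: "linear f \<Longrightarrow> f \<in> borel_measurable borel"
  for f :: "'a::euclidean_space \<Rightarrow> 'b::euclidean_space"
  by (simp add: borel_measurable_continuous_onI linear_continuous_on linear_conv_bounded_linear)

lemma prod_Basis_cart:
  fixes G :: "real^'n::finite \<Rightarrow> 'b::comm_monoid_mult"
  shows "(\<Prod>b\<in>Basis. G b) = (\<Prod>i\<in>UNIV. G (axis i 1))"
proof -
  have B: "(Basis :: (real^'n) set) = (\<lambda>i. axis i 1) ` UNIV" by (auto simp: Basis_vec_def)
  have "inj (\<lambda>i :: 'n. axis i (1::real))" by (simp add: inj_def axis_eq_axis)
  then show ?thesis unfolding B by (simp only: prod.reindex o_def)
qed

text \<open>Relabelling coordinates maps boxes to boxes with the same side lengths, and the volumes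
  of boxes determine Lebesgue measure.\<close>

lemma lborel_to_wo: "distr lborel borel to_wo = (lborel :: (real^'k::finite wo) measure)"
proof (rule lborel_eqI[symmetric])
  fix l u :: "real^'k wo" assume lu: "\<And>b. b \<in> Basis \<Longrightarrow> l \<bullet> b \<le> u \<bullet> b"
  have lu': "l $ i \<le> u $ i" for i
    using lu[of "axis i 1"] by (simp add: inner_axis axis_in_Basis_iff)
  have "to_wo -` box l u = box (of_wo l) (of_wo u)"
  proof -
    have "(\<forall>i. l $ i < x $ Rep_wo i \<and> x $ Rep_wo i < u $ i) \<longleftrightarrow>
        (\<forall>i. l $ Abs_wo i < x $ i \<and> x $ i < u $ Abs_wo i)" for x :: "real^'k"
      by (metis Abs_wo_inverse Rep_wo_inverse UNIV_I)
    then show ?thesis by (auto simp: mem_box_cart to_wo_def of_wo_def)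
  qed
  then have "emeasure (distr lborel borel to_wo) (box l u) = emeasure lborel (box (of_wo l) (of_wo u))"
    by (subst emeasure_distr) (auto intro: borel_measurable_linear linear_to_wo)
  also have "\<dots> = (\<Prod>b\<in>Basis. (of_wo u - of_wo l) \<bullet> b)"
  proof -
    have "of_wo l \<bullet> b \<le> of_wo u \<bullet> b" if "b \<in> Basis" for b :: "real^'k"
    proof -
      obtain i where "b = axis i 1" using \<open>b \<in> Basis\<close> by (auto simp: Basis_vec_def)
      then show ?thesis using lu'[of "Abs_wo i"] by (simp add: inner_axis of_wo_def)
    qed
    then show ?thesis by (simp add: emeasure_lborel_box_eq)
  qed
  also have "(\<Prod>b\<in>Basis. (of_wo u - of_wo l) \<bullet> b) = (\<Prod>i\<in>UNIV. (u - l) $ Abs_wo i)"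
    by (simp add: prod_Basis_cart inner_axis of_wo_def)
  also have "\<dots> = (\<Prod>i\<in>UNIV. (u - l) $ i)"
    using prod.reindex_bij_betw[OF bij_Abs_wo[where 'a='k], of "\<lambda>i. (u - l) $ i"] .
  also have "\<dots> = (\<Prod>b\<in>Basis. (u - l) \<bullet> b)"
    by (simp add: prod_Basis_cart inner_axis)
  finally show "emeasure (distr lborel borel to_wo) (box l u) = ennreal (\<Prod>b\<in>Basis. (u - l) \<bullet> b)" .
qed simp

text \<open>\<open>has_measure_differentiable_image\<close> is an equivalence: it gives the formula
  when the integral is finite, and it excludes a finite volume of the image when the integral is
  infinite.\<close>

lemma emeasure_differentiable_image_wo:
  fixes f :: "real^'n::{finite,wellorder} \<Rightarrow> real^'n::_"
  assumes S: "S \<in> sets borel" and fS: "f ` S \<in> sets borel"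
    and d: "\<And>x. x \<in> S \<Longrightarrow> (f has_derivative f' x) (at x)"
    and inj: "inj_on f S"
    and m: "(\<lambda>x. indicator S x * \<bar>det (matrix (f' x))\<bar>) \<in> borel_measurable borel"
  shows "emeasure lborel (f ` S) = (\<integral>\<^sup>+x\<in>S. ennreal \<bar>det (matrix (f' x))\<bar> \<partial>lborel)"
proof -
  let ?J = "\<lambda>x. indicator S x * \<bar>det (matrix (f' x))\<bar>"
  have d': "\<And>x. x \<in> S \<Longrightarrow> (f has_derivative f' x) (at x within S)"
    using d has_derivative_at_withinI by blast
  have Sl: "S \<in> sets lebesgue" using S by simp
  have iff: "f ` S \<in> lmeasurable \<and> measure lebesgue (f ` S) = r \<longleftrightarrow> (?J has_integral r) UNIV" for r
  proof -
    have "(?J has_integral r) UNIV \<longleftrightarrow> ((\<lambda>x. \<bar>det (matrix (f' x))\<bar>) has_integral r) S"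
    proof -
      have "?J = (\<lambda>x. if x \<in> S then \<bar>det (matrix (f' x))\<bar> else 0)" by auto
      then show ?thesis by (simp only: has_integral_restrict_UNIV)
    qed
    then show ?thesis using has_measure_differentiable_image[OF Sl d' inj, of r] by simp
  qed
  have e: "(\<integral>\<^sup>+x\<in>S. ennreal \<bar>det (matrix (f' x))\<bar> \<partial>lborel) = (\<integral>\<^sup>+x. ennreal (?J x) \<partial>lborel)"
    by (intro nn_integral_cong) (auto simp: indicator_def)
  show ?thesis
  proof (cases "(\<integral>\<^sup>+x. ennreal (?J x) \<partial>lborel)")
    case (real r)
    then have "(?J has_integral r) UNIV"
      by (intro nn_integral_has_integral[OF m]) auto
    then have "f ` S \<in> lmeasurable" "measure lebesgue (f ` S) = r" using iff[of r] by auto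
    then have "emeasure lebesgue (f ` S) = ennreal r"
      using emeasure_eq_measure2 by metis
    then show ?thesis using e real fS by simp
  next
    case top
    have "emeasure lborel (f ` S) = \<infinity>"
    proof (rule ccontr)
      assume "\<not> ?thesis"
      then have "f ` S \<in> lmeasurable" using fS by (auto simp: fmeasurable_def less_top)
      then have "(?J has_integral measure lebesgue (f ` S)) UNIV" using iff by blast
      then have "(\<integral>\<^sup>+x. ennreal (?J x) \<partial>lborel) = ennreal (measure lebesgue (f ` S))"
        by (intro nn_integral_has_integral_lborel[OF m]) auto
      then show False using top by simp
    qed
    then show ?thesis using e top by simp
  qed
qed

text \<open>Conjugation by \<open>to_wo\<close> preserves Lebesgue measure and Jacobian
  determinants.\<close>

lemma emeasure_differentiable_image:
  fixes f :: "real^'k::finite \<Rightarrow> real^'k"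
  assumes S: "S \<in> sets borel" and fS: "f ` S \<in> sets borel"
    and d: "\<And>x. x \<in> S \<Longrightarrow> (f has_derivative f' x) (at x)"
    and inj: "inj_on f S"
    and m: "(\<lambda>x. indicator S x * \<bar>det (matrix (f' x))\<bar>) \<in> borel_measurable borel"
  shows "emeasure lborel (f ` S) = (\<integral>\<^sup>+x\<in>S. ennreal \<bar>det (matrix (f' x))\<bar> \<partial>lborel)"
proof -
  have to_m [measurable]: "to_wo \<in> borel_measurable (borel :: (real^'k) measure)"
    by (rule borel_measurable_linear[OF linear_to_wo])
  have of_m [measurable]: "of_wo \<in> borel_measurable (borel :: (real^'k wo) measure)"
    by (rule borel_measurable_linear[OF linear_of_wo])
  have im: "to_wo ` E = of_wo -` E" for E :: "(real^'k) set"
    by (auto simp: image_iff) (metis to_of_wo)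
  have imb: "to_wo ` E \<in> sets borel" if "E \<in> sets borel" for E :: "(real^'k) set"
    unfolding im using measurable_sets[OF of_m that] by simp
  have em: "emeasure lborel (to_wo ` E) = emeasure lborel E" if "E \<in> sets borel" for E :: "(real^'k) set"
  proof -
    have "emeasure lborel (to_wo ` E) = emeasure (distr lborel borel to_wo) (to_wo ` E)"
      by (simp add: lborel_to_wo)
    also have "\<dots> = emeasure lborel (to_wo -` (to_wo ` E))"
      by (subst emeasure_distr) (use imb[OF that] in auto)
    also have "to_wo -` (to_wo ` E) = E"
      by (auto simp: image_iff) (metis of_to_wo)
    finally show ?thesis .
  qed
  define F where "F = to_wo \<circ> f \<circ> of_wo"
  define F' where "F' = (\<lambda>x. to_wo \<circ> f' (of_wo x) \<circ> of_wo)"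
  have FS: "F ` (to_wo ` S) = to_wo ` (f ` S)" by (auto simp: F_def image_iff)
  have dF: "det (matrix (F' x)) = det (matrix (f' (of_wo x)))" for x
    unfolding F'_def by (rule det_wo_conj)
  have "emeasure lborel (f ` S) = emeasure lborel (F ` (to_wo ` S))"
    by (simp add: FS em fS)
  also have "\<dots> = (\<integral>\<^sup>+x\<in>to_wo ` S. ennreal \<bar>det (matrix (F' x))\<bar> \<partial>lborel)"
  proof (rule emeasure_differentiable_image_wo)
    show "to_wo ` S \<in> sets borel" "F ` (to_wo ` S) \<in> sets borel"
      using imb S fS by (auto simp: FS)
    show "inj_on F (to_wo ` S)"
      using inj by (auto simp: inj_on_def F_def) (metis of_to_wo)
    fix x assume "x \<in> to_wo ` S"
    then have "(f has_derivative f' (of_wo x)) (at (of_wo x))" using d by auto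
    then show "(F has_derivative F' x) (at x)"
      unfolding F_def F'_def
      by (intro diff_chain_at)
         (auto intro!: bounded_linear_imp_has_derivative linear_conv_bounded_linear[THEN iffD1] linear_to_wo linear_of_wo)
  next
    have "(\<lambda>x. indicator S (of_wo x) * \<bar>det (matrix (f' (of_wo x)))\<bar>) \<in> borel_measurable borel"
      by (rule measurable_compose[OF of_m m])
    moreover have "indicator (to_wo ` S) x = (indicator S (of_wo x) :: real)" for x
      by (simp add: im indicator_def)
    ultimately show "(\<lambda>x. indicator (to_wo ` S) x * \<bar>det (matrix (F' x))\<bar>) \<in> borel_measurable borel"
      by (simp add: dF)
  qed
  also have "\<dots> = (\<integral>\<^sup>+x. ennreal (indicator S (of_wo x) * \<bar>det (matrix (f' (of_wo x)))\<bar>) \<partial>lborel)"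
    by (intro nn_integral_cong) (simp add: dF im indicator_def)
  also have "\<dots> = (\<integral>\<^sup>+x. ennreal (indicator S (of_wo x) * \<bar>det (matrix (f' (of_wo x)))\<bar>) \<partial>distr lborel borel to_wo)"
    by (simp only: lborel_to_wo)
  also have "\<dots> = (\<integral>\<^sup>+x. ennreal (indicator S x * \<bar>det (matrix (f' x))\<bar>) \<partial>lborel)"
  proof -
    have me: "(\<lambda>x. ennreal (indicator S (of_wo x) * \<bar>det (matrix (f' (of_wo x)))\<bar>)) \<in> borel_measurable borel"
      using measurable_compose[OF of_m m] by simp
    show ?thesis
      by (subst nn_integral_distr) (use me in auto)
  qed
  also have "\<dots> = (\<integral>\<^sup>+x\<in>S. ennreal \<bar>det (matrix (f' x))\<bar> \<partial>lborel)"
    by (intro nn_integral_cong) (auto simp: indicator_def)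
  finally show ?thesis .
qed

section \<open>Continuously differentiable maps\<close>

abbreviation C1 :: "('a::real_normed_vector \<Rightarrow> 'b::real_normed_vector) \<Rightarrow> 'a set \<Rightarrow> bool" where
  "C1 f S \<equiv> Ck_on (Suc 0) f S"

lemma C1I:
  assumes "\<And>x. x \<in> S \<Longrightarrow> (f has_derivative f' x) (at x)" "\<And>v. continuous_on S (\<lambda>x. f' x v)"
  shows "C1 f S"
proof -
  have "frechet_derivative f (at x) = f' x" if "x \<in> S" for x
    using frechet_derivative_at[OF assms(1)[OF that]] by simp
  then have "continuous_on S (\<lambda>x. frechet_derivative f (at x) v)" for v
    using assms(2)[of v] by (simp cong: continuous_on_cong)
  then show ?thesis using assms(1) by (auto simp: differentiable_def)
qed

lemma C1_has_derivative:
  assumes "C1 f S" "x \<in> S"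
  shows "(f has_derivative frechet_derivative f (at x)) (at x)"
  using assms frechet_derivative_works by auto

lemma C1_continuous_derivative: "C1 f S \<Longrightarrow> continuous_on S (\<lambda>x. frechet_derivative f (at x) v)"
  by simp

lemma C1_continuous_on: "C1 f S \<Longrightarrow> continuous_on S f"
  by (meson C1_has_derivative continuous_at_imp_continuous_on has_derivative_continuous)

lemma C1_linear_derivative: "C1 f S \<Longrightarrow> x \<in> S \<Longrightarrow> linear (frechet_derivative f (at x))"
  using C1_has_derivative has_derivative_linear by blast

lemma C1_Un:
  assumes "C1 f S" "C1 f T" "open S" "open T"
  shows "C1 f (S \<union> T)"
  using assms by (auto intro!: continuous_on_open_Un)

lemma Ck_on_2D: "Ck_on 2 F S \<Longrightarrow> C1 (\<lambda>x. frechet_derivative F (at x) v) S"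
  "Ck_on 2 F S \<Longrightarrow> x \<in> S \<Longrightarrow> (F has_derivative frechet_derivative F (at x)) (at x)"
  by (simp_all add: numeral_2_eq_2 frechet_derivative_works)

declare Ck_on.simps [simp del]

lemma C1_const: "C1 (\<lambda>x. c) S"
  by (rule C1I[where f' = "\<lambda>x v. 0"]) auto

lemma C1_bounded_linear: "bounded_linear f \<Longrightarrow> C1 f S"
  by (rule C1I[where f' = "\<lambda>x. f"]) (auto intro: bounded_linear_imp_has_derivative)

lemma C1_add:
  assumes "C1 f S" "C1 g S"
  shows "C1 (\<lambda>x. f x + g x) S"
  by (rule C1I[OF has_derivative_add[OF C1_has_derivative[OF assms(1)] C1_has_derivative[OF assms(2)]]])
     (assumption | intro continuous_on_add C1_continuous_derivative assms)+

lemma C1_bilinear: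
  assumes "bounded_bilinear op" "C1 f S" "C1 g S"
  shows "C1 (\<lambda>x. op (f x) (g x)) S"
proof -
  interpret bounded_bilinear op by fact
  show ?thesis
    by (rule C1I[OF FDERIV[OF C1_has_derivative[OF assms(2)] C1_has_derivative[OF assms(3)]]])
       (assumption | intro continuous_on_add continuous_on C1_continuous_on[OF assms(2)] C1_continuous_on[OF assms(3)]
         C1_continuous_derivative[OF assms(2)] C1_continuous_derivative[OF assms(3)])+
qed

lemma C1_mult: "C1 f S \<Longrightarrow> C1 g S \<Longrightarrow> C1 (\<lambda>x. f x * g x :: real) S"
  by (rule C1_bilinear[OF bounded_bilinear_mult])

lemma C1_scaleR: "C1 f S \<Longrightarrow> C1 g S \<Longrightarrow> C1 (\<lambda>x. f x *\<^sub>R g x) S"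
  by (rule C1_bilinear[OF bounded_bilinear_scaleR])

lemma C1_inner: "C1 f S \<Longrightarrow> C1 g S \<Longrightarrow> C1 (\<lambda>x. f x \<bullet> g x) S"
  by (rule C1_bilinear[OF bounded_bilinear_inner])

lemma C1_sum: "finite I \<Longrightarrow> (\<And>i. i \<in> I \<Longrightarrow> C1 (f i) S) \<Longrightarrow> C1 (\<lambda>x. \<Sum>i\<in>I. f i x) S"
proof (induction I rule: finite_induct)
  case (insert a I)
  then have "C1 (\<lambda>x. f a x + (\<Sum>i\<in>I. f i x)) S" by (intro C1_add) auto
  then show ?case using insert by (simp)
qed (simp add: C1_const)

lemma C1_prod: "finite I \<Longrightarrow> (\<And>i. i \<in> I \<Longrightarrow> C1 (f i) S) \<Longrightarrow> C1 (\<lambda>x. \<Prod>i\<in>I. f i x :: real) S"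
proof (induction I rule: finite_induct)
  case (insert a I)
  then have "C1 (\<lambda>x. f a x * (\<Prod>i\<in>I. f i x)) S" by (intro C1_mult) auto
  then show ?case using insert by (simp)
qed (simp add: C1_const)

lemma C1_compose_real:
  fixes f :: "'a::real_normed_vector \<Rightarrow> real"
  assumes f: "C1 f S" and h: "\<And>x. x \<in> S \<Longrightarrow> (h has_real_derivative h' (f x)) (at (f x))"
    and h': "continuous_on (f ` S) h'"
  shows "C1 (\<lambda>x. h (f x)) S"
proof (rule C1I)
  fix x assume "x \<in> S"
  then show "((\<lambda>x. h (f x)) has_derivative (\<lambda>v. h' (f x) * frechet_derivative f (at x) v)) (at x)"
    using has_derivative_compose[OF C1_has_derivative[OF f] h[unfolded has_field_derivative_def]] by auto
next
  fix v
  show "continuous_on S (\<lambda>x. h' (f x) * frechet_derivative f (at x) v)"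
    by (intro continuous_on_mult continuous_on_compose2[OF h'] C1_continuous_on[OF f] C1_continuous_derivative[OF f]) auto
qed

lemma C1_inverse:
  fixes f :: "'a::real_normed_vector \<Rightarrow> real"
  assumes f: "C1 f S" and nz: "\<And>x. x \<in> S \<Longrightarrow> f x \<noteq> 0"
  shows "C1 (\<lambda>x. inverse (f x)) S"
proof (rule C1_compose_real[OF f, where h' = "\<lambda>t. - (inverse t * inverse t)"])
  show "(inverse has_real_derivative - (inverse (f x) * inverse (f x))) (at (f x))" if "x \<in> S" for x
    using DERIV_inverse[OF nz[OF that]] by (simp add: power2_eq_square numeral_2_eq_2)
qed (use nz in \<open>auto intro!: continuous_intros\<close>)

lemma C1_divide:
  fixes f :: "'a::real_normed_vector \<Rightarrow> real"
  assumes "C1 f S" "C1 g S" and nz: "\<And>x. x \<in> S \<Longrightarrow> g x \<noteq> 0"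
  shows "C1 (\<lambda>x. f x / g x) S"
  unfolding divide_inverse by (intro C1_mult C1_inverse assms)

lemma C1_sqrt:
  fixes f :: "'a::real_normed_vector \<Rightarrow> real"
  assumes f: "C1 f S" and nz: "\<And>x. x \<in> S \<Longrightarrow> f x > 0"
  shows "C1 (\<lambda>x. sqrt (f x)) S"
proof (rule C1_compose_real[OF f DERIV_real_sqrt])
  show "continuous_on (f ` S) (\<lambda>t. inverse (sqrt t) / 2)"
    using nz by (intro continuous_intros) force+
qed (use nz in auto)

lemma C1_cong:
  assumes "open S" "\<And>x. x \<in> S \<Longrightarrow> f x = g x" "C1 g S"
  shows "C1 f S"
proof (rule C1I)
  fix x assume x: "x \<in> S"
  show "(f has_derivative frechet_derivative g (at x)) (at x)"
    by (rule has_derivative_transform_within_open[OF C1_has_derivative[OF assms(3) x] assms(1) x])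
       (simp add: assms(2))
qed (rule C1_continuous_derivative[OF assms(3)])

text \<open>In the chain rule the direction varies with the point, while \<open>C1\<close> speaks of
  fixed directions. Expanding the varying direction in the standard basis leaves fixed directions
  with continuous coefficients.\<close>

lemma C1_compose:
  fixes g :: "real^'k::finite \<Rightarrow> real^'l::finite" and f :: "real^'l \<Rightarrow> 'b::real_normed_vector"
  assumes f: "C1 f T" and g: "C1 g S" and sub: "g ` S \<subseteq> T"
  shows "C1 (f \<circ> g) S"
proof (rule C1I)
  fix x assume "x \<in> S"
  then show "((f \<circ> g) has_derivative (frechet_derivative f (at (g x)) \<circ> frechet_derivative g (at x))) (at x)"
    using sub by (intro diff_chain_at C1_has_derivative[OF f] C1_has_derivative[OF g]) auto
next
  fix v
  have e: "frechet_derivative f (at (g x)) (frechet_derivative g (at x) v) =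
     (\<Sum>i\<in>UNIV. (frechet_derivative g (at x) v $ i) *\<^sub>R frechet_derivative f (at (g x)) (axis i 1))" if "x \<in> S" for x
    using sub that by (intro linear_axis_expand C1_linear_derivative[OF f]) auto
  have "continuous_on S (\<lambda>x. \<Sum>i\<in>UNIV. (frechet_derivative g (at x) v $ i) *\<^sub>R frechet_derivative f (at (g x)) (axis i 1))"
    by (intro continuous_intros C1_continuous_derivative[OF g]
         continuous_on_compose2[OF C1_continuous_derivative[OF f] C1_continuous_on[OF g] sub])
  then show "continuous_on S (\<lambda>x. (frechet_derivative f (at (g x)) \<circ> frechet_derivative g (at x)) v)"
    by (simp add: e cong: continuous_on_cong)
qed

lemma C1_vec:
  fixes f :: "'a::real_normed_vector \<Rightarrow> real^'k::finite"
  assumes "\<And>i. C1 (\<lambda>x. f x $ i) S"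
  shows "C1 f S"
proof -
  have fe: "(\<lambda>x. \<Sum>i\<in>UNIV. (f x $ i) *\<^sub>R axis i 1) = f"
    by (rule ext) (simp add: vec_eq_iff axis_def if_distrib cong: if_cong)
  have "C1 (\<lambda>x. \<Sum>i\<in>UNIV. (f x $ i) *\<^sub>R axis i (1::real)) S"
    by (intro C1_sum C1_scaleR assms C1_const) auto
  then show ?thesis unfolding fe .
qed

lemma C1_det:
  fixes A :: "'a::real_normed_vector \<Rightarrow> real^'n^'n"
  assumes "\<And>i j. C1 (\<lambda>x. A x $ i $ j) S"
  shows "C1 (\<lambda>x. det (A x)) S"
  unfolding det_def by (intro C1_sum C1_mult C1_prod C1_const assms) (auto simp: finite_permutations)

section \<open>Symmetry of second derivatives\<close>

lemma mvt_line:
  fixes f :: "'a::real_normed_vector \<Rightarrow> real"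
  assumes "0 < h" "\<And>s. 0 \<le> s \<Longrightarrow> s \<le> h \<Longrightarrow> (f has_derivative f' (x + s *\<^sub>R v)) (at (x + s *\<^sub>R v))"
  shows "\<exists>s. 0 < s \<and> s < h \<and> f (x + h *\<^sub>R v) - f x = h * f' (x + s *\<^sub>R v) v"
proof -
  have "((\<lambda>s. f (x + s *\<^sub>R v)) has_real_derivative f' (x + s *\<^sub>R v) v) (at s)" if "0 \<le> s" "s \<le> h" for s
  proof -
    have "((\<lambda>s. x + s *\<^sub>R v) has_derivative (\<lambda>s. s *\<^sub>R v)) (at s)"
      by (auto intro!: derivative_eq_intros)
    from has_derivative_compose[OF this assms(2)[OF that]]
    have d: "((\<lambda>s. f (x + s *\<^sub>R v)) has_derivative (\<lambda>t. f' (x + s *\<^sub>R v) (t *\<^sub>R v))) (at s)" .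
    have "linear (f' (x + s *\<^sub>R v))" using assms(2)[OF that] has_derivative_linear by blast
    then have "(\<lambda>t. f' (x + s *\<^sub>R v) (t *\<^sub>R v)) = (*) (f' (x + s *\<^sub>R v) v)"
      by (auto simp: linear_scale)
    then show ?thesis using d by (simp add: has_field_derivative_def)
  qed
  from MVT2[OF assms(1) this] show ?thesis by auto
qed

text \<open>The mean value theorem is applied twice: along \<open>v\<close> to the difference of
  \<open>f\<close> under the shift by \<open>h *\<^sub>R w\<close>, then along \<open>w\<close> to
  the derivative in direction \<open>v\<close>.\<close>

lemma second_difference:
  fixes f :: "'a::real_normed_vector \<Rightarrow> real"
  assumes h: "0 < h"
    and f: "\<And>s t. 0 \<le> s \<Longrightarrow> s \<le> h \<Longrightarrow> 0 \<le> t \<Longrightarrow> t \<le> h \<Longrightarrow>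
       (f has_derivative f' (y + s *\<^sub>R v + t *\<^sub>R w)) (at (y + s *\<^sub>R v + t *\<^sub>R w))"
    and A: "\<And>s t. 0 \<le> s \<Longrightarrow> s \<le> h \<Longrightarrow> 0 \<le> t \<Longrightarrow> t \<le> h \<Longrightarrow>
       ((\<lambda>x. f' x v) has_derivative A (y + s *\<^sub>R v + t *\<^sub>R w)) (at (y + s *\<^sub>R v + t *\<^sub>R w))"
  shows "\<exists>s t. 0 < s \<and> s < h \<and> 0 < t \<and> t < h \<and>
    f (y + h *\<^sub>R v + h *\<^sub>R w) - f (y + h *\<^sub>R v) - (f (y + h *\<^sub>R w) - f y) = h * h * A (y + s *\<^sub>R v + t *\<^sub>R w) w"
proof -
  define g where "g = (\<lambda>x. f (x + h *\<^sub>R w) - f x)"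
  have "(g has_derivative (\<lambda>z. f' (y + s *\<^sub>R v + h *\<^sub>R w) z - f' (y + s *\<^sub>R v) z)) (at (y + s *\<^sub>R v))"
    if "0 \<le> s" "s \<le> h" for s
  proof -
    have "((\<lambda>x. x + h *\<^sub>R w) has_derivative (\<lambda>z. z)) (at (y + s *\<^sub>R v))"
      by (auto intro!: derivative_eq_intros)
    from has_derivative_compose[OF this f[OF that, of h]]
    have "((\<lambda>x. f (x + h *\<^sub>R w)) has_derivative f' (y + s *\<^sub>R v + h *\<^sub>R w)) (at (y + s *\<^sub>R v))"
      using h by simp
    moreover have "(f has_derivative f' (y + s *\<^sub>R v)) (at (y + s *\<^sub>R v))"
      using f[OF that, of 0] h by simp
    ultimately show ?thesis unfolding g_def by (rule has_derivative_diff)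
  qed
  from mvt_line[OF h, of g "\<lambda>x z. f' (x + h *\<^sub>R w) z - f' x z" y v] this
  obtain s where s: "0 < s" "s < h"
    "g (y + h *\<^sub>R v) - g y = h * (f' (y + s *\<^sub>R v + h *\<^sub>R w) v - f' (y + s *\<^sub>R v) v)" by blast
  from mvt_line[OF h, of "\<lambda>x. f' x v" A "y + s *\<^sub>R v" w] A[of s] s
  obtain t where t: "0 < t" "t < h"
    "f' (y + s *\<^sub>R v + h *\<^sub>R w) v - f' (y + s *\<^sub>R v) v = h * A (y + s *\<^sub>R v + t *\<^sub>R w) w" by auto
  have "f (y + h *\<^sub>R v + h *\<^sub>R w) - f (y + h *\<^sub>R v) - (f (y + h *\<^sub>R w) - f y) = g (y + h *\<^sub>R v) - g y"
    by (simp add: g_def)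
  also have "\<dots> = h * h * A (y + s *\<^sub>R v + t *\<^sub>R w) w" using s(3) t(3) by simp
  finally show ?thesis using s t by blast
qed

text \<open>The second difference is symmetric in \<open>v\<close> and \<open>w\<close>. So the two
  mixed derivatives agree at points arbitrarily close to \<open>y\<close>, though not at the same
  point, and continuity carries the equality to \<open>y\<close>.\<close>

lemma second_derivative_symmetric_real:
  fixes f :: "'a::real_normed_vector \<Rightarrow> real"
  assumes V: "open V" "y \<in> V"
    and f: "\<And>x. x \<in> V \<Longrightarrow> (f has_derivative f' x) (at x)"
    and A: "\<And>x. x \<in> V \<Longrightarrow> ((\<lambda>x. f' x v) has_derivative A x) (at x)"
    and B: "\<And>x. x \<in> V \<Longrightarrow> ((\<lambda>x. f' x w) has_derivative B x) (at x)"
    and cA: "continuous_on V (\<lambda>x. A x w)" and cB: "continuous_on V (\<lambda>x. B x v)"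
  shows "A y w = B y v"
proof (rule ccontr)
  assume ne: "A y w \<noteq> B y v"
  define e where "e = \<bar>A y w - B y v\<bar> / 2"
  have e: "e > 0" using ne by (simp add: e_def)
  have "isCont (\<lambda>x. A x w) y" "isCont (\<lambda>x. B x v) y"
    using V cA cB continuous_on_eq_continuous_at by blast+
  then obtain d1 d2 where d1: "d1 > 0" "\<And>x. dist x y < d1 \<Longrightarrow> dist (A x w) (A y w) < e"
    and d2: "d2 > 0" "\<And>x. dist x y < d2 \<Longrightarrow> dist (B x v) (B y v) < e"
    unfolding continuous_at_eps_delta using e by metis
  obtain d3 where d3: "d3 > 0" "ball y d3 \<subseteq> V" using V open_contains_ball by blast
  define d where "d = min d1 (min d2 d3)"
  have d: "d > 0" using d1 d2 d3 by (simp add: d_def)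
  \<comment> \<open>This step size keeps the parallelogram spanned by \<open>h *\<^sub>R v\<close>
    and \<open>h *\<^sub>R w\<close> inside the ball of radius \<open>d\<close>; the summand 1 keeps
    the denominator positive.\<close>
  define h where "h = d / (norm v + norm w + 1)"
  have nn: "0 < norm v + norm w + 1" by (simp add: add_nonneg_pos)
  then have h: "h > 0" using d by (simp add: h_def)
  have near: "dist (y + s *\<^sub>R v + t *\<^sub>R w) y < d" if "0 \<le> s" "s \<le> h" "0 \<le> t" "t \<le> h" for s t
  proof -
    have "dist (y + s *\<^sub>R v + t *\<^sub>R w) y = norm (s *\<^sub>R v + t *\<^sub>R w)" by (simp add: dist_norm add.assoc)
    also have "\<dots> \<le> s * norm v + t * norm w" using norm_triangle_ineq[of "s *\<^sub>R v" "t *\<^sub>R w"] that by simp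
    also have "\<dots> \<le> h * norm v + h * norm w" using that by (intro add_mono mult_right_mono) auto
    also have "\<dots> < h * (norm v + norm w + 1)" using h by (simp add: algebra_simps)
    also have "\<dots> = d" using nn by (simp add: h_def)
    finally show ?thesis .
  qed
  have inV: "y + s *\<^sub>R v + t *\<^sub>R w \<in> V" if "0 \<le> s" "s \<le> h" "0 \<le> t" "t \<le> h" for s t
    using near[OF that] d3 by (auto simp: d_def dist_commute subset_iff)
  have swap: "y + t *\<^sub>R w + s *\<^sub>R v = y + s *\<^sub>R v + t *\<^sub>R w" for s t by (simp add: ac_simps)
  have inV': "y + s *\<^sub>R w + t *\<^sub>R v \<in> V" if "0 \<le> s" "s \<le> h" "0 \<le> t" "t \<le> h" for s t
    using inV[OF that(3,4,1,2)] by (simp only: swap[of s t])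
  obtain s t where st: "0 < s" "s < h" "0 < t" "t < h"
    "f (y + h *\<^sub>R v + h *\<^sub>R w) - f (y + h *\<^sub>R v) - (f (y + h *\<^sub>R w) - f y) = h * h * A (y + s *\<^sub>R v + t *\<^sub>R w) w"
    using second_difference[OF h, of f f' y v w A, OF f[OF inV] A[OF inV]] by blast
  obtain s' t' where st': "0 < s'" "s' < h" "0 < t'" "t' < h"
    "f (y + h *\<^sub>R w + h *\<^sub>R v) - f (y + h *\<^sub>R w) - (f (y + h *\<^sub>R v) - f y) = h * h * B (y + s' *\<^sub>R w + t' *\<^sub>R v) v"
    using second_difference[OF h, of f f' y w v B, OF f[OF inV'] B[OF inV']] by blast
  have "h * h * A (y + s *\<^sub>R v + t *\<^sub>R w) w = h * h * B (y + s' *\<^sub>R w + t' *\<^sub>R v) v"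
    using st(5) st'(5) unfolding swap[of h h] by linarith
  then have eq: "A (y + s *\<^sub>R v + t *\<^sub>R w) w = B (y + t' *\<^sub>R v + s' *\<^sub>R w) v"
    using h swap[of s' t'] by simp
  have "dist (A (y + s *\<^sub>R v + t *\<^sub>R w) w) (A y w) < e"
    using near[of s t] st by (intro d1) (simp add: d_def)
  moreover have "dist (B (y + t' *\<^sub>R v + s' *\<^sub>R w) v) (B y v) < e"
    using near[of t' s'] st' by (intro d2) (simp add: d_def)
  ultimately have "\<bar>A y w - B y v\<bar> < 2 * e" unfolding eq dist_real_def by linarith
  then show False by (simp add: e_def)
qed

lemma second_derivative_symmetric:
  fixes F :: "'a::real_normed_vector \<Rightarrow> 'b::euclidean_space"
  assumes V: "open V" "y \<in> V" and F: "Ck_on 2 F V"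
  shows "frechet_derivative (\<lambda>x. frechet_derivative F (at x) v) (at y) w =
         frechet_derivative (\<lambda>x. frechet_derivative F (at x) w) (at y) v"
proof (rule euclidean_eqI)
  fix b :: 'b assume "b \<in> Basis"
  let ?D = "\<lambda>x. frechet_derivative F (at x)"
  let ?DD = "\<lambda>v x. frechet_derivative (\<lambda>x. frechet_derivative F (at x) v) (at x)"
  note F1 = Ck_on_2D(1)[OF F]
  have d0: "((\<lambda>x. F x \<bullet> b) has_derivative (\<lambda>v. ?D x v \<bullet> b)) (at x)" if "x \<in> V" for x
    by (intro has_derivative_inner_left Ck_on_2D(2)[OF F that])
  have d1: "((\<lambda>x. ?D x u \<bullet> b) has_derivative (\<lambda>w. ?DD u x w \<bullet> b)) (at x)" if "x \<in> V" for x u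
    by (intro has_derivative_inner_left C1_has_derivative[OF F1 that])
  have d2: "continuous_on V (\<lambda>x. ?DD u x z \<bullet> b)" for u z
    by (intro continuous_on_inner continuous_on_const C1_continuous_derivative[OF F1])
  show "?DD v y w \<bullet> b = ?DD w y v \<bullet> b"
    by (rule second_derivative_symmetric_real[OF V d0 d1 d1 d2 d2])
qed

section \<open>Local geometry of a minimal immersion\<close>

definition chart_density :: "(real^'k::finite \<Rightarrow> 'a::euclidean_space) \<Rightarrow> real^'k \<Rightarrow> real" where
  "chart_density F y = sqrt (det (first_ff F y))"

text \<open>Coordinates of the tangential part of the constant vector field \<open>p\<close>, i.e. of the gradient
  of the height function \<open>F y \<bullet> p\<close>.\<close>

definition chart_grad :: "(real^'k::finite \<Rightarrow> 'a::euclidean_space) \<Rightarrow> 'a \<Rightarrow> real^'k \<Rightarrow> real^'k" where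
  "chart_grad F p y = matrix_inv (first_ff F y) *v (\<chi> j. pderiv_at F j y \<bullet> p)"

lemma first_ff_gram: "first_ff F y = gram (frechet_derivative F (at y))"
  by (simp add: first_ff_def gram_def pderiv_at_def)

locale immersed_chart =
  fixes V :: "(real^'k::finite) set" and F :: "real^'k \<Rightarrow> 'a::euclidean_space"
  assumes V: "open V" and smooth: "smooth_on F V"
    and inj: "\<And>y. y \<in> V \<Longrightarrow> inj (frechet_derivative F (at y))"
    and unit: "\<And>y. y \<in> V \<Longrightarrow> norm (F y) = 1"
begin

lemma C2: "Ck_on 2 F V"
  using smooth by (simp add: smooth_on_def)

lemma C1_F: "C1 F V"
  using smooth by (simp add: smooth_on_def)

lemmas D = C1_has_derivative[OF C1_F]
lemmas linear_D = C1_linear_derivative[OF C1_F]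

lemma C1_pderiv: "C1 (pderiv_at F i) V"
  using Ck_on_2D(1)[OF C2, of "axis i 1"] by (simp add: pderiv_at_def[abs_def])

lemma C1_first_ff: "C1 (\<lambda>y. first_ff F y $ i $ j) V"
  unfolding first_ff_def by (simp add: C1_inner C1_pderiv)

lemma det_first_ff_pos: "y \<in> V \<Longrightarrow> det (first_ff F y) > 0"
  unfolding first_ff_gram by (rule det_gram_pos[OF linear_D inj])

lemma invertible_first_ff: "y \<in> V \<Longrightarrow> invertible (first_ff F y)"
  unfolding first_ff_gram by (rule invertible_gram[OF linear_D inj])

lemma C1_density: "C1 (chart_density F) V"
  unfolding chart_density_def[abs_def] by (intro C1_sqrt C1_det C1_first_ff det_first_ff_pos)

lemma density_pos: "y \<in> V \<Longrightarrow> chart_density F y > 0"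
  unfolding chart_density_def using det_first_ff_pos by simp

lemma first_ff_grad: "y \<in> V \<Longrightarrow> first_ff F y *v chart_grad F p y = (\<chi> j. pderiv_at F j y \<bullet> p)"
  unfolding chart_grad_def
  by (simp add: matrix_vector_mul_assoc matrix_inv[OF invertible_first_ff])

text \<open>\<open>matrix_inv\<close> is defined by choice, so differentiability is read off from
  Cramer's rule instead.\<close>

lemma C1_grad: "C1 (chart_grad F p) V"
proof (rule C1_vec, rule C1_cong[OF V])
  fix k y assume y: "y \<in> V"
  let ?b = "\<lambda>y. \<chi> j. pderiv_at F j y \<bullet> p"
  have "det (first_ff F y) \<noteq> 0" using det_first_ff_pos[OF y] by simp
  then have "chart_grad F p y = (\<chi> k. det (\<chi> i j. if j = k then ?b y $ i else first_ff F y $ i $ j) / det (first_ff F y))"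
    using cramer[of "first_ff F y" "chart_grad F p y" "?b y"] first_ff_grad[OF y] by blast
  then show "chart_grad F p y $ k = det (\<chi> i j. if j = k then pderiv_at F i y \<bullet> p else first_ff F y $ i $ j) / det (first_ff F y)"
    by (simp cong: if_cong)
next
  fix k
  have "C1 (\<lambda>y. (\<chi> i j. if j = k then pderiv_at F i y \<bullet> p else first_ff F y $ i $ j) $ i $ j) V" for i j
    by (cases "j = k") (simp_all add: C1_inner C1_pderiv C1_const C1_first_ff)
  then show "C1 (\<lambda>y. det (\<chi> i j. if j = k then pderiv_at F i y \<bullet> p else first_ff F y $ i $ j) / det (first_ff F y)) V"
    using det_first_ff_pos by (intro C1_divide C1_det C1_first_ff) force+
qed

text \<open>The orthogonal projection of \<open>p\<close> to the tangent space:
  \<open>first_ff_grad\<close> is the system of normal equations for its coordinates.\<close>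

definition tangent_part :: "'a \<Rightarrow> real^'k \<Rightarrow> 'a" where
  "tangent_part p y = frechet_derivative F (at y) (chart_grad F p y)"

lemma pderiv_tangent_part:
  assumes "y \<in> V"
  shows "pderiv_at F j y \<bullet> tangent_part p y = pderiv_at F j y \<bullet> p"
proof -
  have "pderiv_at F j y \<bullet> tangent_part p y = axis j 1 \<bullet> (first_ff F y *v chart_grad F p y)"
    unfolding tangent_part_def pderiv_at_def first_ff_gram by (rule gram_inner[OF linear_D[OF assms]])
  then show ?thesis by (simp add: first_ff_grad[OF assms] inner_axis')
qed

lemma derivative_tangent_part:
  assumes "y \<in> V"
  shows "frechet_derivative F (at y) v \<bullet> tangent_part p y = frechet_derivative F (at y) v \<bullet> p"
  unfolding linear_axis_expand[OF linear_D[OF assms], of v]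
  using pderiv_tangent_part[OF assms, of _ p] by (simp add: inner_sum_left pderiv_at_def)

text \<open>The function F . F is constant on \<open>V\<close>, and its derivative in direction
  \<open>v\<close> is twice this inner product.\<close>

lemma F_orthogonal:
  assumes "y \<in> V" shows "F y \<bullet> frechet_derivative F (at y) v = 0"
proof -
  have 1: "((\<lambda>y. F y \<bullet> F y) has_derivative (\<lambda>v. F y \<bullet> frechet_derivative F (at y) v + frechet_derivative F (at y) v \<bullet> F y)) (at y)"
    by (intro has_derivative_inner D assms)
  have "F y \<bullet> F y = 1" if "y \<in> V" for y using unit[OF that] by (simp add: dot_square_norm)
  then have 2: "((\<lambda>y. F y \<bullet> F y) has_derivative (\<lambda>v. 0)) (at y)"
    by (intro has_derivative_transform_within_open[OF has_derivative_const[of 1] V assms]) auto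
  show ?thesis using fun_cong[OF has_derivative_unique[OF 1 2], of v] by (simp add: inner_commute)
qed

text \<open>The remainder p - X - u F has nonnegative squared length. Expanding it uses that X is
  orthogonal to F and that p . X = X . X.\<close>

lemma tangent_part_bound:
  assumes y: "y \<in> V" and p: "norm p = 1"
  shows "(norm (tangent_part p y))\<^sup>2 \<le> 1 - (F y \<bullet> p)\<^sup>2"
    and "p \<bullet> tangent_part p y = (norm (tangent_part p y))\<^sup>2"
proof -
  let ?X = "tangent_part p y" and ?u = "F y \<bullet> p"
  have Xp: "p \<bullet> ?X = ?X \<bullet> ?X"
    using derivative_tangent_part[OF y, of "chart_grad F p y" p] by (simp add: tangent_part_def inner_commute)
  then show "p \<bullet> ?X = (norm ?X)\<^sup>2" by (simp add: power2_norm_eq_inner)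
  have FX: "F y \<bullet> ?X = 0" unfolding tangent_part_def by (rule F_orthogonal[OF y])
  have pp: "p \<bullet> p = 1" "F y \<bullet> F y = 1" using p unit[OF y] by (simp_all add: dot_square_norm)
  have "0 \<le> (p - ?X - ?u *\<^sub>R F y) \<bullet> (p - ?X - ?u *\<^sub>R F y)" by simp
  also have "\<dots> = 1 - ?X \<bullet> ?X - ?u\<^sup>2"
    using Xp FX pp by (simp add: inner_diff_left inner_diff_right inner_commute power2_eq_square)
  finally show "(norm ?X)\<^sup>2 \<le> 1 - ?u\<^sup>2" by (simp add: power2_norm_eq_inner)
qed

abbreviation "pp_deriv i j y \<equiv> pderiv_at (pderiv_at F i) j y"

lemma pp_deriv_sym: "y \<in> V \<Longrightarrow> pp_deriv i j y = pp_deriv j i y"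
  using second_derivative_symmetric[OF V _ C2, of y "axis i 1" "axis j 1"]
  by (simp add: pderiv_at_def[abs_def])

text \<open>Differentiate F . F_i = 0. In the direction of the position vector only the curvature of
  the unit sphere itself is seen.\<close>

lemma pp_deriv_F:
  assumes y: "y \<in> V" shows "pp_deriv i j y \<bullet> F y = - first_ff F y $ i $ j"
proof -
  have 1: "((\<lambda>x. F x \<bullet> pderiv_at F i x) has_derivative
      (\<lambda>v. F y \<bullet> frechet_derivative (pderiv_at F i) (at y) v + frechet_derivative F (at y) v \<bullet> pderiv_at F i y)) (at y)"
    by (intro has_derivative_inner D y C1_has_derivative[OF C1_pderiv y])
  have "F x \<bullet> pderiv_at F i x = 0" if "x \<in> V" for x
    unfolding pderiv_at_def by (rule F_orthogonal[OF that])
  then have 2: "((\<lambda>x. F x \<bullet> pderiv_at F i x) has_derivative (\<lambda>v. 0)) (at y)"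
    by (intro has_derivative_transform_within_open[OF has_derivative_const[of 0] V y]) simp
  have "F y \<bullet> pp_deriv i j y + pderiv_at F j y \<bullet> pderiv_at F i y = 0"
    unfolding pderiv_at_def[of "pderiv_at F i" j y] pderiv_at_def[of F j y]
    by (rule fun_cong[OF has_derivative_unique[OF 1 2]])
  then show ?thesis
    by (simp add: first_ff_def inner_commute[of "pp_deriv i j y"] inner_commute[of "pderiv_at F i y"] eq_neg_iff_add_eq_0)
qed

text \<open>Differentiating \<open>F\<^sub>j \<bullet> X = F\<^sub>j \<bullet> p\<close>, where \<open>X = \<Sum>\<^sub>i w\<^sub>i F\<^sub>i\<close> is the tangential part of \<open>p\<close>.\<close>

lemma grad_derivative:
  assumes y: "y \<in> V"
  shows "(\<Sum>i\<in>UNIV. first_ff F y $ j $ i * pderiv_at (chart_grad F p) l y $ i) =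
    pp_deriv j l y \<bullet> (p - tangent_part p y) - (\<Sum>i\<in>UNIV. chart_grad F p y $ i * (pderiv_at F j y \<bullet> pp_deriv i l y))"
proof -
  let ?W = "chart_grad F p" and ?e = "axis l 1"
  have X: "tangent_part p x = (\<Sum>i\<in>UNIV. (?W x $ i) *\<^sub>R pderiv_at F i x)" if "x \<in> V" for x
    unfolding tangent_part_def pderiv_at_def by (rule linear_axis_expand[OF linear_D[OF that]])
  have Wd: "((\<lambda>x. ?W x $ i) has_derivative (\<lambda>v. frechet_derivative ?W (at y) v $ i)) (at y)" for i
    by (rule bounded_linear.has_derivative[OF bounded_linear_vec_nth C1_has_derivative[OF C1_grad y]])
  have pd: "(pderiv_at F i has_derivative frechet_derivative (pderiv_at F i) (at y)) (at y)" for i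
    by (rule C1_has_derivative[OF C1_pderiv y])
  have 1: "((\<lambda>x. pderiv_at F j x \<bullet> (\<Sum>i\<in>UNIV. (?W x $ i) *\<^sub>R pderiv_at F i x)) has_derivative
     (\<lambda>v. pderiv_at F j y \<bullet> (\<Sum>i\<in>UNIV. (?W y $ i) *\<^sub>R frechet_derivative (pderiv_at F i) (at y) v
              + (frechet_derivative ?W (at y) v $ i) *\<^sub>R pderiv_at F i y)
        + frechet_derivative (pderiv_at F j) (at y) v \<bullet> (\<Sum>i\<in>UNIV. (?W y $ i) *\<^sub>R pderiv_at F i y))) (at y)"
    by (intro has_derivative_inner has_derivative_sum has_derivative_scaleR Wd pd)
  have 2: "((\<lambda>x. pderiv_at F j x \<bullet> (\<Sum>i\<in>UNIV. (?W x $ i) *\<^sub>R pderiv_at F i x)) has_derivative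
     (\<lambda>v. frechet_derivative (pderiv_at F j) (at y) v \<bullet> p)) (at y)"
    by (rule has_derivative_transform_within_open[OF has_derivative_inner_left[OF pd] V y])
       (simp add: X[symmetric] pderiv_tangent_part)
  have "pderiv_at F j y \<bullet> (\<Sum>i\<in>UNIV. (?W y $ i) *\<^sub>R pp_deriv i l y + (pderiv_at ?W l y $ i) *\<^sub>R pderiv_at F i y)
        + pp_deriv j l y \<bullet> (\<Sum>i\<in>UNIV. (?W y $ i) *\<^sub>R pderiv_at F i y) = pp_deriv j l y \<bullet> p"
    using fun_cong[OF has_derivative_unique[OF 1 2], of ?e] by (simp add: pderiv_at_def[of "pderiv_at F _"] pderiv_at_def[of ?W])
  then show ?thesis
    unfolding X[OF y, symmetric]
    by (simp add: inner_sum_right inner_add_right sum.distrib first_ff_def inner_diff_right algebra_simps)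
qed

text \<open>The transpose of an inverse of a symmetric matrix is again an inverse of it.\<close>

lemma matrix_inv_first_ff_sym:
  assumes y: "y \<in> V"
  shows "matrix_inv (first_ff F y) $ i $ j = matrix_inv (first_ff F y) $ j $ i"
proof -
  let ?G = "first_ff F y" and ?H = "matrix_inv (first_ff F y)"
  note GH = matrix_inv[OF invertible_first_ff[OF y]]
  have tG: "transpose ?G = ?G" by (simp add: transpose_def first_ff_def inner_commute vec_eq_iff)
  have "transpose (?G ** ?H) = mat 1" by (simp add: GH transpose_mat)
  then have hg: "transpose ?H ** ?G = mat 1" by (simp only: matrix_transpose_mul tG)
  have "transpose ?H = transpose ?H ** (?G ** ?H)" by (simp only: GH matrix_mul_rid)
  also have "\<dots> = ?H" by (simp only: matrix_mul_assoc hg matrix_mul_lid)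
  finally have "transpose ?H $ j $ i = ?H $ j $ i" by (simp only:)
  then show ?thesis by (simp add: transpose_def)
qed

text \<open>Jacobi's formula for the determinant of the metric. The product rule gives two terms for
  each entry; by symmetry of the inverse they have equal traces, which cancels the factor 1/2 from
  the square root.\<close>

lemma density_derivative:
  assumes y: "y \<in> V"
  shows "frechet_derivative (chart_density F) (at y) (axis i 1) = chart_density F y *
    (\<Sum>l\<in>UNIV. \<Sum>j\<in>UNIV. matrix_inv (first_ff F y) $ l $ j * (pderiv_at F j y \<bullet> pp_deriv l i y))"
proof -
  let ?H = "matrix_inv (first_ff F y)" and ?e = "axis i 1"
  let ?G' = "\<lambda>v. \<chi> j l. pderiv_at F j y \<bullet> frechet_derivative (pderiv_at F l) (at y) v
      + frechet_derivative (pderiv_at F j) (at y) v \<bullet> pderiv_at F l y"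
  let ?S = "\<Sum>l\<in>UNIV. \<Sum>j\<in>UNIV. ?H $ l $ j * (pderiv_at F j y \<bullet> pp_deriv l i y)"
  have pd: "(pderiv_at F i has_derivative frechet_derivative (pderiv_at F i) (at y)) (at y)" for i
    by (rule C1_has_derivative[OF C1_pderiv y])
  have "((\<lambda>x. det (first_ff F x)) has_derivative (\<lambda>v. det (first_ff F y) * trace (?H ** ?G' v))) (at y)"
  proof (rule det_has_derivative)
    show "((\<lambda>x. first_ff F x $ i $ j) has_derivative (\<lambda>v. ?G' v $ i $ j)) (at y)" for i j
      by (simp add: first_ff_def has_derivative_inner pd)
  qed (rule invertible_first_ff[OF y])
  moreover have "(sqrt has_derivative (*) (inverse (sqrt (det (first_ff F y))) / 2)) (at (det (first_ff F y)))"
    using DERIV_real_sqrt[OF det_first_ff_pos[OF y]] by (simp add: has_field_derivative_def)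
  ultimately have "((\<lambda>x. sqrt (det (first_ff F x))) has_derivative
     (\<lambda>v. inverse (sqrt (det (first_ff F y))) / 2 * (det (first_ff F y) * trace (?H ** ?G' v)))) (at y)"
    by (rule has_derivative_compose)
  then have "frechet_derivative (chart_density F) (at y) = (\<lambda>v. inverse (sqrt (det (first_ff F y))) / 2 * (det (first_ff F y) * trace (?H ** ?G' v)))"
    unfolding chart_density_def[abs_def] by (rule frechet_derivative_at[symmetric])
  then have "frechet_derivative (chart_density F) (at y) ?e = inverse (sqrt (det (first_ff F y))) / 2 * (det (first_ff F y) * trace (?H ** ?G' ?e))"
    by simp
  also have "\<dots> = (det (first_ff F y) / sqrt (det (first_ff F y))) * trace (?H ** ?G' ?e) / 2"
    by (simp add: field_simps)
  also have "\<dots> = chart_density F y * trace (?H ** ?G' ?e) / 2"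
    using det_first_ff_pos[OF y] by (simp add: real_div_sqrt chart_density_def)
  also have "trace (?H ** ?G' ?e) = 2 * ?S"
  proof -
    have "trace (?H ** ?G' ?e) = (\<Sum>l\<in>UNIV. \<Sum>j\<in>UNIV. ?H $ l $ j * (pderiv_at F j y \<bullet> pp_deriv l i y + pp_deriv j i y \<bullet> pderiv_at F l y))"
      by (simp add: trace_def matrix_matrix_mult_def pderiv_at_def[of "pderiv_at F _"])
    also have "\<dots> = ?S + (\<Sum>l\<in>UNIV. \<Sum>j\<in>UNIV. ?H $ l $ j * (pp_deriv j i y \<bullet> pderiv_at F l y))"
      by (simp add: distrib_left sum.distrib)
    also have "(\<Sum>l\<in>UNIV. \<Sum>j\<in>UNIV. ?H $ l $ j * (pp_deriv j i y \<bullet> pderiv_at F l y)) = ?S"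
      by (subst sum.swap) (simp add: inner_commute matrix_inv_first_ff_sym[OF y])
    finally show ?thesis by simp
  qed
  finally show ?thesis by simp
qed

end

locale minimal_chart = immersed_chart V F
  for V :: "(real^'k::finite) set" and F :: "real^'k \<Rightarrow> 'a::euclidean_space" +
  assumes minimal: "\<And>y. y \<in> V \<Longrightarrow> mean_curvature F y = 0"
begin

text \<open>Here p - X = N + u F with N normal to the submanifold inside the sphere. The trace
  against N is the mean curvature, hence zero; the trace against u F is - u times the trace of the
  identity, by \<open>pp_deriv_F\<close>.\<close>

lemma trace_second_derivative:
  assumes y: "y \<in> V"
  shows "(\<Sum>i\<in>UNIV. \<Sum>j\<in>UNIV. matrix_inv (first_ff F y) $ i $ j * (pp_deriv i j y \<bullet> (p - tangent_part p y))) =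
    - (real CARD('k) * (F y \<bullet> p))"
proof -
  let ?H = "matrix_inv (first_ff F y)" and ?u = "F y \<bullet> p" and ?S = "normal_space F y"
  let ?N = "p - tangent_part p y - ?u *\<^sub>R F y"
  have sub: "subspace ?S" unfolding normal_space_def by (rule subspace_orthogonal_comp)
  have FF: "F y \<bullet> F y = 1" using unit[OF y] by (simp add: dot_square_norm)
  have FX: "F y \<bullet> tangent_part p y = 0" unfolding tangent_part_def by (rule F_orthogonal[OF y])
  have N1: "F y \<bullet> ?N = 0" using FF FX by (simp add: inner_diff_right)
  have N2: "pderiv_at F i y \<bullet> ?N = 0" for i
    using pderiv_tangent_part[OF y, of i p] F_orthogonal[OF y, of "axis i 1"]
    by (simp add: inner_diff_right pderiv_at_def inner_commute[of "frechet_derivative F (at y) _" "F y"])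
  have NS: "?N \<in> ?S"
    unfolding normal_space_def orthogonal_comp_def orthogonal_def
  proof (intro CollectI ballI)
    fix x assume "x \<in> span (insert (F y) (range (\<lambda>i. pderiv_at F i y)))"
    then show "x \<bullet> ?N = 0"
    proof (rule span_induct)
      show "subspace {x. x \<bullet> ?N = 0}" by (simp add: subspace_def inner_add_left)
      show "x \<bullet> ?N = 0" if "x \<in> insert (F y) (range (\<lambda>i. pderiv_at F i y))" for x
        using that N1 N2 by auto
    qed
  qed
  \<comment> \<open>The variational inequality of the closest point, tested at displacements
    \<open>?N\<close> and \<open>- ?N\<close>, becomes orthogonality because the set is a
    subspace.\<close>
  have proj: "a \<bullet> ?N = closest_point ?S a \<bullet> ?N" for a
  proof -
    let ?c = "closest_point ?S a"
    have cl: "closed ?S" "convex ?S" "?S \<noteq> {}"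
      using sub subspace_0 by (auto simp: closed_subspace subspace_imp_convex)
    have cS: "?c \<in> ?S" using closest_point_in_set[OF cl(1,3)] .
    have "(a - ?c) \<bullet> ((?c + ?N) - ?c) \<le> 0"
      by (rule closest_point_dot[OF cl(2,1)]) (use sub cS NS in \<open>simp add: subspace_add\<close>)
    moreover have "(a - ?c) \<bullet> ((?c - ?N) - ?c) \<le> 0"
      by (rule closest_point_dot[OF cl(2,1)]) (use sub cS NS in \<open>simp add: subspace_diff\<close>)
    moreover have "a \<bullet> n = ?c \<bullet> n" if "(a - ?c) \<bullet> ((?c + n) - ?c) \<le> 0" "(a - ?c) \<bullet> ((?c - n) - ?c) \<le> 0" for n
      using that by (simp add: inner_diff_left)
    ultimately show ?thesis by blast
  qed
  have e: "pp_deriv i j y \<bullet> (p - tangent_part p y) = second_ff F i j y \<bullet> ?N - ?u * first_ff F y $ i $ j" for i j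
  proof -
    have "pp_deriv i j y \<bullet> (p - tangent_part p y) = pp_deriv i j y \<bullet> ?N + ?u * (pp_deriv i j y \<bullet> F y)"
      by (simp add: inner_diff_right)
    also have "\<dots> = second_ff F i j y \<bullet> ?N - ?u * first_ff F y $ i $ j"
      unfolding second_ff_def proj[of "pp_deriv i j y"] pp_deriv_F[OF y] by simp
    finally show ?thesis .
  qed
  have "(\<Sum>i\<in>UNIV. \<Sum>j\<in>UNIV. ?H $ i $ j * (second_ff F i j y \<bullet> ?N)) = mean_curvature F y \<bullet> ?N"
    by (simp add: mean_curvature_def inner_sum_left)
  then have 1: "(\<Sum>i\<in>UNIV. \<Sum>j\<in>UNIV. ?H $ i $ j * (second_ff F i j y \<bullet> ?N)) = 0"
    by (simp add: minimal[OF y])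
  have "(\<Sum>i\<in>UNIV. \<Sum>j\<in>UNIV. ?H $ i $ j * (?u * first_ff F y $ i $ j)) = ?u * trace (?H ** first_ff F y)"
    by (simp add: trace_def matrix_matrix_mult_def sum_distrib_left first_ff_def inner_commute mult_ac)
  also have "\<dots> = ?u * real CARD('k)"
    by (simp add: matrix_inv[OF invertible_first_ff[OF y]] trace_I)
  finally show ?thesis using 1 unfolding e by (simp add: right_diff_distrib sum_subtractf)
qed

text \<open>In coordinates this is the statement that the tangential part of \<open>p\<close> has
  divergence - k u. The first-order terms left over by \<open>grad_derivative\<close> are exactly
  those produced by differentiating the density.\<close>

lemma divergence_grad:
  assumes y: "y \<in> V"
  shows "(\<Sum>i\<in>UNIV. pderiv_at (chart_grad F p) i y $ i * chart_density F y
      + chart_grad F p y $ i * frechet_derivative (chart_density F) (at y) (axis i 1))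
    = - (real CARD('k) * (F y \<bullet> p)) * chart_density F y"
proof -
  let ?H = "matrix_inv (first_ff F y)" and ?G = "first_ff F y" and ?W = "chart_grad F p"
  let ?N = "p - tangent_part p y"
  \<comment> \<open>The identity is inserted as inverse metric times metric, because
    \<open>grad_derivative\<close> only knows the derivative of the coordinates after multiplication
    by the metric.\<close>
  have "(\<Sum>l\<in>UNIV. pderiv_at ?W l y $ l) = (\<Sum>l\<in>UNIV. \<Sum>i\<in>UNIV. (?H ** ?G) $ l $ i * pderiv_at ?W l y $ i)"
    by (simp add: matrix_inv[OF invertible_first_ff[OF y]] mat_def if_distrib[of "\<lambda>x. x * _"] cong: if_cong)
  also have "\<dots> = (\<Sum>l\<in>UNIV. \<Sum>i\<in>UNIV. \<Sum>j\<in>UNIV. ?H $ l $ j * (?G $ j $ i * pderiv_at ?W l y $ i))"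
    by (simp add: matrix_matrix_mult_def sum_distrib_right mult.assoc)
  also have "\<dots> = (\<Sum>l\<in>UNIV. \<Sum>j\<in>UNIV. \<Sum>i\<in>UNIV. ?H $ l $ j * (?G $ j $ i * pderiv_at ?W l y $ i))"
    by (rule sum.cong[OF refl]) (rule sum.swap)
  also have "\<dots> = (\<Sum>l\<in>UNIV. \<Sum>j\<in>UNIV. ?H $ l $ j * (pp_deriv j l y \<bullet> ?N - (\<Sum>i\<in>UNIV. ?W y $ i * (pderiv_at F j y \<bullet> pp_deriv i l y))))"
    by (simp add: sum_distrib_left[symmetric] grad_derivative[OF y])
  also have "\<dots> = (\<Sum>l\<in>UNIV. \<Sum>j\<in>UNIV. ?H $ l $ j * (pp_deriv j l y \<bullet> ?N))
     - (\<Sum>l\<in>UNIV. \<Sum>j\<in>UNIV. \<Sum>i\<in>UNIV. ?W y $ i * (?H $ l $ j * (pderiv_at F j y \<bullet> pp_deriv i l y)))"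
    by (simp add: right_diff_distrib sum_subtractf sum_distrib_left mult_ac)
  also have "(\<Sum>l\<in>UNIV. \<Sum>j\<in>UNIV. ?H $ l $ j * (pp_deriv j l y \<bullet> ?N)) = - (real CARD('k) * (F y \<bullet> p))"
    unfolding trace_second_derivative[OF y, symmetric] by (simp add: pp_deriv_sym[OF y])
  also have "(\<Sum>l\<in>UNIV. \<Sum>j\<in>UNIV. \<Sum>i\<in>UNIV. ?W y $ i * (?H $ l $ j * (pderiv_at F j y \<bullet> pp_deriv i l y)))
     = (\<Sum>l\<in>UNIV. \<Sum>i\<in>UNIV. \<Sum>j\<in>UNIV. ?W y $ i * (?H $ l $ j * (pderiv_at F j y \<bullet> pp_deriv i l y)))"
    by (rule sum.cong[OF refl]) (rule sum.swap)
  also have "\<dots> = (\<Sum>i\<in>UNIV. \<Sum>l\<in>UNIV. \<Sum>j\<in>UNIV. ?W y $ i * (?H $ l $ j * (pderiv_at F j y \<bullet> pp_deriv i l y)))"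
    by (rule sum.swap)
  also have "\<dots> = (\<Sum>i\<in>UNIV. ?W y $ i * (\<Sum>l\<in>UNIV. \<Sum>j\<in>UNIV. ?H $ l $ j * (pderiv_at F j y \<bullet> pp_deriv l i y)))"
    by (simp only: sum_distrib_left pp_deriv_sym[OF y])
  finally have div: "(\<Sum>l\<in>UNIV. pderiv_at ?W l y $ l) = - (real CARD('k) * (F y \<bullet> p))
     - (\<Sum>i\<in>UNIV. ?W y $ i * (\<Sum>l\<in>UNIV. \<Sum>j\<in>UNIV. ?H $ l $ j * (pderiv_at F j y \<bullet> pp_deriv l i y)))" .
  have "(\<Sum>i\<in>UNIV. pderiv_at ?W i y $ i * chart_density F y
      + ?W y $ i * frechet_derivative (chart_density F) (at y) (axis i 1))
    = chart_density F y * ((\<Sum>l\<in>UNIV. pderiv_at ?W l y $ l)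
      + (\<Sum>i\<in>UNIV. ?W y $ i * (\<Sum>l\<in>UNIV. \<Sum>j\<in>UNIV. ?H $ l $ j * (pderiv_at F j y \<bullet> pp_deriv l i y))))"
    by (simp only: density_derivative[OF y] sum.distrib sum_distrib_left distrib_left mult_ac)
  then show ?thesis unfolding div by simp
qed

end

section \<open>The Riemannian measure of an immersed manifold\<close>

text \<open>The volume formula for images says that \<open>T\<close> pushes the measure with density
  the absolute Jacobian forward to Lebesgue measure on the image; integrating \<open>g\<close>
  against both gives the claim.\<close>

lemma nn_integral_change_of_variables:
  fixes T :: "real^'k::finite \<Rightarrow> real^'k"
  assumes U: "U \<in> sets borel" and TU: "T ` U \<in> sets borel"
    and d: "\<And>x. x \<in> U \<Longrightarrow> (T has_derivative T' x) (at x)"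
    and inj: "inj_on T U"
    and m: "(\<lambda>x. indicator U x * \<bar>det (matrix (T' x))\<bar>) \<in> borel_measurable borel"
    and g: "g \<in> borel_measurable borel"
  shows "(\<integral>\<^sup>+x. indicator U x * (ennreal \<bar>det (matrix (T' x))\<bar> * g (T x)) \<partial>lborel) = (\<integral>\<^sup>+z. indicator (T ` U) z * g z \<partial>lborel)"
proof -
  define J where "J = (\<lambda>x. ennreal (indicator U x * \<bar>det (matrix (T' x))\<bar>))"
  \<comment> \<open>Nothing is known about \<open>T\<close> outside \<open>U\<close>, so it is
    replaced there by 0 to obtain a Borel map; the density \<open>J\<close> vanishes there.\<close>
  define R where "R = (\<lambda>x. if x \<in> U then T x else 0)"
  have "continuous_on U T"
    by (meson d has_derivative_continuous continuous_at_imp_continuous_on)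
  then have "(\<lambda>x. if x \<in> U then T x else 0) \<in> borel_measurable borel"
    by (intro borel_measurable_continuous_on_if U) auto
  then have R[measurable]: "R \<in> borel_measurable borel" by (simp add: R_def)
  have J[measurable]: "J \<in> borel_measurable borel" using m unfolding J_def by simp
  have "distr (density lborel J) borel R = density lborel (indicator (T ` U))"
  proof (rule measure_eqI)
    fix E assume "E \<in> sets (distr (density lborel J) borel R)"
    then have E: "E \<in> sets borel" by simp
    let ?S = "U \<inter> R -` E"
    have S: "?S \<in> sets borel" using U measurable_sets[OF R E] by auto
    have im: "T ` ?S = E \<inter> T ` U" by (auto simp: R_def)
    have "emeasure (distr (density lborel J) borel R) E = emeasure (density lborel J) (R -` E)"
      using E by (subst emeasure_distr) auto
    also have "\<dots> = (\<integral>\<^sup>+x. J x * indicator (R -` E) x \<partial>lborel)"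
      using measurable_sets[OF R E] by (subst emeasure_density) auto
    also have "\<dots> = (\<integral>\<^sup>+x\<in>?S. ennreal \<bar>det (matrix (T' x))\<bar> \<partial>lborel)"
      by (intro nn_integral_cong) (auto simp: indicator_def J_def R_def)
    also have "\<dots> = emeasure lborel (T ` ?S)"
    proof (rule emeasure_differentiable_image[symmetric])
      show "?S \<in> sets borel" by (rule S)
      show "T ` ?S \<in> sets borel" unfolding im using E TU by auto
      show "inj_on T ?S" using inj by (rule inj_on_subset) auto
      have "(\<lambda>x. indicator ?S x * (indicator U x * \<bar>det (matrix (T' x))\<bar>)) \<in> borel_measurable borel"
        using S m by measurable
      moreover have "indicator ?S x * (indicator U x * \<bar>det (matrix (T' x))\<bar>) = indicator ?S x * \<bar>det (matrix (T' x))\<bar>" for x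
        by (auto simp: indicator_def)
      ultimately show "(\<lambda>x. indicator ?S x * \<bar>det (matrix (T' x))\<bar>) \<in> borel_measurable borel"
        by simp
    qed (use d in auto)
    also have "\<dots> = emeasure (density lborel (indicator (T ` U))) E"
      unfolding im using E TU by (subst emeasure_density) (auto simp: indicator_inter_arith[symmetric] Int_commute)
    finally show "emeasure (distr (density lborel J) borel R) E = emeasure (density lborel (indicator (T ` U))) E" .
  qed simp
  then have "(\<integral>\<^sup>+z. g z \<partial>distr (density lborel J) borel R) = (\<integral>\<^sup>+z. g z \<partial>density lborel (indicator (T ` U)))"
    by simp
  moreover have "(\<integral>\<^sup>+z. g z \<partial>distr (density lborel J) borel R) = (\<integral>\<^sup>+x. J x * g (R x) \<partial>lborel)"
    using g by (simp add: nn_integral_distr nn_integral_density measurable_compose[OF R])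
  moreover have "(\<integral>\<^sup>+z. g z \<partial>density lborel (indicator (T ` U))) = (\<integral>\<^sup>+z. indicator (T ` U) z * g z \<partial>lborel)"
    using g TU by (subst nn_integral_density) auto
  moreover have "(\<integral>\<^sup>+x. J x * g (R x) \<partial>lborel) = (\<integral>\<^sup>+x. indicator U x * (ennreal \<bar>det (matrix (T' x))\<bar> * g (T x)) \<partial>lborel)"
    by (intro nn_integral_cong) (auto simp: R_def J_def indicator_def)
  ultimately show ?thesis by simp
qed

text \<open>Used to glue the Riemannian measure from finitely many pieces, each carried by one
  chart.\<close>

lemma ex_sum_measure:
  fixes N :: "'i \<Rightarrow> 'b measure"
  assumes "finite I" "\<And>i. i \<in> I \<Longrightarrow> sets (N i) = sets N0"
  shows "\<exists>\<mu>. sets \<mu> = sets N0 \<and> (\<forall>E\<in>sets N0. emeasure \<mu> E = (\<Sum>i\<in>I. emeasure (N i) E))"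
proof -
  let ?\<mu> = "measure_of (space N0) (sets N0) (\<lambda>E. \<Sum>i\<in>I. emeasure (N i) E)"
  have s: "sets ?\<mu> = sets N0" by simp
  have "emeasure ?\<mu> E = (\<Sum>i\<in>I. emeasure (N i) E)" if "E \<in> sets N0" for E
  proof (rule emeasure_measure_of[OF refl])
    show "sets N0 \<subseteq> Pow (space N0)" by (rule sets.space_closed)
    show "E \<in> sets ?\<mu>" using that s by simp
    show "positive (sets ?\<mu>) (\<lambda>E. \<Sum>i\<in>I. emeasure (N i) E)" by (simp add: positive_def)
    show "countably_additive (sets ?\<mu>) (\<lambda>E. \<Sum>i\<in>I. emeasure (N i) E)"
      unfolding s
    proof (rule countably_additiveI)
      fix F :: "nat \<Rightarrow> 'b set" assume F: "range F \<subseteq> sets N0" "disjoint_family F" "\<Union> (range F) \<in> sets N0"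
      have "(\<Sum>n. \<Sum>i\<in>I. emeasure (N i) (F n)) = (\<Sum>i\<in>I. \<Sum>n. emeasure (N i) (F n))"
        by (rule suminf_sum) simp
      also have "\<dots> = (\<Sum>i\<in>I. emeasure (N i) (\<Union> (range F)))"
        by (intro sum.cong refl suminf_emeasure) (use F assms in auto)
      finally show "(\<Sum>n. \<Sum>i\<in>I. emeasure (N i) (F n)) = (\<Sum>i\<in>I. emeasure (N i) (\<Union> (range F)))" .
    qed
  qed
  with s show ?thesis by blast
qed

section \<open>Charts of an immersed closed manifold and their transition maps\<close>

locale immersed_manifold =
  fixes M :: "'m::t2_space set" and \<A> :: "('k::finite, 'm) atlas" and f :: "'m \<Rightarrow> 'a::euclidean_space"
  assumes manifold: "closed_manifold M \<A>" and immersion: "immersion_into_sphere M \<A> f"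
begin

lemma compact_M: "compact M" and M_nonempty: "M \<noteq> {}"
  using manifold by (auto simp: closed_manifold_def)

lemma M_borel [measurable]: "M \<in> sets borel"
  using compact_M by (simp add: compact_imp_closed)

lemma M_charts: "M = (\<Union>(V, \<psi>)\<in>\<A>. \<psi> ` V)"
  using manifold by (auto simp: closed_manifold_def smooth_atlas_def)

lemma f_unit: "x \<in> M \<Longrightarrow> norm (f x) = 1"
  using immersion by (auto simp: immersion_into_sphere_def)

lemma chart_homeomorphism:
  assumes "(V, \<psi>) \<in> \<A>"
  shows "homeomorphism V (\<psi> ` V) \<psi> (inv_into V \<psi>)"
proof -
  obtain \<phi> where h: "homeomorphism V (\<psi> ` V) \<psi> \<phi>"
    using bspec[OF conjunct1[OF manifold[unfolded closed_manifold_def smooth_atlas_def, THEN conjunct2, THEN conjunct2]] assms]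
    by auto
  then have "inj_on \<psi> V" by (intro inj_on_inverseI[of _ \<phi>]) (rule homeomorphism_apply1)
  then have "inv_into V \<psi> x = \<phi> x" if "x \<in> \<psi> ` V" for x
  proof -
    obtain v where "v \<in> V" "x = \<psi> v" using \<open>x \<in> \<psi> ` V\<close> by auto
    then show ?thesis using \<open>inj_on \<psi> V\<close> homeomorphism_apply1[OF h] by simp
  qed
  then show ?thesis by (intro homeomorphism_cong[OF h refl refl refl]) auto
qed

lemma chart:
  assumes "(V, \<psi>) \<in> \<A>"
  shows chart_open: "open V" and chart_openin: "openin (top_of_set M) (\<psi> ` V)"
    and chart_subset: "\<psi> ` V \<subseteq> M" and chart_inj: "inj_on \<psi> V"
    and chart_continuous: "continuous_on V \<psi>"
    and chart_inv_continuous: "continuous_on (\<psi> ` V) (inv_into V \<psi>)"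
proof -
  show "open V" "openin (top_of_set M) (\<psi> ` V)"
    using manifold assms by (auto simp: closed_manifold_def smooth_atlas_def)
  then show "\<psi> ` V \<subseteq> M" using openin_imp_subset by blast
  show "inj_on \<psi> V" "continuous_on V \<psi>" "continuous_on (\<psi> ` V) (inv_into V \<psi>)"
    using chart_homeomorphism[OF assms] by (auto simp: homeomorphism_def inj_on_def) metis
qed

lemma immersed_chart:
  assumes "(V, \<psi>) \<in> \<A>"
  shows "immersed_chart V (f \<circ> \<psi>)"
proof
  show "open V" by (rule chart_open[OF assms])
  show "smooth_on (f \<circ> \<psi>) V" "\<And>y. y \<in> V \<Longrightarrow> inj (frechet_derivative (f \<circ> \<psi>) (at y))"
    using immersion assms by (auto simp: immersion_into_sphere_def)
  show "norm ((f \<circ> \<psi>) y) = 1" if "y \<in> V" for y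
    using f_unit chart_subset[OF assms] that by auto
qed

lemma chart_image_borel: "(V, \<psi>) \<in> \<A> \<Longrightarrow> \<psi> ` V \<in> sets borel"
  using chart_openin[of V \<psi>] M_borel by (auto simp: openin_open)

lemma chart_vimage_borel:
  assumes c: "(V, \<psi>) \<in> \<A>" and E: "E \<in> sets borel"
  shows "V \<inter> \<psi> -` E \<in> sets borel"
proof -
  have "\<psi> \<in> borel_measurable (restrict_space borel V)"
    by (rule borel_measurable_continuous_on_restrict[OF chart_continuous[OF c]])
  from measurable_sets[OF this E] show ?thesis
    using chart_open[OF c] by (auto simp: sets_restrict_space_iff space_restrict_space Int_commute)
qed

lemma chart_image_subset_borel:
  assumes c: "(V, \<psi>) \<in> \<A>" and B: "B \<in> sets borel" "B \<subseteq> V"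
  shows "\<psi> ` B \<in> sets borel"
proof -
  have "inv_into V \<psi> \<in> borel_measurable (restrict_space borel (\<psi> ` V))"
    by (rule borel_measurable_continuous_on_restrict[OF chart_inv_continuous[OF c]])
  from measurable_sets[OF this B(1)]
  have "inv_into V \<psi> -` B \<inter> \<psi> ` V \<in> sets borel"
    using chart_image_borel[OF c] by (auto simp: sets_restrict_space_iff space_restrict_space)
  moreover have "inv_into V \<psi> -` B \<inter> \<psi> ` V = \<psi> ` B"
    using chart_inj[OF c] B(2) by (auto simp: image_iff)
  ultimately show ?thesis by simp
qed

definition transition where "transition V \<psi> W \<xi> = (inv_into W \<xi> \<circ> \<psi> :: real^'k \<Rightarrow> real^'k)"
definition overlap where "overlap V \<psi> W \<xi> = (V \<inter> \<psi> -` (\<xi> ` W) :: (real^'k) set)" for \<psi> \<xi> :: "real^'k \<Rightarrow> 'm"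

context
  fixes V W \<psi> \<xi>
  assumes c: "(V, \<psi>) \<in> \<A>" and d: "(W, \<xi>) \<in> \<A>"
begin

lemma overlap_open: "open (overlap V \<psi> W \<xi>)"
proof -
  obtain G where G: "open G" "\<xi> ` W = M \<inter> G" using chart_openin[OF d] by (auto simp: openin_open)
  then have "overlap V \<psi> W \<xi> = V \<inter> \<psi> -` G"
    using chart_subset[OF c] by (auto simp: overlap_def)
  then show ?thesis
    using continuous_on_open_vimage[OF chart_open[OF c]] chart_continuous[OF c] G(1)
    by (metis Int_commute)
qed

lemma transition_C1: "C1 (transition V \<psi> W \<xi>) (overlap V \<psi> W \<xi>)"
  using manifold c d unfolding closed_manifold_def smooth_atlas_def smooth_on_def transition_def overlap_def
  by blast

lemma transition_in: "y \<in> overlap V \<psi> W \<xi> \<Longrightarrow> transition V \<psi> W \<xi> y \<in> W"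
  and transition_eq: "y \<in> overlap V \<psi> W \<xi> \<Longrightarrow> \<xi> (transition V \<psi> W \<xi> y) = \<psi> y"
  by (auto simp: overlap_def transition_def inv_into_into f_inv_into_f)

lemma transition_inj: "inj_on (transition V \<psi> W \<xi>) (overlap V \<psi> W \<xi>)"
proof (rule inj_onI)
  fix y z assume a: "y \<in> overlap V \<psi> W \<xi>" "z \<in> overlap V \<psi> W \<xi>" "transition V \<psi> W \<xi> y = transition V \<psi> W \<xi> z"
  then have "\<psi> y = \<psi> z" using transition_eq by metis
  then show "y = z" using a chart_inj[OF c] by (auto simp: overlap_def inj_on_def)
qed

lemma transition_image:
  assumes "B \<subseteq> overlap V \<psi> W \<xi>"
  shows "transition V \<psi> W \<xi> ` B = W \<inter> \<xi> -` (\<psi> ` B)"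
proof
  show "transition V \<psi> W \<xi> ` B \<subseteq> W \<inter> \<xi> -` (\<psi> ` B)"
    using assms transition_in transition_eq by auto
  show "W \<inter> \<xi> -` (\<psi> ` B) \<subseteq> transition V \<psi> W \<xi> ` B"
  proof
    fix z assume "z \<in> W \<inter> \<xi> -` (\<psi> ` B)"
    then obtain y where y: "z \<in> W" "y \<in> B" "\<xi> z = \<psi> y" by auto
    then have "transition V \<psi> W \<xi> y = z"
      using chart_inj[OF d] by (simp add: transition_def inv_into_f_eq)
    then show "z \<in> transition V \<psi> W \<xi> ` B" using y by auto
  qed
qed

lemma transition_derivative:
  assumes y: "y \<in> overlap V \<psi> W \<xi>" and g: "C1 (g \<circ> \<xi>) W"
  shows "frechet_derivative (g \<circ> \<psi>) (at y) =
    frechet_derivative (g \<circ> \<xi>) (at (transition V \<psi> W \<xi> y)) \<circ> frechet_derivative (transition V \<psi> W \<xi>) (at y)"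
proof -
  have "((g \<circ> \<xi>) \<circ> transition V \<psi> W \<xi> has_derivative
     frechet_derivative (g \<circ> \<xi>) (at (transition V \<psi> W \<xi> y)) \<circ> frechet_derivative (transition V \<psi> W \<xi>) (at y)) (at y)"
    by (intro diff_chain_at C1_has_derivative[OF transition_C1] C1_has_derivative[OF g] transition_in y)
  then have "(g \<circ> \<psi> has_derivative
     frechet_derivative (g \<circ> \<xi>) (at (transition V \<psi> W \<xi> y)) \<circ> frechet_derivative (transition V \<psi> W \<xi>) (at y)) (at y)"
    by (rule has_derivative_transform_within_open[OF _ overlap_open y]) (simp add: transition_eq)
  then show ?thesis by (rule frechet_derivative_at[symmetric])
qed

text \<open>By the chain rule the Gram determinant picks up the square of the Jacobian of the
  transition map.\<close>

lemma density_transition: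
  assumes y: "y \<in> overlap V \<psi> W \<xi>"
  shows "chart_density (f \<circ> \<psi>) y = \<bar>det (matrix (frechet_derivative (transition V \<psi> W \<xi>) (at y)))\<bar> *
     chart_density (f \<circ> \<xi>) (transition V \<psi> W \<xi> y)"
proof -
  interpret W: immersed_chart W "f \<circ> \<xi>" by (rule immersed_chart[OF d])
  have "det (first_ff (f \<circ> \<psi>) y) = (det (matrix (frechet_derivative (transition V \<psi> W \<xi>) (at y))))\<^sup>2 *
     det (first_ff (f \<circ> \<xi>) (transition V \<psi> W \<xi> y))"
    unfolding first_ff_gram transition_derivative[OF y W.C1_F]
    by (intro det_gram_compose W.linear_D transition_in y C1_linear_derivative[OF transition_C1])
  then show ?thesis by (simp add: chart_density_def real_sqrt_mult)
qed

end

definition chart_mass :: "(real^'k) set \<Rightarrow> (real^'k \<Rightarrow> 'm) \<Rightarrow> (real^'k) set \<Rightarrow> ennreal" where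
  "chart_mass V \<psi> B = (\<integral>\<^sup>+y\<in>B. ennreal (chart_density (f \<circ> \<psi>) y) \<partial>lborel)"

lemma density_measurable:
  assumes c: "(V, \<psi>) \<in> \<A>" and B: "B \<in> sets borel" "B \<subseteq> V"
  shows "(\<lambda>y. indicator B y * chart_density (f \<circ> \<psi>) y) \<in> borel_measurable borel"
proof -
  interpret immersed_chart V "f \<circ> \<psi>" by (rule immersed_chart[OF c])
  have "(\<lambda>y. indicator B y *\<^sub>R chart_density (f \<circ> \<psi>) y) \<in> borel_measurable borel"
    by (rule borel_measurable_continuous_on_indicator[OF B(1) continuous_on_subset[OF C1_continuous_on[OF C1_density] B(2)]])
  then show ?thesis by simp
qed

text \<open>Two charts assign the same mass to a common part of their images, so the prescriptions
  that define the Riemannian measure are consistent.\<close>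

lemma chart_mass_transition:
  assumes c: "(V, \<psi>) \<in> \<A>" and d: "(W, \<xi>) \<in> \<A>"
    and B: "B \<in> sets borel" "B \<subseteq> V" "\<psi> ` B \<subseteq> \<xi> ` W"
  shows "chart_mass V \<psi> B = chart_mass W \<xi> (W \<inter> \<xi> -` (\<psi> ` B))"
proof -
  let ?T = "transition V \<psi> W \<xi>" and ?U = "overlap V \<psi> W \<xi>"
  let ?T' = "\<lambda>y. frechet_derivative ?T (at y)"
  \<comment> \<open>The indicator makes the integrand Borel on the whole space; the density is
    controlled on \<open>W\<close> only.\<close>
  let ?g = "\<lambda>z. ennreal (indicator W z * chart_density (f \<circ> \<xi>) z)"
  have BU: "B \<subseteq> ?U" using B by (auto simp: overlap_def)
  have im: "?T ` B = W \<inter> \<xi> -` (\<psi> ` B)" by (rule transition_image[OF c d BU])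
  have nn: "0 \<le> chart_density (f \<circ> \<xi>) z" if "z \<in> W" for z
    using immersed_chart.density_pos[OF immersed_chart[OF d] that] by simp
  have "chart_mass V \<psi> B = (\<integral>\<^sup>+x. indicator B x * (ennreal \<bar>det (matrix (?T' x))\<bar> * ?g (?T x)) \<partial>lborel)"
    unfolding chart_mass_def
  proof (intro nn_integral_cong)
    fix y
    show "ennreal (chart_density (f \<circ> \<psi>) y) * indicator B y = indicator B y * (ennreal \<bar>det (matrix (?T' y))\<bar> * ?g (?T y))"
    proof (cases "y \<in> B")
      case True
      then have y: "y \<in> ?U" using BU by auto
      show ?thesis using True transition_in[OF c d y] nn[OF transition_in[OF c d y]]
        by (simp add: density_transition[OF c d y] ennreal_mult)
    qed auto
  qed
  also have "\<dots> = (\<integral>\<^sup>+z. indicator (?T ` B) z * ?g z \<partial>lborel)"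
  proof (rule nn_integral_change_of_variables[OF B(1)])
    show "?T ` B \<in> sets borel" unfolding im
      by (rule chart_vimage_borel[OF d chart_image_subset_borel[OF c B(1,2)]])
    show "(?T has_derivative ?T' x) (at x)" if "x \<in> B" for x
      using that BU by (intro C1_has_derivative[OF transition_C1[OF c d]]) auto
    show "inj_on ?T B" by (rule inj_on_subset[OF transition_inj[OF c d] BU])
    have "continuous_on ?U (\<lambda>y. det (matrix (?T' y)))"
      unfolding det_def matrix_def
      by (simp, intro continuous_intros C1_continuous_derivative[OF transition_C1[OF c d]])
    then have "continuous_on B (\<lambda>y. \<bar>det (matrix (?T' y))\<bar>)"
      using BU continuous_on_subset by (intro continuous_intros) blast
    from borel_measurable_continuous_on_indicator[OF B(1) this]
    show "(\<lambda>x. indicator B x * \<bar>det (matrix (?T' x))\<bar>) \<in> borel_measurable borel" by simp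
    show "?g \<in> borel_measurable borel"
      using density_measurable[OF d borel_open[OF chart_open[OF d]]] by simp
  qed
  also have "\<dots> = chart_mass W \<xi> (?T ` B)"
    unfolding chart_mass_def im by (intro nn_integral_cong) (auto simp: indicator_def)
  finally show ?thesis by (simp add: im)
qed

end

context immersed_manifold
begin

lemma chart_image_openin:
  assumes c: "(V, \<psi>) \<in> \<A>" and U: "open U" "U \<subseteq> V"
  shows "openin (top_of_set M) (\<psi> ` U)"
proof -
  have "openin (top_of_set (\<psi> ` V)) (\<psi> ` U)"
    using U chart_open[OF c]
    by (intro homeomorphism_imp_open_map[OF chart_homeomorphism[OF c]]) (simp add: openin_open_eq)
  then show ?thesis using chart_openin[OF c] by (rule openin_trans)
qed

text \<open>Compactness applied to open balls whose closed balls still lie in a chart. The closed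
  balls later supply bounded densities and compact supports.\<close>

lemma finite_ball_cover:
  obtains I :: "((real^'k) set \<times> (real^'k \<Rightarrow> 'm) \<times> (real^'k) \<times> real) set"
  where "finite I" "\<And>V \<psi> y r. (V, \<psi>, y, r) \<in> I \<Longrightarrow> (V, \<psi>) \<in> \<A> \<and> 0 < r \<and> cball y r \<subseteq> V"
    "M = (\<Union>(V, \<psi>, y, r)\<in>I. \<psi> ` ball y r)"
proof -
  let ?K = "{(V, \<psi>, y, r). (V, \<psi>) \<in> \<A> \<and> 0 < r \<and> cball y r \<subseteq> V}"
  let ?g = "\<lambda>(V, \<psi>, y, r). \<psi> ` ball y r"
  have 1: "openin (top_of_set M) G" if "G \<in> ?g ` ?K" for G
    using that by (auto intro!: chart_image_openin)
  have 2: "M \<subseteq> \<Union> (?g ` ?K)"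
  proof
    fix x assume "x \<in> M"
    then obtain V \<psi> y where c: "(V, \<psi>) \<in> \<A>" "y \<in> V" "x = \<psi> y" using M_charts by auto
    then obtain r where r: "0 < r" "cball y r \<subseteq> V" using chart_open[OF c(1)] open_contains_cball by blast
    have "(V, \<psi>, y, r) \<in> ?K" using c r by auto
    moreover have "x \<in> ?g (V, \<psi>, y, r)" using c r by auto
    ultimately show "x \<in> \<Union> (?g ` ?K)" by blast
  qed
  have "\<exists>\<D>\<subseteq>?g ` ?K. finite \<D> \<and> M \<subseteq> \<Union> \<D>"
    by (rule mp[OF spec[OF compact_M[unfolded compact_eq_openin_cover]]], intro conjI ballI, erule 1, rule 2)
  then obtain \<D> where D: "\<D> \<subseteq> ?g ` ?K" "finite \<D>" "M \<subseteq> \<Union> \<D>" by (elim exE conjE)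
  obtain I where I: "I \<subseteq> ?K" "finite I" "\<D> = ?g ` I" using finite_subset_image[OF D(2,1)] by (elim exE conjE)
  have "?g i \<subseteq> M" if i: "i \<in> I" for i
    by (rule openin_imp_subset, rule 1, rule imageI, rule subsetD[OF I(1) i])
  then have "(\<Union>i\<in>I. ?g i) \<subseteq> M" by (rule UN_least)
  then have "M = (\<Union>i\<in>I. ?g i)" using D(3) unfolding I(3) by (rule subset_antisym[rotated])
  moreover have "(V, \<psi>) \<in> \<A> \<and> 0 < r \<and> cball y r \<subseteq> V" if "(V, \<psi>, y, r) \<in> I" for V \<psi> y r
    using subsetD[OF I(1) that] by simp
  ultimately show thesis using that[OF I(2)] by metis
qed

text \<open>Each chart image in a finite cover loses the points already covered. The pieces are
  Borel and each lies in one chart, which is what additivity needs.\<close>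

lemma finite_disjoint_cover:
  obtains n :: nat and Vs :: "nat \<Rightarrow> (real^'k) set" and ps and D
  where "\<And>i. i < n \<Longrightarrow> (Vs i, ps i) \<in> \<A>" "\<And>i. i < n \<Longrightarrow> D i \<subseteq> ps i ` Vs i"
    "\<And>i. i < n \<Longrightarrow> D i \<in> sets borel" "disjoint_family_on D {..<n}" "M = (\<Union>i<n. D i)"
proof (rule finite_ball_cover)
  fix I :: "((real^'k) set \<times> (real^'k \<Rightarrow> 'm) \<times> (real^'k) \<times> real) set"
  assume I: "finite I" "\<And>V \<psi> y r. (V, \<psi>, y, r) \<in> I \<Longrightarrow> (V, \<psi>) \<in> \<A> \<and> 0 < r \<and> cball y r \<subseteq> V"
    "M = (\<Union>(V, \<psi>, y, r)\<in>I. \<psi> ` ball y r)"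
  obtain xs where xs: "set xs = I" using finite_list[OF I(1)] by blast
  define n where "n = length xs"
  define Vs where "Vs = (\<lambda>i. fst (xs ! i))"
  define ps where "ps = (\<lambda>i. fst (snd (xs ! i)))"
  \<comment> \<open>The sequence is continued by empty sets because \<open>disjointed\<close> works
    on sequences indexed by all natural numbers.\<close>
  define E where "E = (\<lambda>i. if i < n then ps i ` Vs i else {})"
  have c: "(Vs i, ps i) \<in> \<A>" if "i < n" for i
  proof -
    have "xs ! i \<in> I" using that xs by (auto simp: n_def)
    then show ?thesis using I(2) by (cases "xs ! i") (auto simp: Vs_def ps_def)
  qed
  have Eb: "E i \<in> sets borel" for i using chart_image_borel[OF c] by (auto simp: E_def)
  have "M = (\<Union>i. E i)"
  proof
    show "(\<Union>i. E i) \<subseteq> M" using chart_subset[OF c] by (auto simp: E_def split: if_splits)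
    show "M \<subseteq> (\<Union>i. E i)"
    proof
      fix x assume "x \<in> M"
      then obtain V \<psi> y r where v: "(V, \<psi>, y, r) \<in> I" "x \<in> \<psi> ` ball y r" using I(3) by auto
      then obtain i where i: "i < n" "xs ! i = (V, \<psi>, y, r)" using xs by (auto simp: in_set_conv_nth n_def)
      have "ball y r \<subseteq> V" using I(2)[OF v(1)] ball_subset_cball[of y r] by blast
      then have "x \<in> E i" using v(2) i by (auto simp: E_def Vs_def ps_def)
      then show "x \<in> (\<Union>i. E i)" by blast
    qed
  qed
  also have "\<dots> = (\<Union>i. disjointed E i)" by (simp add: UN_disjointed_eq)
  also have "\<dots> = (\<Union>i<n. disjointed E i)"
  proof -
    have "i < n" if "x \<in> disjointed E i" for x i
      using that disjointed_subset[of E i] by (auto simp: E_def split: if_splits)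
    then show ?thesis by (intro equalityI UN_mono subset_UNIV subset_refl UN_least subsetI UN_I) auto
  qed
  finally have M: "M = (\<Union>i<n. disjointed E i)" .
  have "disjointed E i \<in> sets borel" for i
    using sets.range_disjointed_sets[of E borel] Eb by blast
  moreover have "disjoint_family_on (disjointed E) {..<n}"
    using disjoint_family_disjointed[of E] by (auto simp: disjoint_family_on_def)
  moreover have "disjointed E i \<subseteq> ps i ` Vs i" if "i < n" for i
    using disjointed_subset[of E i] that by (simp add: E_def)
  ultimately show thesis using that[of n Vs ps "disjointed E"] c M by blast
qed

section \<open>Existence, uniqueness and finiteness of the Riemannian measure\<close>

abbreviation "M_borel_sets \<equiv> sets (restrict_space borel M)"

lemma M_borel_sets_iff: "E \<in> M_borel_sets \<longleftrightarrow> E \<in> sets borel \<and> E \<subseteq> M"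
  using M_borel by (auto simp: sets_restrict_space_iff)

text \<open>The default point makes the parametrization a total map into \<open>M\<close>. In all
  uses S is a subset of \<open>V\<close>, so the default carries no mass.\<close>

definition pushforward where
  "pushforward V \<psi> S = distr (density lborel (\<lambda>y. ennreal (indicator S y * chart_density (f \<circ> \<psi>) y)))
     (restrict_space borel M) (\<lambda>y. if y \<in> V then \<psi> y else (SOME x. x \<in> M))"

lemma chart_measurable:
  assumes c: "(V, \<psi>) \<in> \<A>"
  shows "(\<lambda>y. if y \<in> V then \<psi> y else (SOME x. x \<in> M)) \<in> borel \<rightarrow>\<^sub>M restrict_space borel M"
proof (rule measurable_restrict_space2)
  show "(\<lambda>y. if y \<in> V then \<psi> y else (SOME x. x \<in> M)) \<in> space borel \<rightarrow> M"
    using chart_subset[OF c] some_in_eq[of M] M_nonempty by (auto simp: image_subset_iff split: if_splits)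
  show "(\<lambda>y. if y \<in> V then \<psi> y else (SOME x. x \<in> M)) \<in> borel_measurable borel"
    by (intro borel_measurable_continuous_on_if borel_open chart_open[OF c] chart_continuous[OF c] continuous_on_const)
qed

lemma chart_mass_density:
  assumes c: "(V, \<psi>) \<in> \<A>" and S: "S \<in> sets borel" "S \<subseteq> V" and B: "B \<in> sets borel"
  shows "emeasure (density lborel (\<lambda>y. ennreal (indicator S y * chart_density (f \<circ> \<psi>) y))) B = chart_mass V \<psi> (S \<inter> B)"
proof -
  have "emeasure (density lborel (\<lambda>y. ennreal (indicator S y * chart_density (f \<circ> \<psi>) y))) B =
      (\<integral>\<^sup>+y. ennreal (indicator S y * chart_density (f \<circ> \<psi>) y) * indicator B y \<partial>lborel)"
    by (rule emeasure_density) (use density_measurable[OF c S] B in simp_all)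
  also have "\<dots> = chart_mass V \<psi> (S \<inter> B)"
    unfolding chart_mass_def by (intro nn_integral_cong) (auto simp: indicator_def)
  finally show ?thesis .
qed

lemma emeasure_pushforward:
  assumes c: "(V, \<psi>) \<in> \<A>" and S: "S \<in> sets borel" "S \<subseteq> V" and E: "E \<in> M_borel_sets"
  shows "emeasure (pushforward V \<psi> S) E = chart_mass V \<psi> (S \<inter> \<psi> -` E)"
proof -
  let ?h = "\<lambda>y. if y \<in> V then \<psi> y else (SOME x. x \<in> M)"
  have "?h -` E \<in> sets borel" using measurable_sets[OF chart_measurable[OF c] E] by simp
  moreover have "S \<inter> ?h -` E = S \<inter> \<psi> -` E" using S by auto
  moreover have "?h \<in> density lborel (\<lambda>y. ennreal (indicator S y * chart_density (f \<circ> \<psi>) y)) \<rightarrow>\<^sub>M restrict_space borel M"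
    using chart_measurable[OF c] by simp
  ultimately show ?thesis
    unfolding pushforward_def using E by (simp add: emeasure_distr chart_mass_density[OF c S])
qed

definition is_riemannian_measure :: "'m measure \<Rightarrow> bool" where
  "is_riemannian_measure \<mu> \<longleftrightarrow> sets \<mu> = M_borel_sets \<and>
     (\<forall>(V, \<psi>)\<in>\<A>. \<forall>B\<in>sets borel. B \<subseteq> V \<longrightarrow> emeasure \<mu> (\<psi> ` B) = chart_mass V \<psi> B)"

text \<open>Sum the pushforwards over the disjoint pieces. For a set in any other chart, cut it
  along the pieces and compare each part by \<open>chart_mass_transition\<close>.\<close>

lemma ex_riemannian_measure: "\<exists>\<mu>. is_riemannian_measure \<mu>"
proof (rule finite_disjoint_cover)
  fix n :: nat and Vs :: "nat \<Rightarrow> (real^'k) set" and ps D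
  assume c: "\<And>i. i < n \<Longrightarrow> (Vs i, ps i) \<in> \<A>" and Dsub: "\<And>i. i < n \<Longrightarrow> D i \<subseteq> ps i ` Vs i"
    and Db: "\<And>i. i < n \<Longrightarrow> D i \<in> sets borel" and disj: "disjoint_family_on D {..<n}" and M: "M = (\<Union>i<n. D i)"
  let ?S = "\<lambda>i. Vs i \<inter> ps i -` D i"
  have S: "?S i \<in> sets borel" "?S i \<subseteq> Vs i" if "i < n" for i
    using chart_vimage_borel[OF c[OF that] Db[OF that]] by auto
  obtain \<mu> where \<mu>: "sets \<mu> = M_borel_sets" "\<And>E. E \<in> M_borel_sets \<Longrightarrow> emeasure \<mu> E = (\<Sum>i<n. emeasure (pushforward (Vs i) (ps i) (?S i)) E)"
    using ex_sum_measure[of "{..<n}" "\<lambda>i. pushforward (Vs i) (ps i) (?S i)" "restrict_space borel M"]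
    by (auto simp: pushforward_def)
  have "emeasure \<mu> (\<psi> ` B) = chart_mass V \<psi> B" if v: "(V, \<psi>) \<in> \<A>" and B: "B \<in> sets borel" "B \<subseteq> V" for V \<psi> B
  proof -
    let ?N = "density lborel (\<lambda>y. ennreal (indicator V y * chart_density (f \<circ> \<psi>) y))"
    note N = chart_mass_density[OF v borel_open[OF chart_open[OF v]] order_refl]
    have im: "\<psi> ` B \<in> M_borel_sets"
      using chart_image_subset_borel[OF v B] chart_subset[OF v] B by (auto simp: M_borel_sets_iff)
    let ?B = "\<lambda>i. B \<inter> \<psi> -` D i"
    have Bb: "?B i \<in> sets borel" if "i < n" for i
    proof -
      have "?B i = B \<inter> (V \<inter> \<psi> -` D i)" using B by auto
      then show ?thesis using chart_vimage_borel[OF v Db[OF that]] B by simp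
    qed
    have "emeasure \<mu> (\<psi> ` B) = (\<Sum>i<n. emeasure (pushforward (Vs i) (ps i) (?S i)) (\<psi> ` B))"
      by (rule \<mu>(2)[OF im])
    also have "\<dots> = (\<Sum>i<n. chart_mass V \<psi> (?B i))"
    proof (rule sum.cong[OF refl])
      fix i assume "i \<in> {..<n}"
      then have i: "i < n" by simp
      have "emeasure (pushforward (Vs i) (ps i) (?S i)) (\<psi> ` B) = chart_mass (Vs i) (ps i) (?S i \<inter> ps i -` (\<psi> ` B))"
        by (rule emeasure_pushforward[OF c[OF i] S[OF i] im])
      also have "?S i \<inter> ps i -` (\<psi> ` B) = Vs i \<inter> ps i -` (\<psi> ` ?B i)" by auto
      also have "chart_mass (Vs i) (ps i) \<dots> = chart_mass V \<psi> (?B i)"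
        by (rule chart_mass_transition[OF v c[OF i] Bb[OF i], symmetric]) (use B Dsub[OF i] in auto)
      finally show "emeasure (pushforward (Vs i) (ps i) (?S i)) (\<psi> ` B) = chart_mass V \<psi> (?B i)" .
    qed
    also have "\<dots> = (\<Sum>i<n. emeasure ?N (?B i))"
    proof (rule sum.cong[OF refl])
      fix i assume "i \<in> {..<n}"
      moreover have "V \<inter> ?B i = ?B i" using B by auto
      ultimately show "chart_mass V \<psi> (?B i) = emeasure ?N (?B i)" using N[OF Bb] by simp
    qed
    also have "\<dots> = emeasure ?N (\<Union>i<n. ?B i)"
    proof (rule sum_emeasure)
      show "?B ` {..<n} \<subseteq> sets ?N" using Bb by auto
      show "disjoint_family_on ?B {..<n}" using disj by (auto simp: disjoint_family_on_def)
    qed simp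
    also have "(\<Union>i<n. ?B i) = B"
    proof -
      have "\<psi> y \<in> (\<Union>i<n. D i)" if "y \<in> B" for y using that M chart_subset[OF v] B by auto
      then show ?thesis by auto
    qed
    also have "emeasure ?N B = chart_mass V \<psi> B"
      using N[OF B(1)] B(2) by (simp add: Int_absorb1)
    finally show ?thesis .
  qed
  then show ?thesis using \<mu>(1) by (auto simp: is_riemannian_measure_def)
qed

text \<open>Every Borel set is a finite disjoint union of sets that lie in one chart each, and on
  those the defining property prescribes the measure.\<close>

lemma riemannian_measure_unique:
  assumes "is_riemannian_measure \<mu>" "is_riemannian_measure \<nu>"
  shows "\<mu> = \<nu>"
proof (rule finite_disjoint_cover)
  fix n :: nat and Vs :: "nat \<Rightarrow> (real^'k) set" and ps D
  assume c: "\<And>i. i < n \<Longrightarrow> (Vs i, ps i) \<in> \<A>" and Dsub: "\<And>i. i < n \<Longrightarrow> D i \<subseteq> ps i ` Vs i"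
    and Db: "\<And>i. i < n \<Longrightarrow> D i \<in> sets borel" and disj: "disjoint_family_on D {..<n}" and M: "M = (\<Union>i<n. D i)"
  have e: "emeasure \<rho> E = (\<Sum>i<n. chart_mass (Vs i) (ps i) (Vs i \<inter> ps i -` (E \<inter> D i)))"
    if \<rho>: "is_riemannian_measure \<rho>" and E: "E \<in> M_borel_sets" for \<rho> E
  proof -
    have Eb: "E \<in> sets borel" "E \<subseteq> M" using E by (auto simp: M_borel_sets_iff)
    have "E = (\<Union>i<n. E \<inter> D i)" using Eb(2) M by auto
    then have "emeasure \<rho> E = emeasure \<rho> (\<Union>i<n. E \<inter> D i)" by simp
    also have "\<dots> = (\<Sum>i<n. emeasure \<rho> (E \<inter> D i))"
    proof (rule sum_emeasure[symmetric])
      show "(\<lambda>i. E \<inter> D i) ` {..<n} \<subseteq> sets \<rho>"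
        using \<rho> Eb Db by (auto simp: is_riemannian_measure_def M_borel_sets_iff)
      show "disjoint_family_on (\<lambda>i. E \<inter> D i) {..<n}" using disj by (auto simp: disjoint_family_on_def)
    qed simp
    also have "\<dots> = (\<Sum>i<n. chart_mass (Vs i) (ps i) (Vs i \<inter> ps i -` (E \<inter> D i)))"
    proof (rule sum.cong[OF refl])
      fix i assume "i \<in> {..<n}"
      then have i: "i < n" by simp
      let ?B = "Vs i \<inter> ps i -` (E \<inter> D i)"
      have "?B \<in> sets borel" by (rule chart_vimage_borel[OF c[OF i]]) (use Eb Db[OF i] in auto)
      then have "emeasure \<rho> (ps i ` ?B) = chart_mass (Vs i) (ps i) ?B"
        using \<rho> c[OF i] unfolding is_riemannian_measure_def by blast
      moreover have "ps i ` ?B = E \<inter> D i" using Dsub[OF i] by auto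
      ultimately show "emeasure \<rho> (E \<inter> D i) = chart_mass (Vs i) (ps i) ?B" by simp
    qed
    finally show ?thesis .
  qed
  show ?thesis
  proof (rule measure_eqI)
    show "sets \<mu> = sets \<nu>" using assms by (simp add: is_riemannian_measure_def)
    show "emeasure \<mu> E = emeasure \<nu> E" if "E \<in> sets \<mu>" for E
      using that e assms by (simp add: is_riemannian_measure_def)
  qed
qed

abbreviation vol :: "'m measure" where "vol \<equiv> riemannian_measure M \<A> f"

lemma is_riemannian_measure_vol: "is_riemannian_measure vol"
proof -
  have "vol = (THE \<mu>. is_riemannian_measure \<mu>)"
    unfolding riemannian_measure_def is_riemannian_measure_def chart_mass_def chart_density_def ..
  moreover have "is_riemannian_measure (THE \<mu>. is_riemannian_measure \<mu>)"
    using ex_riemannian_measure riemannian_measure_unique by (metis theI)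
  ultimately show ?thesis by simp
qed

lemma sets_vol: "sets vol = M_borel_sets"
  using is_riemannian_measure_vol by (simp add: is_riemannian_measure_def)

lemma space_vol [simp]: "space vol = M"
  using sets_eq_imp_space_eq[OF sets_vol] by (simp add: space_restrict_space)

lemma vol_chart: "(V, \<psi>) \<in> \<A> \<Longrightarrow> B \<in> sets borel \<Longrightarrow> B \<subseteq> V \<Longrightarrow> emeasure vol (\<psi> ` B) = chart_mass V \<psi> B"
  using is_riemannian_measure_vol unfolding is_riemannian_measure_def by blast

lemma measurable_vol_cong: "borel_measurable vol = borel_measurable (restrict_space borel M)"
  by (rule measurable_cong_sets[OF sets_vol refl])

text \<open>Finitely many coordinate balls cover \<open>M\<close>, and the density is bounded on
  each because it is continuous on the closed ball.\<close>

lemma emeasure_vol_finite: "emeasure vol M < \<infinity>"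
proof (rule finite_ball_cover)
  fix I :: "((real^'k) set \<times> (real^'k \<Rightarrow> 'm) \<times> (real^'k) \<times> real) set"
  assume I: "finite I" "\<And>V \<psi> y r. (V, \<psi>, y, r) \<in> I \<Longrightarrow> (V, \<psi>) \<in> \<A> \<and> 0 < r \<and> cball y r \<subseteq> V"
    "M = (\<Union>(V, \<psi>, y, r)\<in>I. \<psi> ` ball y r)"
  let ?g = "\<lambda>(V, \<psi>, y, r). \<psi> ` ball y r"
  have a: "?g i \<in> sets vol \<and> emeasure vol (?g i) < \<infinity>" if i: "i \<in> I" for i
  proof -
    obtain V \<psi> y r where e: "i = (V, \<psi>, y, r)" by (cases i)
    note c = I(2)[OF i[unfolded e]]
    interpret immersed_chart V "f \<circ> \<psi>" by (rule immersed_chart) (use c in blast)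
    have sub: "ball y r \<subseteq> V" using c ball_subset_cball by blast
    have s: "\<psi> ` ball y r \<in> sets vol"
      unfolding sets_vol M_borel_sets_iff
      using chart_image_subset_borel[of V \<psi> "ball y r"] chart_subset[of V \<psi>] c sub by auto
    have "continuous_on (cball y r) (chart_density (f \<circ> \<psi>))"
      using continuous_on_subset[OF C1_continuous_on[OF C1_density]] c by blast
    then have "bdd_above (chart_density (f \<circ> \<psi>) ` cball y r)"
      by (intro bounded_imp_bdd_above compact_imp_bounded compact_continuous_image compact_cball)
    then obtain K where K: "\<And>z. z \<in> cball y r \<Longrightarrow> chart_density (f \<circ> \<psi>) z \<le> K"
      unfolding bdd_above_def by blast
    have "emeasure vol (\<psi> ` ball y r) = (\<integral>\<^sup>+z\<in>ball y r. ennreal (chart_density (f \<circ> \<psi>) z) \<partial>lborel)"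
      using vol_chart[of V \<psi> "ball y r"] c sub by (simp add: chart_mass_def)
    also have "\<dots> \<le> (\<integral>\<^sup>+z. ennreal K * indicator (ball y r) z \<partial>lborel)"
      by (intro nn_integral_mono) (use K in \<open>auto simp: indicator_def intro!: ennreal_leI\<close>)
    also have "\<dots> = ennreal K * emeasure lborel (ball y r)"
      by (rule nn_integral_cmult_indicator) simp
    also have "\<dots> < \<infinity>" using emeasure_lborel_ball_finite[of y r] by (simp add: ennreal_mult_less_top)
    finally show ?thesis using s by (simp add: e)
  qed
  have "emeasure vol M = emeasure vol (\<Union>i\<in>I. ?g i)" using I(3) by simp
  also have "\<dots> \<le> (\<Sum>i\<in>I. emeasure vol (?g i))"
    by (rule emeasure_subadditive_finite[OF I(1)]) (use a in blast)
  also have "\<dots> < \<infinity>" using a by (simp add: I(1))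
  finally show ?thesis .
qed

sublocale vol: finite_measure vol
  by standard (use emeasure_vol_finite in auto)

text \<open>Restricted to a chart image, the Riemannian measure is the pushforward from the model
  space.\<close>

lemma chart_integral:
  fixes h :: "'m \<Rightarrow> real"
  assumes c: "(V, \<psi>) \<in> \<A>" and h: "h \<in> borel_measurable vol"
    and supp: "\<And>x. x \<in> M \<Longrightarrow> x \<notin> \<psi> ` V \<Longrightarrow> h x = 0"
  shows "(\<integral>x. h x \<partial>vol) = (\<integral>y. indicator V y * (chart_density (f \<circ> \<psi>) y * h (\<psi> y)) \<partial>lborel)"
proof -
  have Vb: "V \<in> sets borel" using chart_open[OF c] by simp
  have im: "\<psi> ` V \<in> sets vol"
    unfolding sets_vol M_borel_sets_iff using chart_image_borel[OF c] chart_subset[OF c] by simp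
  let ?dens = "\<lambda>y. indicator V y * chart_density (f \<circ> \<psi>) y"
  let ?h = "\<lambda>y. if y \<in> V then \<psi> y else (SOME x. x \<in> M)"
  have "density vol (indicator (\<psi> ` V)) = pushforward V \<psi> V"
  proof (rule measure_eqI)
    show "sets (density vol (indicator (\<psi> ` V))) = sets (pushforward V \<psi> V)"
      by (simp add: pushforward_def sets_vol)
    fix E assume "E \<in> sets (density vol (indicator (\<psi> ` V)))"
    then have E: "E \<in> M_borel_sets" by (simp add: sets_vol)
    have "emeasure (density vol (indicator (\<psi> ` V))) E = emeasure vol (\<psi> ` V \<inter> E)"
      using im E sets_vol by (subst emeasure_density) (auto simp: indicator_inter_arith[symmetric])
    also have "\<psi> ` V \<inter> E = \<psi> ` (V \<inter> \<psi> -` E)" by auto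
    also have "emeasure vol \<dots> = chart_mass V \<psi> (V \<inter> \<psi> -` E)"
      by (rule vol_chart[OF c chart_vimage_borel[OF c]]) (use E M_borel_sets_iff in auto)
    also have "\<dots> = emeasure (pushforward V \<psi> V) E"
      by (rule emeasure_pushforward[OF c Vb order_refl E, symmetric])
    finally show "emeasure (density vol (indicator (\<psi> ` V))) E = emeasure (pushforward V \<psi> V) E" .
  qed
  then have d: "density vol (\<lambda>x. ennreal (indicator (\<psi> ` V) x)) = pushforward V \<psi> V"
    by (simp add: ennreal_indicator)
  have hm: "h \<in> borel_measurable (restrict_space borel M)" using h by (simp add: measurable_vol_cong)
  have hh: "?h \<in> density lborel (\<lambda>y. ennreal (?dens y)) \<rightarrow>\<^sub>M restrict_space borel M"
    using chart_measurable[OF c] by simp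
  have "(\<integral>x. h x \<partial>vol) = (\<integral>x. indicator (\<psi> ` V) x *\<^sub>R h x \<partial>vol)"
    by (rule Bochner_Integration.integral_cong) (use supp in \<open>auto simp: indicator_def\<close>)
  also have "\<dots> = (\<integral>x. h x \<partial>density vol (\<lambda>x. ennreal (indicator (\<psi> ` V) x)))"
    by (rule integral_density[symmetric]) (use im h in auto)
  also have "\<dots> = (\<integral>y. h (?h y) \<partial>density lborel (\<lambda>y. ennreal (?dens y)))"
    unfolding d pushforward_def by (rule integral_distr[OF hh hm])
  also have "\<dots> = (\<integral>y. ?dens y *\<^sub>R h (?h y) \<partial>lborel)"
  proof (rule integral_density)
    show "(\<lambda>y. h (?h y)) \<in> borel_measurable lborel"
      using measurable_compose[OF chart_measurable[OF c] hm] by simp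
    show "?dens \<in> borel_measurable lborel" using density_measurable[OF c Vb order_refl] by simp
    show "AE y in lborel. 0 \<le> ?dens y"
      using immersed_chart.density_pos[OF immersed_chart[OF c]] by (auto simp: indicator_def less_imp_le)
  qed
  also have "\<dots> = (\<integral>y. indicator V y * (chart_density (f \<circ> \<psi>) y * h (\<psi> y)) \<partial>lborel)"
    by (rule Bochner_Integration.integral_cong) (auto simp: indicator_def)
  finally show ?thesis .
qed

end

section \<open>Integration by parts\<close>

lemma C1_zero_outside:
  assumes "closed K" "\<And>x. x \<notin> K \<Longrightarrow> b x = 0" "x \<notin> K"
  shows "frechet_derivative b (at x) = (\<lambda>v. 0)"
proof -
  have "(b has_derivative (\<lambda>v. 0)) (at x)"
  proof (rule has_derivative_transform_within_open[OF has_derivative_const[of 0]])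
    show "open (- K)" using assms by auto
  qed (use assms in auto)
  then show ?thesis by (rule frechet_derivative_at[symmetric])
qed

lemma lborel_integral_translate:
  fixes b :: "'b::euclidean_space \<Rightarrow> real"
  assumes "b \<in> borel_measurable borel"
  shows "(\<integral>x. b (c + x) \<partial>lborel) = (\<integral>x. b x \<partial>lborel)"
proof -
  have "(\<integral>x. b x \<partial>lborel) = (\<integral>x. b x \<partial>distr lborel borel ((+) c))"
    by (simp add: lborel_distr_plus)
  also have "\<dots> = (\<integral>x. b (c + x) \<partial>lborel)"
    by (rule integral_distr) (use assms in auto)
  finally show ?thesis by simp
qed

lemma integrable_continuous_compact_support:
  fixes b :: "'b::euclidean_space \<Rightarrow> real"
  assumes b: "continuous_on UNIV b" and K: "compact K" and z: "\<And>x. x \<notin> K \<Longrightarrow> b x = 0"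
  shows "integrable lborel b"
proof -
  have "integrable lborel (\<lambda>x. indicator K x *\<^sub>R b x)"
    using borel_integrable_compact[OF K continuous_on_subset[OF b subset_UNIV]]
    by (simp add: set_integrable_def)
  also have "(\<lambda>x. indicator K x *\<^sub>R b x) = b" using z by (auto simp: indicator_def fun_eq_iff)
  finally show ?thesis .
qed

text \<open>Every difference quotient has integral zero by translation invariance; dominated
  convergence passes this on to the derivative.\<close>

lemma integral_directional_derivative:
  fixes b :: "'b::euclidean_space \<Rightarrow> real"
  assumes b: "C1 b UNIV" and K: "compact K" and z: "\<And>x. x \<notin> K \<Longrightarrow> b x = 0"
  shows "integrable lborel (\<lambda>x. frechet_derivative b (at x) v)"
    and "(\<integral>x. frechet_derivative b (at x) v \<partial>lborel) = 0"
proof -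
  let ?g = "\<lambda>x. frechet_derivative b (at x) v"
  have gc: "continuous_on UNIV ?g" by (rule C1_continuous_derivative[OF b])
  have gz: "?g x = 0" if "x \<notin> K" for x
    using fun_cong[OF C1_zero_outside[OF compact_imp_closed[OF K] z that]] by simp
  show "integrable lborel ?g" by (rule integrable_continuous_compact_support[OF gc K gz])
  have bi: "integrable lborel b" by (rule integrable_continuous_compact_support[OF C1_continuous_on[OF b] K z])
  have bm: "b \<in> borel_measurable borel"
    by (rule borel_measurable_continuous_onI[OF C1_continuous_on[OF b]])
  have "bounded (?g ` K)"
    by (intro compact_imp_bounded compact_continuous_image continuous_on_subset[OF gc] K) auto
  then obtain B where B: "B > 0" "\<And>x. x \<in> K \<Longrightarrow> norm (?g x) \<le> B"
    unfolding bounded_pos by auto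
  have gB: "norm (?g x) \<le> B" for x using B gz[of x] by (cases "x \<in> K") auto
  obtain R where R: "R > 0" "\<And>x. x \<in> K \<Longrightarrow> norm x \<le> R"
    using compact_imp_bounded[OF K] unfolding bounded_pos by auto
  define q where "q = (\<lambda>n x. (b (inverse (Suc n) *\<^sub>R v + x) - b x) / inverse (real (Suc n)))"
  have q: "\<exists>s. 0 < s \<and> s < inverse (real (Suc n)) \<and> q n x = ?g (x + s *\<^sub>R v)" for n x
  proof -
    have "\<exists>s. 0 < s \<and> s < inverse (real (Suc n)) \<and> b (x + inverse (real (Suc n)) *\<^sub>R v) - b x = inverse (real (Suc n)) * ?g (x + s *\<^sub>R v)"
      by (rule mvt_line[where f' = "\<lambda>x. frechet_derivative b (at x)"]) (auto intro: C1_has_derivative[OF b])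
    then obtain s where s: "0 < s" "s < inverse (real (Suc n))" "b (x + inverse (real (Suc n)) *\<^sub>R v) - b x = inverse (real (Suc n)) * ?g (x + s *\<^sub>R v)"
      by blast
    then have "q n x = ?g (x + s *\<^sub>R v)" unfolding q_def by (simp add: add.commute del: of_nat_Suc)
    then show ?thesis using s by blast
  qed
  have qi: "(\<integral>x. q n x \<partial>lborel) = 0" for n
  proof -
    have "integrable lborel (\<lambda>x. b (inverse (Suc n) *\<^sub>R v + x))"
    proof -
      have "integrable (distr lborel borel ((+) (inverse (Suc n) *\<^sub>R v))) b" using bi by (simp add: lborel_distr_plus)
      then show ?thesis by (subst (asm) integrable_distr_eq) (use bm in auto)
    qed
    then have "(\<integral>x. b (inverse (Suc n) *\<^sub>R v + x) - b x \<partial>lborel) = 0"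
      using bi lborel_integral_translate[OF bm] by simp
    then show ?thesis by (simp add: q_def del: of_nat_Suc)
  qed
  have "(\<lambda>n. \<integral>x. q n x \<partial>lborel) \<longlonglongrightarrow> (\<integral>x. ?g x \<partial>lborel)"
  proof (rule integral_dominated_convergence)
    show "?g \<in> borel_measurable lborel" using borel_measurable_continuous_onI[OF gc] by simp
    show "q n \<in> borel_measurable lborel" for n unfolding q_def using bm by simp
    \<comment> \<open>The mean value point lies at distance at most \<open>norm v\<close> from x,
      because the steps are at most 1. Hence the quotients vanish outside the enlarged ball.\<close>
    show "integrable lborel (\<lambda>x. B * indicator (cball 0 (R + norm v)) x :: real)"
      by (intro integrable_mult_right) (use emeasure_lborel_cball_finite[of 0 "R + norm v"] in \<open>auto intro!: integrable_real_indicator simp: less_top[symmetric]\<close>)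
    show "AE x in lborel. (\<lambda>n. q n x) \<longlonglongrightarrow> ?g x"
    proof (rule AE_I2)
      fix x :: 'b
      obtain s where s: "\<And>n. 0 < s n \<and> s n < inverse (real (Suc n)) \<and> q n x = ?g (x + s n *\<^sub>R v)"
        using q[of _ x] by metis
      have "s \<longlonglongrightarrow> 0"
        by (rule tendsto_sandwich[OF _ _ tendsto_const LIMSEQ_inverse_real_of_nat])
           (use s in \<open>auto intro!: always_eventually less_imp_le simp del: of_nat_Suc\<close>)
      then have "(\<lambda>n. x + s n *\<^sub>R v) \<longlonglongrightarrow> x + 0 *\<^sub>R v" by (intro tendsto_intros)
      then have "(\<lambda>n. x + s n *\<^sub>R v) \<longlonglongrightarrow> x" by simp
      then have "(\<lambda>n. ?g (x + s n *\<^sub>R v)) \<longlonglongrightarrow> ?g x"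
        using gc continuous_on_tendsto_compose[of UNIV ?g] by simp
      then show "(\<lambda>n. q n x) \<longlonglongrightarrow> ?g x" using s by simp
    qed
    show "AE x in lborel. norm (q n x) \<le> B * indicator (cball 0 (R + norm v)) x" for n
    proof (rule AE_I2)
      fix x :: 'b
      obtain s where s: "0 < s" "s < inverse (real (Suc n))" "q n x = ?g (x + s *\<^sub>R v)" using q by blast
      show "norm (q n x) \<le> B * indicator (cball 0 (R + norm v)) x"
      proof (cases "x + s *\<^sub>R v \<in> K")
        case True
        have "s \<le> 1"
        proof -
          have "inverse (real (Suc n)) \<le> 1" by (simp add: field_simps)
          then show ?thesis using s by linarith
        qed
        then have "norm (s *\<^sub>R v) \<le> norm v" using s by (simp add: mult_left_le_one_le)
        then have "norm x \<le> R + norm v"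
          using R(2)[OF True] norm_triangle_ineq4[of "x + s *\<^sub>R v" "s *\<^sub>R v"] by simp
        then show ?thesis using gB s(3) by simp
      next
        case False
        then show ?thesis using gz s(3) B by (simp add: indicator_def)
      qed
    qed
  qed
  then show "(\<integral>x. ?g x \<partial>lborel) = 0" unfolding qi using LIMSEQ_unique tendsto_const by metis
qed

lemma C1_nth: "C1 Z S \<Longrightarrow> C1 (\<lambda>x. Z x $ i) S"
  and frechet_derivative_nth: "C1 Z S \<Longrightarrow> x \<in> S \<Longrightarrow> frechet_derivative (\<lambda>x. Z x $ i) (at x) v = frechet_derivative Z (at x) v $ i"
  for Z :: "'b::real_normed_vector \<Rightarrow> real^'k::finite"
proof -
  have d: "((\<lambda>x. Z x $ i) has_derivative (\<lambda>v. frechet_derivative Z (at x) v $ i)) (at x)" if "C1 Z S" "x \<in> S" for x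
    by (rule bounded_linear.has_derivative[OF bounded_linear_vec_nth C1_has_derivative[OF that]])
  then show "C1 Z S \<Longrightarrow> x \<in> S \<Longrightarrow> frechet_derivative (\<lambda>x. Z x $ i) (at x) v = frechet_derivative Z (at x) v $ i"
    using frechet_derivative_at by metis
  show "C1 (\<lambda>x. Z x $ i) S" if Z: "C1 Z S"
    by (rule C1I[OF d[OF Z]]) (auto intro!: continuous_intros C1_continuous_derivative[OF Z])
qed

lemma integral_divergence:
  fixes Z :: "real^'k::finite \<Rightarrow> real^'k"
  assumes Z: "C1 Z UNIV" and K: "compact K" and z: "\<And>x. x \<notin> K \<Longrightarrow> Z x = 0"
  shows "(\<integral>x. (\<Sum>i\<in>UNIV. frechet_derivative Z (at x) (axis i 1) $ i) \<partial>lborel) = 0"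
proof -
  have z': "\<And>x. x \<notin> K \<Longrightarrow> Z x $ i = 0" for i using z by simp
  note I = integral_directional_derivative[OF C1_nth[OF Z] K z']
  have "(\<integral>x. (\<Sum>i\<in>UNIV. frechet_derivative (\<lambda>x. Z x $ i) (at x) (axis i 1)) \<partial>lborel) = (\<Sum>i\<in>(UNIV::'k set). 0)"
    by (subst Bochner_Integration.integral_sum) (use I in auto)
  then show ?thesis by (simp add: frechet_derivative_nth[OF Z])
qed

context minimal_chart
begin

text \<open>The divergence theorem for the gradient coordinates multiplied by \<open>\<phi>\<close>
  and the density, extended by zero; \<open>divergence_grad\<close> evaluates the part in which
  \<open>\<phi>\<close> is not differentiated.\<close>

lemma green_chart:
  assumes \<phi>: "C1 \<phi> V" and K: "compact K" "K \<subseteq> V" and z: "\<And>y. y \<in> V \<Longrightarrow> y \<notin> K \<Longrightarrow> \<phi> y = 0"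
  shows "(\<integral>y. indicator V y * (chart_density F y *
     (frechet_derivative \<phi> (at y) (chart_grad F p y) - real CARD('k) * (F y \<bullet> p) * \<phi> y)) \<partial>lborel) = 0"
proof -
  let ?W = "chart_grad F p" and ?d = "chart_density F"
  define Z where "Z = (\<lambda>y. if y \<in> V then (\<phi> y * ?d y) *\<^sub>R ?W y else 0)"
  have ZK: "Z y = 0" if "y \<notin> K" for y using z that by (auto simp: Z_def)
  have oK: "open (- K)" using K compact_imp_closed by blast
  have "C1 Z V"
    by (rule C1_cong[OF V, of _ "\<lambda>y. (\<phi> y * ?d y) *\<^sub>R ?W y"])
       (auto simp: Z_def intro!: C1_scaleR C1_mult \<phi> C1_density C1_grad)
  moreover have "C1 Z (- K)"
    by (rule C1_cong[OF oK _ C1_const[of 0]]) (auto simp: ZK)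
  ultimately have "C1 Z (V \<union> - K)" using V oK by (rule C1_Un)
  \<comment> \<open>The field is continuously differentiable on \<open>V\<close> by its formula and
    off \<open>K\<close> because it is zero there; these two open sets cover the space.\<close>
  moreover have "V \<union> - K = UNIV" using K by auto
  ultimately have Z: "C1 Z UNIV" by simp
  have "(\<Sum>i\<in>UNIV. frechet_derivative Z (at y) (axis i 1) $ i) = indicator V y * (?d y *
     (frechet_derivative \<phi> (at y) (?W y) - real CARD('k) * (F y \<bullet> p) * \<phi> y))" for y
  proof (cases "y \<in> V")
    case False
    then have "frechet_derivative Z (at y) = (\<lambda>v. 0)"
      using K by (intro C1_zero_outside[OF compact_imp_closed[OF K(1)] ZK]) auto
    then show ?thesis using False by simp
  next
    case y: True
    have "((\<lambda>y. (\<phi> y * ?d y) *\<^sub>R ?W y) has_derivative (\<lambda>v. (\<phi> y * ?d y) *\<^sub>R frechet_derivative ?W (at y) v +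
        (\<phi> y * frechet_derivative ?d (at y) v + frechet_derivative \<phi> (at y) v * ?d y) *\<^sub>R ?W y)) (at y)"
      by (intro has_derivative_scaleR has_derivative_mult C1_has_derivative[OF \<phi> y] C1_has_derivative[OF C1_density y] C1_has_derivative[OF C1_grad y])
    then have "(Z has_derivative (\<lambda>v. (\<phi> y * ?d y) *\<^sub>R frechet_derivative ?W (at y) v +
        (\<phi> y * frechet_derivative ?d (at y) v + frechet_derivative \<phi> (at y) v * ?d y) *\<^sub>R ?W y)) (at y)"
      by (rule has_derivative_transform_within_open[OF _ V y]) (simp add: Z_def)
    then have "frechet_derivative Z (at y) = (\<lambda>v. (\<phi> y * ?d y) *\<^sub>R frechet_derivative ?W (at y) v +
        (\<phi> y * frechet_derivative ?d (at y) v + frechet_derivative \<phi> (at y) v * ?d y) *\<^sub>R ?W y)"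
      by (rule frechet_derivative_at[symmetric])
    then have "(\<Sum>i\<in>UNIV. frechet_derivative Z (at y) (axis i 1) $ i) =
       (\<Sum>i\<in>UNIV. \<phi> y * (pderiv_at ?W i y $ i * ?d y + ?W y $ i * frechet_derivative ?d (at y) (axis i 1))
          + ?d y * (?W y $ i *\<^sub>R frechet_derivative \<phi> (at y) (axis i 1)))"
      by (simp add: pderiv_at_def algebra_simps)
    also have "\<dots> = \<phi> y * (\<Sum>i\<in>UNIV. pderiv_at ?W i y $ i * ?d y + ?W y $ i * frechet_derivative ?d (at y) (axis i 1))
        + ?d y * (\<Sum>i\<in>UNIV. ?W y $ i *\<^sub>R frechet_derivative \<phi> (at y) (axis i 1))"
      by (simp only: sum.distrib sum_distrib_left distrib_left)
    also have "(\<Sum>i\<in>UNIV. ?W y $ i *\<^sub>R frechet_derivative \<phi> (at y) (axis i 1)) = frechet_derivative \<phi> (at y) (?W y)"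
      by (rule linear_axis_expand[OF C1_linear_derivative[OF \<phi> y], symmetric])
    finally show ?thesis unfolding divergence_grad[OF y] using y by (simp add: algebra_simps)
  qed
  then show ?thesis using integral_divergence[OF Z K(1) ZK] by simp
qed

end

section \<open>Functions on the manifold\<close>

context immersed_manifold
begin

definition C1M :: "('m \<Rightarrow> real) \<Rightarrow> bool" where
  "C1M \<phi> \<longleftrightarrow> (\<forall>(V, \<psi>)\<in>\<A>. C1 (\<phi> \<circ> \<psi>) V)"

lemma C1M_D: "C1M \<phi> \<Longrightarrow> (V, \<psi>) \<in> \<A> \<Longrightarrow> C1 (\<phi> \<circ> \<psi>) V"
  unfolding C1M_def by blast

lemma C1M_I: "(\<And>V \<psi>. (V, \<psi>) \<in> \<A> \<Longrightarrow> C1 (\<phi> \<circ> \<psi>) V) \<Longrightarrow> C1M \<phi>"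
  unfolding C1M_def by blast

lemma point_chart:
  assumes "x \<in> M"
  obtains V \<psi> y where "(V, \<psi>) \<in> \<A>" "y \<in> V" "x = \<psi> y"
  using assms M_charts by auto

text \<open>Chart images are open in \<open>M\<close>, so continuity at a point can be tested in one
  chart around it.\<close>

lemma continuous_on_M:
  fixes g :: "'m \<Rightarrow> 'b::topological_space"
  assumes "\<And>V \<psi>. (V, \<psi>) \<in> \<A> \<Longrightarrow> continuous_on V (g \<circ> \<psi>)"
  shows "continuous_on M g"
  unfolding continuous_on_eq_continuous_within
proof
  fix x assume "x \<in> M"
  then obtain V \<psi> y where c: "(V, \<psi>) \<in> \<A>" "y \<in> V" "x = \<psi> y" by (rule point_chart)
  have "continuous_on (\<psi> ` V) ((g \<circ> \<psi>) \<circ> inv_into V \<psi>)"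
    using chart_inj[OF c(1)]
    by (intro continuous_on_compose chart_inv_continuous[OF c(1)] continuous_on_subset[OF assms[OF c(1)]]) auto
  then have "continuous_on (\<psi> ` V) g"
    by (rule continuous_on_eq) (auto simp: f_inv_into_f)
  then have w: "continuous (at x within \<psi> ` V) g" using c by (simp add: continuous_on_eq_continuous_within)
  obtain G where G: "open G" "\<psi> ` V = M \<inter> G" using chart_openin[OF c(1)] by (auto simp: openin_open)
  have "at x within M = at x within \<psi> ` V"
    by (rule at_within_nhd[OF _ G(1)]) (use c G in auto)
  then show "continuous (at x within M) g" using w by simp
qed

lemma continuous_f: "continuous_on M f"
  by (rule continuous_on_M) (intro C1_continuous_on immersed_chart.C1_F immersed_chart)

lemma continuous_C1M: "C1M \<phi> \<Longrightarrow> continuous_on M \<phi>"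
  by (rule continuous_on_M) (intro C1_continuous_on C1M_D)

lemma integrable_continuous:
  fixes g :: "'m \<Rightarrow> real"
  assumes "continuous_on M g"
  shows "integrable vol g"
proof -
  have m: "g \<in> borel_measurable vol"
    unfolding measurable_vol_cong by (rule borel_measurable_continuous_on_restrict[OF assms])
  have "bounded (g ` M)" by (intro compact_imp_bounded compact_continuous_image assms compact_M)
  then obtain B where B: "\<And>x. x \<in> M \<Longrightarrow> norm (g x) \<le> B" unfolding bounded_iff by auto
  show ?thesis by (rule vol.integrable_const_bound[OF _ m, of B]) (use B in \<open>auto intro!: AE_I2\<close>)
qed

text \<open>Well defined, because the tangential part of \<open>p\<close> does not depend on the chart.\<close>

definition tangent_deriv :: "'a \<Rightarrow> ('m \<Rightarrow> real) \<Rightarrow> 'm \<Rightarrow> real" where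
  "tangent_deriv p \<phi> x = (THE r. \<forall>(V, \<psi>)\<in>\<A>. \<forall>y\<in>V. \<psi> y = x \<longrightarrow>
     r = frechet_derivative (\<phi> \<circ> \<psi>) (at y) (chart_grad (f \<circ> \<psi>) p y))"

text \<open>In both charts the gradient coordinates push forward to the orthogonal projection of
  \<open>p\<close> to the same tangent space. Injectivity of the derivative then matches the
  coordinates themselves through the transition map.\<close>

lemma tangent_deriv_chart:
  assumes \<phi>: "C1M \<phi>" and c: "(V, \<psi>) \<in> \<A>" and y: "y \<in> V"
  shows "tangent_deriv p \<phi> (\<psi> y) = frechet_derivative (\<phi> \<circ> \<psi>) (at y) (chart_grad (f \<circ> \<psi>) p y)"
proof -
  interpret V: immersed_chart V "f \<circ> \<psi>" by (rule immersed_chart[OF c])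
  have inv: "frechet_derivative (\<phi> \<circ> \<psi>) (at y) (chart_grad (f \<circ> \<psi>) p y) =
      frechet_derivative (\<phi> \<circ> \<xi>) (at z) (chart_grad (f \<circ> \<xi>) p z)"
    if d: "(W, \<xi>) \<in> \<A>" and z: "z \<in> W" "\<xi> z = \<psi> y" for W \<xi> z
  proof -
    interpret W: immersed_chart W "f \<circ> \<xi>" by (rule immersed_chart[OF d])
    let ?T = "transition V \<psi> W \<xi>"
    have ov: "y \<in> overlap V \<psi> W \<xi>" using y z by (auto simp: overlap_def) (metis imageI)
    have Ty: "?T y = z"
      using chart_inj[OF d] z transition_in[OF c d ov] transition_eq[OF c d ov] by (auto simp: inj_on_def)
    let ?DT = "frechet_derivative ?T (at y)" and ?DW = "frechet_derivative (f \<circ> \<xi>) (at z)"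
      and ?DV = "frechet_derivative (f \<circ> \<psi>) (at y)"
    let ?w = "chart_grad (f \<circ> \<psi>) p y"
    have DV: "?DV = ?DW \<circ> ?DT" using transition_derivative[OF c d ov W.C1_F] by (simp add: Ty)
    have lT: "linear ?DT" by (rule C1_linear_derivative[OF transition_C1[OF c d] ov])
    have "inj ?DT" using V.inj[OF y] unfolding DV by (rule inj_on_imageI2)
    then have surj: "surj ?DT" using lT by (simp add: linear_inj_imp_surj)
    have lW: "linear ?DW" by (rule W.linear_D[OF z(1)])
    let ?X = "?DW (?DT ?w) - ?DW (chart_grad (f \<circ> \<xi>) p z)"
    have orth: "?DW v \<bullet> ?X = 0" for v
    proof -
      obtain u where u: "v = ?DT u" using surj by (metis surjD)
      have "?DW v \<bullet> ?DW (?DT ?w) = ?DW v \<bullet> p"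
        using V.derivative_tangent_part[OF y, of u p] by (simp add: V.tangent_part_def DV u)
      moreover have "?DW v \<bullet> ?DW (chart_grad (f \<circ> \<xi>) p z) = ?DW v \<bullet> p"
        using W.derivative_tangent_part[OF z(1), of v p] by (simp add: W.tangent_part_def)
      ultimately show ?thesis by (simp add: inner_diff_right)
    qed
    \<comment> \<open>The difference of the two pushed-forward vectors is tangent and orthogonal to
      all tangent vectors, hence to itself.\<close>
    have "?X = ?DW (?DT ?w - chart_grad (f \<circ> \<xi>) p z)" by (simp add: linear_diff[OF lW])
    then have "?X \<bullet> ?X = 0" using orth by metis
    then have "?DW (?DT ?w) = ?DW (chart_grad (f \<circ> \<xi>) p z)" by simp
    then have "?DT ?w = chart_grad (f \<circ> \<xi>) p z" using W.inj[OF z(1)] by (simp add: inj_eq)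
    then show ?thesis
      using transition_derivative[OF c d ov C1M_D[OF \<phi> d]] by (simp add: Ty)
  qed
  show ?thesis
    unfolding tangent_deriv_def
  proof (rule the_equality)
    show "\<forall>(W, \<xi>)\<in>\<A>. \<forall>z\<in>W. \<xi> z = \<psi> y \<longrightarrow> frechet_derivative (\<phi> \<circ> \<psi>) (at y) (chart_grad (f \<circ> \<psi>) p y)
       = frechet_derivative (\<phi> \<circ> \<xi>) (at z) (chart_grad (f \<circ> \<xi>) p z)"
      using inv by blast
    show "r = frechet_derivative (\<phi> \<circ> \<psi>) (at y) (chart_grad (f \<circ> \<psi>) p y)"
      if "\<forall>(W, \<xi>)\<in>\<A>. \<forall>z\<in>W. \<xi> z = \<psi> y \<longrightarrow> r = frechet_derivative (\<phi> \<circ> \<xi>) (at z) (chart_grad (f \<circ> \<xi>) p z)" for r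
      using that c y by blast
  qed
qed

lemma continuous_tangent_deriv:
  assumes "C1M \<phi>"
  shows "continuous_on M (tangent_deriv p \<phi>)"
proof (rule continuous_on_M)
  fix V \<psi> assume c: "(V, \<psi>) \<in> \<A>"
  interpret V: immersed_chart V "f \<circ> \<psi>" by (rule immersed_chart[OF c])
  let ?D = "\<lambda>y. frechet_derivative (\<phi> \<circ> \<psi>) (at y)" and ?w = "chart_grad (f \<circ> \<psi>) p"
  note \<phi> = C1M_D[OF assms c]
  have "continuous_on V (\<lambda>y. \<Sum>i\<in>UNIV. (?w y $ i) *\<^sub>R ?D y (axis i 1))"
    by (intro continuous_intros C1_continuous_derivative[OF \<phi>] C1_continuous_on[OF V.C1_grad])
  then show "continuous_on V (tangent_deriv p \<phi> \<circ> \<psi>)"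
  proof (rule continuous_on_eq)
    fix y assume y: "y \<in> V"
    show "(\<Sum>i\<in>UNIV. (?w y $ i) *\<^sub>R ?D y (axis i 1)) = (tangent_deriv p \<phi> \<circ> \<psi>) y"
      using linear_axis_expand[OF C1_linear_derivative[OF \<phi> y], of "?w y"] tangent_deriv_chart[OF assms c y] by simp
  qed
qed

section \<open>Calculus of continuously differentiable functions on the manifold, and bump
  functions\<close>

lemma C1M_sum: "finite I \<Longrightarrow> (\<And>i. i \<in> I \<Longrightarrow> C1M (\<phi> i)) \<Longrightarrow> C1M (\<lambda>x. \<Sum>i\<in>I. \<phi> i x)"
  unfolding C1M_def o_def by (auto intro!: C1_sum)

lemma C1M_mult: "C1M \<phi> \<Longrightarrow> C1M \<rho> \<Longrightarrow> C1M (\<lambda>x. \<phi> x * \<rho> x)"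
  unfolding C1M_def o_def by (auto intro!: C1_mult)

lemma C1M_divide:
  assumes \<phi>: "C1M \<phi>" and \<rho>: "C1M \<rho>" and nz: "\<And>x. x \<in> M \<Longrightarrow> \<rho> x \<noteq> 0"
  shows "C1M (\<lambda>x. \<phi> x / \<rho> x)"
proof (rule C1M_I)
  fix V \<psi> assume c: "(V, \<psi>) \<in> \<A>"
  have "C1 (\<lambda>y. (\<phi> \<circ> \<psi>) y / (\<rho> \<circ> \<psi>) y) V"
    by (rule C1_divide[OF C1M_D[OF \<phi> c] C1M_D[OF \<rho> c]]) (use nz chart_subset[OF c] in auto)
  then show "C1 ((\<lambda>x. \<phi> x / \<rho> x) \<circ> \<psi>) V" by (simp add: o_def)
qed

lemma tangent_deriv_sum:
  assumes I: "finite I" and \<phi>: "\<And>i. i \<in> I \<Longrightarrow> C1M (\<phi> i)" and x: "x \<in> M"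
  shows "tangent_deriv p (\<lambda>x. \<Sum>i\<in>I. \<phi> i x) x = (\<Sum>i\<in>I. tangent_deriv p (\<phi> i) x)"
proof -
  obtain V \<psi> y where c: "(V, \<psi>) \<in> \<A>" "y \<in> V" "x = \<psi> y" using x by (rule point_chart)
  have "((\<lambda>y. \<Sum>i\<in>I. (\<phi> i \<circ> \<psi>) y) has_derivative (\<lambda>v. \<Sum>i\<in>I. frechet_derivative (\<phi> i \<circ> \<psi>) (at y) v)) (at y)"
    by (intro has_derivative_sum C1_has_derivative[OF C1M_D[OF \<phi> c(1)] c(2)])
  then have "frechet_derivative ((\<lambda>x. \<Sum>i\<in>I. \<phi> i x) \<circ> \<psi>) (at y) = (\<lambda>v. \<Sum>i\<in>I. frechet_derivative (\<phi> i \<circ> \<psi>) (at y) v)"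
    using frechet_derivative_at by (force simp: o_def)
  moreover have "C1M (\<lambda>x. \<Sum>i\<in>I. \<phi> i x)" by (rule C1M_sum[OF I \<phi>])
  ultimately show ?thesis
    by (simp add: c(3) tangent_deriv_chart[OF _ c(1,2)] tangent_deriv_chart[OF \<phi> c(1,2)])
qed

text \<open>The image of \<open>K\<close> is compact, hence closed, so near a point off it the
  function is identically zero in any chart.\<close>

lemma tangent_deriv_zero:
  assumes \<phi>: "C1M \<phi>" and c: "(V, \<psi>) \<in> \<A>" and K: "compact K" "K \<subseteq> V"
    and z: "\<And>x. x \<in> M \<Longrightarrow> x \<notin> \<psi> ` K \<Longrightarrow> \<phi> x = 0" and x: "x \<in> M" "x \<notin> \<psi> ` K"
  shows "tangent_deriv p \<phi> x = 0"
proof -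
  obtain W \<xi> y where d: "(W, \<xi>) \<in> \<A>" "y \<in> W" "x = \<xi> y" using x(1) by (rule point_chart)
  have "compact (\<psi> ` K)"
    by (intro compact_continuous_image continuous_on_subset[OF chart_continuous[OF c]] K)
  then have "open (- (\<psi> ` K))" using compact_imp_closed by blast
  then have o: "open (W \<inter> \<xi> -` (- (\<psi> ` K)))"
    using continuous_on_open_vimage[OF chart_open[OF d(1)]] chart_continuous[OF d(1)] by (metis Int_commute)
  have "((\<phi> \<circ> \<xi>) has_derivative (\<lambda>v. 0)) (at y)"
  proof (rule has_derivative_transform_within_open[OF has_derivative_const[of 0] o])
    show "y \<in> W \<inter> \<xi> -` (- (\<psi> ` K))" using d x by auto
    show "0 = (\<phi> \<circ> \<xi>) w" if "w \<in> W \<inter> \<xi> -` (- (\<psi> ` K))" for w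
      using that z[of "\<xi> w"] chart_subset[OF d(1)] by auto
  qed
  then have "frechet_derivative (\<phi> \<circ> \<xi>) (at y) = (\<lambda>v. 0)" by (rule frechet_derivative_at[symmetric])
  then show ?thesis using tangent_deriv_chart[OF \<phi> d(1,2)] d(3) by simp
qed

text \<open>The bump functions \<open>max 0 (r\<^sup>2 - |z - y|\<^sup>2)\<^sup>2\<close> are only continuously differentiable, which is
  all that integration by parts needs.\<close>

definition bump :: "(real^'k) set \<Rightarrow> (real^'k \<Rightarrow> 'm) \<Rightarrow> real^'k \<Rightarrow> real \<Rightarrow> 'm \<Rightarrow> real" where
  "bump V \<psi> y r x = (if x \<in> \<psi> ` V then (max 0 (r\<^sup>2 - (inv_into V \<psi> x - y) \<bullet> (inv_into V \<psi> x - y)))\<^sup>2 else 0)"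

text \<open>Only t = 0 needs care: the difference quotient at step h is at most |h| in absolute
  value.\<close>

lemma max_0_square_deriv: "((\<lambda>t. (max 0 t)\<^sup>2) has_real_derivative 2 * max 0 t) (at t)" for t :: real
proof -
  consider "t > 0" | "t < 0" | "t = 0" by linarith
  then show ?thesis
  proof cases
    case 1
    have "((\<lambda>t. t\<^sup>2) has_real_derivative 2 * t) (at t)" by (auto intro!: derivative_eq_intros)
    then have "((\<lambda>t. (max 0 t)\<^sup>2) has_real_derivative 2 * t) (at t)"
      by (rule has_field_derivative_transform_within_open[where S = "{0<..}"]) (use 1 in auto)
    then show ?thesis using 1 by simp
  next
    case 2
    have "((\<lambda>t. 0) has_real_derivative 0) (at t)" by simp
    then have "((\<lambda>t. (max 0 t)\<^sup>2) has_real_derivative 0) (at t)"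
      by (rule has_field_derivative_transform_within_open[where S = "{..<0}"]) (use 2 in auto)
    then show ?thesis using 2 by simp
  next
    case 3
    have "(\<lambda>h. ((max 0 (0 + h))\<^sup>2 - (max 0 0)\<^sup>2) / h) \<midarrow>0\<rightarrow> (0::real)"
    proof (rule Lim_null_comparison)
      show "\<forall>\<^sub>F h in at 0. norm (((max 0 (0 + h))\<^sup>2 - (max 0 0)\<^sup>2) / h) \<le> \<bar>h::real\<bar>"
        by (rule always_eventually) (auto simp: max_def power2_eq_square)
      show "(\<lambda>h::real. \<bar>h\<bar>) \<midarrow>0\<rightarrow> 0" using tendsto_rabs[OF tendsto_ident_at[of "0::real" UNIV]] by simp
    qed
    then show ?thesis using 3 by (simp add: DERIV_def)
  qed
qed

lemma bump_profile_outside: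
  fixes y z :: "real^'k"
  assumes "0 < r" "z \<notin> cball y r"
  shows "(max 0 (r\<^sup>2 - (z - y) \<bullet> (z - y)))\<^sup>2 = 0"
proof -
  have "r < norm (z - y)" using assms(2) by (simp add: dist_norm norm_minus_commute)
  then have "r\<^sup>2 < (norm (z - y))\<^sup>2" using assms(1) by (intro power_strict_mono) auto
  then show ?thesis by (simp add: power2_norm_eq_inner)
qed

text \<open>A second chart splits into the overlap, where the bump is an explicit function of the
  transition map, and the part mapped off the image of the closed ball, where the bump is zero. Both
  are open, and they cover the chart.\<close>

lemma C1M_bump:
  assumes c: "(V, \<psi>) \<in> \<A>" and r: "cball y r \<subseteq> V" "0 < r"
  shows "C1M (bump V \<psi> y r)"
proof (rule C1M_I)
  fix W \<xi> assume d: "(W, \<xi>) \<in> \<A>"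
  let ?b = "\<lambda>z :: real^'k. (max 0 (r\<^sup>2 - (z - y) \<bullet> (z - y)))\<^sup>2"
  let ?T = "transition W \<xi> V \<psi>" and ?O = "overlap W \<xi> V \<psi>"
  let ?N = "W \<inter> \<xi> -` (- (\<psi> ` cball y r))"
  have b: "C1 ?b UNIV"
  proof -
    have 1: "C1 (\<lambda>z :: real^'k. z - y) UNIV"
      using C1_add[OF C1_bounded_linear[OF bounded_linear_ident] C1_const[of "- y"]] by simp
    have "C1 (\<lambda>z. r\<^sup>2 + (- 1) * ((z - y) \<bullet> (z - y))) UNIV"
      by (rule C1_add[OF C1_const C1_mult[OF C1_const C1_inner[OF 1 1]]])
    then have 2: "C1 (\<lambda>z. r\<^sup>2 - (z - y) \<bullet> (z - y)) UNIV" by simp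
    show ?thesis
      by (rule C1_compose_real[OF 2 max_0_square_deriv]) (intro continuous_intros)
  qed
  have "compact (\<psi> ` cball y r)"
    by (intro compact_continuous_image continuous_on_subset[OF chart_continuous[OF c]] r compact_cball)
  then have "open (- (\<psi> ` cball y r))" using compact_imp_closed by blast
  then have oN: "open ?N"
    using continuous_on_open_vimage[OF chart_open[OF d]] chart_continuous[OF d] by (metis Int_commute)
  have oO: "open ?O" by (rule overlap_open[OF d c])
  have "C1 (?b \<circ> ?T) ?O" by (rule C1_compose[OF b transition_C1[OF d c]]) simp
  then have "C1 (bump V \<psi> y r \<circ> \<xi>) ?O"
    by (rule C1_cong[OF oO, rotated]) (auto simp: bump_def transition_def overlap_def)
  moreover have "C1 (bump V \<psi> y r \<circ> \<xi>) ?N"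
  proof (rule C1_cong[OF oN _ C1_const[of 0]])
    fix w assume w: "w \<in> ?N"
    show "(bump V \<psi> y r \<circ> \<xi>) w = 0"
    proof (cases "\<xi> w \<in> \<psi> ` V")
      case True
      have "inv_into V \<psi> (\<xi> w) \<notin> cball y r"
      proof
        assume "inv_into V \<psi> (\<xi> w) \<in> cball y r"
        from imageI[OF this, of \<psi>] show False using w f_inv_into_f[OF True] by simp
      qed
      then show ?thesis using bump_profile_outside[OF r(2)] by (simp add: bump_def)
    qed (simp add: bump_def)
  qed
  ultimately have "C1 (bump V \<psi> y r \<circ> \<xi>) (?O \<union> ?N)" using oO oN by (rule C1_Un)
  moreover have "?O \<union> ?N = W" using image_mono[OF r(1), of \<psi>] unfolding overlap_def by blast
  ultimately show "C1 (bump V \<psi> y r \<circ> \<xi>) W" by simp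
qed

lemma bump_nonneg: "0 \<le> bump V \<psi> y r x" by (simp add: bump_def)

lemma bump_support:
  assumes "0 < r" "x \<notin> \<psi> ` cball y r"
  shows "bump V \<psi> y r x = 0"
proof (cases "x \<in> \<psi> ` V")
  case True
  let ?z = "inv_into V \<psi> x"
  have "?z \<notin> cball y r"
  proof
    assume "?z \<in> cball y r"
    from imageI[OF this, of \<psi>] show False using assms(2) f_inv_into_f[OF True] by simp
  qed
  from bump_profile_outside[OF assms(1) this] show ?thesis by (simp add: bump_def)
qed (simp add: bump_def)

lemma bump_pos:
  assumes c: "(V, \<psi>) \<in> \<A>" and r: "cball y r \<subseteq> V" "0 < r" and x: "x \<in> \<psi> ` ball y r"
  shows "0 < bump V \<psi> y r x"
proof -
  obtain z where z: "z \<in> ball y r" "x = \<psi> z" using x by auto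
  have zV: "z \<in> V" using z r ball_subset_cball by blast
  have "norm (z - y) < r" using z by (simp add: dist_norm norm_minus_commute)
  then have "(norm (z - y))\<^sup>2 < r\<^sup>2" by (intro power_strict_mono) auto
  moreover have "inv_into V \<psi> x = z" using chart_inj[OF c] zV z by simp
  ultimately show ?thesis using zV z by (simp add: bump_def power2_norm_eq_inner)
qed

end

section \<open>Green's formula and the height inequality on a minimal manifold\<close>

locale minimal_manifold = immersed_manifold M \<A> f
  for M :: "'m::t2_space set" and \<A> :: "('k::finite, 'm) atlas" and f :: "'m \<Rightarrow> 'a::euclidean_space" +
  assumes minimal: "\<And>V \<psi> y. (V, \<psi>) \<in> \<A> \<Longrightarrow> y \<in> V \<Longrightarrow> mean_curvature (f \<circ> \<psi>) y = 0"
begin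

text \<open>The divergence of \<open>\<phi>\<close> times the tangential part of \<open>p\<close>,
  by the product rule and \<open>divergence_grad\<close>.\<close>

definition weak_form :: "'a \<Rightarrow> ('m \<Rightarrow> real) \<Rightarrow> 'm \<Rightarrow> real" where
  "weak_form p \<phi> x = tangent_deriv p \<phi> x - real CARD('k) * (f x \<bullet> p) * \<phi> x"

lemma continuous_weak_form: "C1M \<phi> \<Longrightarrow> continuous_on M (weak_form p \<phi>)"
  unfolding weak_form_def[abs_def]
  by (intro continuous_intros continuous_tangent_deriv continuous_C1M continuous_f)

lemma green_local:
  assumes \<phi>: "C1M \<phi>" and c: "(V, \<psi>) \<in> \<A>" and K: "compact K" "K \<subseteq> V"
    and z: "\<And>x. x \<in> M \<Longrightarrow> x \<notin> \<psi> ` K \<Longrightarrow> \<phi> x = 0"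
  shows "(\<integral>x. weak_form p \<phi> x \<partial>vol) = 0"
proof -
  interpret V: minimal_chart V "f \<circ> \<psi>"
    by (intro minimal_chart.intro immersed_chart[OF c] minimal_chart_axioms.intro minimal[OF c])
  have w0: "weak_form p \<phi> x = 0" if "x \<in> M" "x \<notin> \<psi> ` V" for x
  proof -
    have x: "x \<notin> \<psi> ` K" using that K by auto
    show ?thesis using z[OF that(1) x] tangent_deriv_zero[OF \<phi> c K z that(1) x] by (simp add: weak_form_def)
  qed
  have m: "weak_form p \<phi> \<in> borel_measurable vol"
    using integrable_continuous[OF continuous_weak_form[OF \<phi>]] by (rule borel_measurable_integrable)
  have "(\<integral>x. weak_form p \<phi> x \<partial>vol) = (\<integral>y. indicator V y * (chart_density (f \<circ> \<psi>) y * weak_form p \<phi> (\<psi> y)) \<partial>lborel)"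
    by (rule chart_integral[OF c m w0])
  also have "\<dots> = (\<integral>y. indicator V y * (chart_density (f \<circ> \<psi>) y *
     (frechet_derivative (\<phi> \<circ> \<psi>) (at y) (chart_grad (f \<circ> \<psi>) p y) - real CARD('k) * ((f \<circ> \<psi>) y \<bullet> p) * (\<phi> \<circ> \<psi>) y)) \<partial>lborel)"
    by (rule Bochner_Integration.integral_cong) (auto simp: indicator_def weak_form_def tangent_deriv_chart[OF \<phi> c])
  also have "\<dots> = 0"
  proof (rule V.green_chart[OF C1M_D[OF \<phi> c] K])
    fix y assume y: "y \<in> V" "y \<notin> K"
    then have "\<psi> y \<notin> \<psi> ` K" using chart_inj[OF c] K(2) by (auto simp: inj_on_def)
    then show "(\<phi> \<circ> \<psi>) y = 0" using z chart_subset[OF c] y by auto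
  qed
  finally show ?thesis .
qed

text \<open>Partition of unity: the finitely many bumps have a positive sum on \<open>M\<close>, and
  dividing by it splits \<open>\<phi>\<close> into pieces supported in one chart each, to which
  \<open>green_local\<close> applies.\<close>

lemma green:
  assumes \<phi>: "C1M \<phi>"
  shows "(\<integral>x. weak_form p \<phi> x \<partial>vol) = 0"
proof (rule finite_ball_cover)
  fix I :: "((real^'k) set \<times> (real^'k \<Rightarrow> 'm) \<times> (real^'k) \<times> real) set"
  assume I: "finite I" "\<And>V \<psi> y r. (V, \<psi>, y, r) \<in> I \<Longrightarrow> (V, \<psi>) \<in> \<A> \<and> 0 < r \<and> cball y r \<subseteq> V"
    "M = (\<Union>(V, \<psi>, y, r)\<in>I. \<psi> ` ball y r)"
  let ?\<beta> = "\<lambda>(V, \<psi>, y, r). bump V \<psi> y r"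
  define S where "S = (\<lambda>x. \<Sum>i\<in>I. ?\<beta> i x)"
  have \<beta>: "C1M (?\<beta> i)" if "i \<in> I" for i
    using that by (cases i) (auto intro!: C1M_bump dest!: I(2))
  have S: "C1M S" unfolding S_def by (rule C1M_sum[OF I(1) \<beta>])
  have Spos: "S x > 0" if xM: "x \<in> M" for x
  proof -
    obtain V \<psi> y r where i: "(V, \<psi>, y, r) \<in> I" "x \<in> \<psi> ` ball y r" using I(3) xM by auto
    show ?thesis unfolding S_def
    proof (rule sum_pos2[OF I(1) i(1)])
      show "0 < ?\<beta> (V, \<psi>, y, r) x" using bump_pos I(2)[OF i(1)] i(2) by auto
      show "0 \<le> ?\<beta> i x" for i by (cases i) (simp add: bump_nonneg)
    qed
  qed
  define \<rho> where "\<rho> = (\<lambda>i x. ?\<beta> i x * \<phi> x / S x)"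
  have \<rho>: "C1M (\<rho> i)" if "i \<in> I" for i
    unfolding \<rho>_def using Spos by (intro C1M_divide C1M_mult \<beta>[OF that] \<phi> S) force
  have sum: "(\<Sum>i\<in>I. \<rho> i x) = \<phi> x" if "x \<in> M" for x
  proof -
    have "(\<Sum>i\<in>I. \<rho> i x) = S x * \<phi> x / S x"
      by (simp add: \<rho>_def S_def sum_distrib_right sum_divide_distrib)
    then show ?thesis using Spos[OF that] by simp
  qed
  have zero: "(\<integral>x. weak_form p (\<rho> i) x \<partial>vol) = 0" if i: "i \<in> I" for i
  proof -
    obtain V \<psi> y r where e: "i = (V, \<psi>, y, r)" by (cases i)
    note c = I(2)[OF i[unfolded e]]
    show ?thesis
    proof (rule green_local[OF \<rho>[OF i], of V \<psi> "cball y r"])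
      show "\<rho> i x = 0" if "x \<notin> \<psi> ` cball y r" for x
        using bump_support[OF _ that, of V] c by (simp add: \<rho>_def e)
    qed (use c in auto)
  qed
  have "weak_form p \<phi> x = (\<Sum>i\<in>I. weak_form p (\<rho> i) x)" if x: "x \<in> M" for x
  proof -
    \<comment> \<open>The sum of the pieces agrees with \<open>\<phi>\<close> on \<open>M\<close>
      only, so the derivatives are compared inside a chart.\<close>
    have "tangent_deriv p \<phi> x = tangent_deriv p (\<lambda>x. \<Sum>i\<in>I. \<rho> i x) x"
    proof -
      obtain V \<psi> y where c: "(V, \<psi>) \<in> \<A>" "y \<in> V" "x = \<psi> y" using x by (rule point_chart)
      have "(\<phi> \<circ> \<psi> has_derivative frechet_derivative ((\<lambda>x. \<Sum>i\<in>I. \<rho> i x) \<circ> \<psi>) (at y)) (at y)"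
        by (rule has_derivative_transform_within_open[OF C1_has_derivative[OF C1M_D[OF C1M_sum[OF I(1) \<rho>] c(1)] c(2)] chart_open[OF c(1)] c(2)])
           (use sum chart_subset[OF c(1)] in auto)
      then have "frechet_derivative ((\<lambda>x. \<Sum>i\<in>I. \<rho> i x) \<circ> \<psi>) (at y) = frechet_derivative (\<phi> \<circ> \<psi>) (at y)"
        by (rule frechet_derivative_at)
      moreover have "C1M (\<lambda>x. \<Sum>i\<in>I. \<rho> i x)" by (rule C1M_sum[OF I(1) \<rho>])
      ultimately show ?thesis
        by (simp add: c(3) tangent_deriv_chart[OF _ c(1,2)] \<phi>)
    qed
    then show ?thesis
      by (simp add: weak_form_def tangent_deriv_sum[OF I(1) \<rho> x] sum_subtractf sum_distrib_left[symmetric] sum[OF x])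
  qed
  then have "(\<integral>x. weak_form p \<phi> x \<partial>vol) = (\<integral>x. (\<Sum>i\<in>I. weak_form p (\<rho> i) x) \<partial>vol)"
    by (intro Bochner_Integration.integral_cong) auto
  also have "\<dots> = (\<Sum>i\<in>I. \<integral>x. weak_form p (\<rho> i) x \<partial>vol)"
    by (rule Bochner_Integration.integral_sum) (intro integrable_continuous continuous_weak_form \<rho>)
  finally show ?thesis using zero by simp
qed

lemma height_bounds:
  assumes "norm p = 1" "x \<in> M"
  shows "- 1 \<le> f x \<bullet> p" "f x \<bullet> p \<le> 1"
  using Cauchy_Schwarz_ineq2[of "f x" p] f_unit[OF assms(2)] assms(1) by auto

text \<open>For \<open>\<phi>\<close> = h(u) the weak form is h'(u) |X|^2 - k u h(u). As h' >= 0,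
  the bound on |X|^2 makes it at most \<open>\<Phi>\<close> of the height, and its integral is zero
  by \<open>green\<close>.\<close>

lemma height_inequality:
  assumes p: "norm p = 1"
    and h: "\<And>u. -1 \<le> u \<Longrightarrow> u \<le> 1 \<Longrightarrow> (h has_real_derivative h' u) (at u)"
    and h': "continuous_on UNIV h'" and nn: "\<And>u. 0 \<le> h' u"
  defines "\<Phi> \<equiv> \<lambda>u. h' u * (1 - u\<^sup>2) - real CARD('k) * u * h u"
  shows "integrable vol (\<lambda>x. \<Phi> (f x \<bullet> p))" "0 \<le> (\<integral>x. \<Phi> (f x \<bullet> p) \<partial>vol)"
proof -
  let ?u = "\<lambda>x. f x \<bullet> p" and ?\<phi> = "\<lambda>x. h (f x \<bullet> p)"
  have "continuous_on {-1..1} h"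
    by (intro continuous_at_imp_continuous_on ballI DERIV_isCont[OF h]) auto
  then have "continuous_on {-1..1} \<Phi>"
    unfolding \<Phi>_def by (intro continuous_intros continuous_on_subset[OF h']) auto
  then have c: "continuous_on M (\<lambda>x. \<Phi> (?u x))"
    by (rule continuous_on_compose2) (use height_bounds[OF p] in \<open>auto intro!: continuous_intros continuous_f\<close>)
  then show i: "integrable vol (\<lambda>x. \<Phi> (?u x))" by (rule integrable_continuous)
  have cu: "C1 (\<lambda>y. (f \<circ> \<psi>) y \<bullet> p) V" if "(V, \<psi>) \<in> \<A>" for V \<psi>
    by (intro C1_inner C1_const immersed_chart.C1_F[OF immersed_chart[OF that]])
  have C: "C1M ?\<phi>"
  proof (rule C1M_I)
    fix V \<psi> assume v: "(V, \<psi>) \<in> \<A>"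
    have "C1 (\<lambda>y. h ((f \<circ> \<psi>) y \<bullet> p)) V"
      by (rule C1_compose_real[OF cu[OF v] h continuous_on_subset[OF h' subset_UNIV]])
         (use height_bounds[OF p] chart_subset[OF v] in auto)
    then show "C1 (?\<phi> \<circ> \<psi>) V" by (simp add: o_def)
  qed
  have le: "weak_form p ?\<phi> x \<le> \<Phi> (?u x)" if x: "x \<in> M" for x
  proof -
    obtain V \<psi> y where v: "(V, \<psi>) \<in> \<A>" "y \<in> V" "x = \<psi> y" using x by (rule point_chart)
    interpret V: immersed_chart V "f \<circ> \<psi>" by (rule immersed_chart[OF v(1)])
    let ?X = "V.tangent_part p y"
    have "((\<lambda>y. (f \<circ> \<psi>) y \<bullet> p) has_derivative (\<lambda>v. frechet_derivative (f \<circ> \<psi>) (at y) v \<bullet> p)) (at y)"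
      by (intro has_derivative_inner_left V.D v)
    moreover have "(h has_derivative (*) (h' ((f \<circ> \<psi>) y \<bullet> p))) (at ((f \<circ> \<psi>) y \<bullet> p))"
      using h[of "f x \<bullet> p"] height_bounds[OF p x] v(3) by (simp add: has_field_derivative_def)
    ultimately have "((\<lambda>y. h ((f \<circ> \<psi>) y \<bullet> p)) has_derivative (\<lambda>v. h' ((f \<circ> \<psi>) y \<bullet> p) * (frechet_derivative (f \<circ> \<psi>) (at y) v \<bullet> p))) (at y)"
      by (rule has_derivative_compose)
    then have "frechet_derivative (?\<phi> \<circ> \<psi>) (at y) = (\<lambda>v. h' ((f \<circ> \<psi>) y \<bullet> p) * (frechet_derivative (f \<circ> \<psi>) (at y) v \<bullet> p))"
      using frechet_derivative_at by (force simp: o_def)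
    then have "tangent_deriv p ?\<phi> x = h' (?u x) * (p \<bullet> ?X)"
      using tangent_deriv_chart[OF C v(1,2)] v(3) by (simp add: V.tangent_part_def inner_commute)
    also have "\<dots> \<le> h' (?u x) * (1 - (?u x)\<^sup>2)"
      using V.tangent_part_bound[OF v(2) p] nn v(3) by (intro mult_left_mono) auto
    finally show ?thesis by (simp add: weak_form_def \<Phi>_def)
  qed
  have "0 = (\<integral>x. weak_form p ?\<phi> x \<partial>vol)" using green[OF C] by simp
  also have "\<dots> \<le> (\<integral>x. \<Phi> (?u x) \<partial>vol)"
    by (rule integral_mono[OF integrable_continuous[OF continuous_weak_form[OF C]] i]) (use le in auto)
  finally show "0 \<le> (\<integral>x. \<Phi> (?u x) \<partial>vol)" .
qed

end

section \<open>Lower volume bounds near a point\<close>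

context immersed_chart
begin

lemma difference_lower_bound:
  assumes y: "y \<in> V"
  obtains B where "0 < B" "\<And>v. B * norm v \<le> norm (frechet_derivative F (at y) v)"
proof -
  have "bounded_linear (frechet_derivative F (at y))"
    using linear_D[OF y] by (simp add: linear_conv_bounded_linear)
  from linear_inj_bounded_below_pos[OF linear_D[OF y] inj[OF y]] that show thesis by metis
qed

text \<open>The injective derivative expands by at least B, while near \<open>y\<close> the
  remainder is at most B/2 times the displacement. So \<open>F\<close> cannot return to the value at
  \<open>y\<close>.\<close>

lemma local_injective:
  assumes y: "y \<in> V"
  obtains d where "0 < d" "\<And>z. z \<in> ball y d \<Longrightarrow> z \<in> V" "\<And>z. z \<in> ball y d \<Longrightarrow> F z = F y \<Longrightarrow> z = y"
proof -
  let ?L = "frechet_derivative F (at y)"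
  obtain B where B: "0 < B" "\<And>v. B * norm v \<le> norm (?L v)" using difference_lower_bound[OF y] by metis
  obtain d1 where d1: "0 < d1" "\<And>z. norm (z - y) < d1 \<Longrightarrow> norm (F z - F y - ?L (z - y)) \<le> B / 2 * norm (z - y)"
    using D[OF y] B(1) unfolding has_derivative_at_alt by (meson half_gt_zero)
  obtain d2 where d2: "0 < d2" "ball y d2 \<subseteq> V" using V y open_contains_ball by blast
  show thesis
  proof (rule that[of "min d1 d2"])
    show "0 < min d1 d2" using d1 d2 by simp
    show "z \<in> V" if "z \<in> ball y (min d1 d2)" for z using that d2 by auto
    fix z assume z: "z \<in> ball y (min d1 d2)" "F z = F y"
    have "norm (F z - F y - ?L (z - y)) \<le> B / 2 * norm (z - y)"
      using z(1) by (intro d1) (simp add: dist_norm norm_minus_commute)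
    then have "norm (?L (z - y)) \<le> B / 2 * norm (z - y)" using z(2) by simp
    then have "B * norm (z - y) \<le> B / 2 * norm (z - y)" using B(2)[of "z - y"] by linarith
    then have "B * norm (z - y) \<le> 0" by simp
    then show "z = y" using B(1) by (simp add: mult_le_0_iff)
  qed
qed

text \<open>The isometric model of the derivative maps this ellipsoid onto a round ball, and the
  absolute value of its determinant is the density at \<open>y\<close>.\<close>

lemma ellipsoid_volume:
  assumes y: "y \<in> V" and r: "0 \<le> r"
  shows "ennreal (chart_density F y) * emeasure lborel {z. norm (frechet_derivative F (at y) (z - y)) < r}
    = ennreal (unit_ball_vol (real CARD('k)) * r ^ CARD('k))"
proof -
  let ?L = "frechet_derivative F (at y)" and ?S = "{z. norm (frechet_derivative F (at y) (z - y)) < r}"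
  obtain Q :: "real^'k \<Rightarrow> real^'k" where Q: "linear Q" "inj Q" "\<And>x. norm (Q x) = norm (?L x)"
    "det (gram ?L) = (det (matrix Q))\<^sup>2" "det (matrix Q) \<noteq> 0"
    using isometric_model[OF linear_D[OF y] inj[OF y]] by blast
  have dens: "chart_density F y = \<bar>det (matrix Q)\<bar>"
    by (simp add: chart_density_def first_ff_gram Q(4))
  let ?q = "\<lambda>z. Q (z - y)"
  have Qb: "bounded_linear Q" using Q(1) by (simp add: linear_conv_bounded_linear)
  have S: "?S = ?q -` ball 0 r" using Q(3) by auto
  have c: "continuous_on UNIV ?q"
    by (intro bounded_linear.continuous_on[OF Qb] continuous_intros)
  have "open ?S" unfolding S by (rule open_vimage[OF open_ball c])
  then have Sb: "?S \<in> sets borel" by simp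
  have "surj Q" using Q(1,2) by (simp add: linear_inj_imp_surj)
  then have im: "?q ` ?S = ball 0 r"
  proof -
    have "w \<in> ?q ` ?S" if w: "w \<in> ball 0 r" for w
    proof -
      obtain v where v: "w = Q v" using \<open>surj Q\<close> by (metis surjD)
      then show ?thesis using w Q(3)[of v] by (intro image_eqI[of _ _ "v + y"]) auto
    qed
    then show ?thesis using Q(3) by auto
  qed
  have "emeasure lborel (?q ` ?S) = (\<integral>\<^sup>+x\<in>?S. ennreal \<bar>det (matrix Q)\<bar> \<partial>lborel)"
  proof (rule emeasure_differentiable_image[OF Sb, where f' = "\<lambda>x. Q"])
    show "?q ` ?S \<in> sets borel" unfolding im by simp
    show "inj_on ?q ?S"
    proof (rule inj_onI)
      fix x z assume "Q (x - y) = Q (z - y)"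
      then have "x - y = z - y" by (rule injD[OF Q(2)])
      then show "x = z" by simp
    qed
    show "((\<lambda>z. Q (z - y)) has_derivative Q) (at x)" for x
    proof -
      have "((\<lambda>z. z - y) has_derivative (\<lambda>v. v)) (at x)" by (auto intro!: derivative_eq_intros)
      from bounded_linear.has_derivative[OF Qb this] show ?thesis by simp
    qed
    show "(\<lambda>x. indicator ?S x * \<bar>det (matrix Q)\<bar>) \<in> borel_measurable borel" using Sb by simp
  qed
  also have "\<dots> = ennreal \<bar>det (matrix Q)\<bar> * emeasure lborel ?S"
    using Sb by (subst nn_integral_cmult_indicator) auto
  finally show ?thesis
    unfolding im dens using emeasure_ball[OF r, of "0 :: real^'k"] by simp
qed

text \<open>Near \<open>y\<close> the immersion is almost its linearization, so an ellipsoid in the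
  chart has nearly the volume of a flat ball and maps into the ambient ball.\<close>

lemma local_volume:
  assumes y: "y \<in> V" and U: "open U" "y \<in> U" "U \<subseteq> V" and a: "0 < a" "a < 1"
  shows "\<exists>r0>0. \<forall>r. 0 < r \<and> r < r0 \<longrightarrow> (\<exists>B. open B \<and> B \<subseteq> U \<and> (\<forall>z\<in>B. norm (F z - F y) < r) \<and>
    ennreal (a * unit_ball_vol (real CARD('k)) * r ^ CARD('k)) \<le> (\<integral>\<^sup>+z\<in>B. ennreal (chart_density F z) \<partial>lborel))"
proof -
  let ?L = "frechet_derivative F (at y)" and ?k = "CARD('k)" and ?d = "chart_density F"
  \<comment> \<open>A relative error \<open>e\<close> is allowed twice: 1 - e for the density and 1
    / (1 + e) for the radius. Together they must not cost more than the factor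
    \<open>a\<close>.\<close>
  have "((\<lambda>e::real. (1 - e) / (1 + e) ^ ?k) \<longlongrightarrow> (1 - 0) / (1 + 0) ^ ?k) (at_right 0)"
    by (intro tendsto_intros) auto
  then have "\<forall>\<^sub>F e in at_right (0::real). a < (1 - e) / (1 + e) ^ ?k"
    using a(2) by (intro order_tendstoD(1)) auto
  moreover have "\<forall>\<^sub>F e in at_right (0::real). e \<in> {0<..<1}" by (rule eventually_at_right_real) simp
  ultimately have "\<forall>\<^sub>F e in at_right (0::real). a < (1 - e) / (1 + e) ^ ?k \<and> e \<in> {0<..<1}"
    by (rule eventually_conj)
  then obtain e :: real where "a < (1 - e) / (1 + e) ^ ?k \<and> e \<in> {0<..<1}"
    using eventually_happens'[of "at_right (0::real)"] by fastforce
  then have e: "a < (1 - e) / (1 + e) ^ ?k" "0 < e" "e < 1" by auto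
  obtain B where B: "0 < B" "\<And>v. B * norm v \<le> norm (?L v)" using difference_lower_bound[OF y] by metis
  have eB: "0 < e * B" using e B by simp
  obtain d1 where d1: "0 < d1" "\<And>z. norm (z - y) < d1 \<Longrightarrow> norm (F z - F y - ?L (z - y)) \<le> (e * B) * norm (z - y)"
    using D[OF y] eB unfolding has_derivative_at_alt by meson
  have dp: "?d y > 0" by (rule density_pos[OF y])
  have "isCont ?d y" using C1_continuous_on[OF C1_density] V y continuous_on_eq_continuous_at by blast
  then obtain d2 where d2: "0 < d2" "\<And>z. dist z y < d2 \<Longrightarrow> dist (?d z) (?d y) < e * ?d y"
    unfolding continuous_at_eps_delta using e dp by (meson mult_pos_pos)
  obtain d3 where d3: "0 < d3" "ball y d3 \<subseteq> U" using U open_contains_ball by blast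
  define d where "d = min d1 (min d2 d3)"
  have d: "d > 0" using d1 d2 d3 by (simp add: d_def)
  show ?thesis
  proof (intro exI[of _ "d * B"] conjI allI impI)
    show "0 < d * B" using d B by simp
    fix r assume "0 < r \<and> r < d * B"
    then have r: "0 < r" "r < d * B" by auto
    \<comment> \<open>The radius is shrunk because \<open>F\<close> may stretch by 1 + e compared
      with its derivative. The bound d B on \<open>r\<close> keeps the ellipsoid within distance
      \<open>d\<close> of \<open>y\<close>.\<close>
    define \<rho> where "\<rho> = r / (1 + e)"
    have \<rho>: "0 < \<rho>" "\<rho> \<le> r" "(1 + e) * \<rho> = r" using r e by (auto simp: \<rho>_def field_simps)
    define S where "S = {z. norm (?L (z - y)) < \<rho>}"
    have Lb: "bounded_linear ?L" using linear_D[OF y] by (simp add: linear_conv_bounded_linear)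
    have "S = (\<lambda>z. ?L (z - y)) -` ball 0 \<rho>" by (auto simp: S_def)
    moreover have "continuous_on UNIV (\<lambda>z. ?L (z - y))"
      by (intro bounded_linear.continuous_on[OF Lb] continuous_intros)
    ultimately have S: "open S" using open_vimage[OF open_ball] by metis
    have near: "norm (z - y) < d" if "z \<in> S" for z
    proof -
      have "B * norm (z - y) < d * B" using B(2)[of "z - y"] that r \<rho> by (simp add: S_def)
      then show ?thesis using B(1) by (simp add: mult.commute)
    qed
    have SU: "S \<subseteq> U" using near d3 by (auto simp: d_def dist_norm norm_minus_commute)
    have close: "norm (F z - F y) < r" if "z \<in> S" for z
    proof -
      have "norm (F z - F y - ?L (z - y)) \<le> (e * B) * norm (z - y)"
        using near[OF that] by (intro d1) (simp add: d_def)
      also have "\<dots> \<le> e * norm (?L (z - y))" using B(2)[of "z - y"] e by simp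
      finally have "norm (F z - F y) \<le> (1 + e) * norm (?L (z - y))"
        using norm_triangle_sub[of "F z - F y" "?L (z - y)"] by (simp add: algebra_simps)
      also have "\<dots> < (1 + e) * \<rho>" using that e by (simp add: S_def)
      finally show ?thesis using \<rho> by simp
    qed
    have dens: "(1 - e) * ?d y \<le> ?d z" if "z \<in> S" for z
    proof -
      have "dist (?d z) (?d y) < e * ?d y"
        using near[OF that] by (intro d2) (simp add: d_def dist_norm)
      then show ?thesis by (simp add: dist_real_def algebra_simps abs_less_iff)
    qed
    have "a * unit_ball_vol (real ?k) * r ^ ?k \<le> (1 - e) / (1 + e) ^ ?k * unit_ball_vol (real ?k) * r ^ ?k"
      using e(1) r(1) by (intro mult_right_mono) auto
    also have "\<dots> = (1 - e) * (unit_ball_vol (real ?k) * \<rho> ^ ?k)"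
      by (simp add: \<rho>_def power_divide)
    finally have "ennreal (a * unit_ball_vol (real ?k) * r ^ ?k) \<le> ennreal (1 - e) * ennreal (unit_ball_vol (real ?k) * \<rho> ^ ?k)"
      using e \<rho> by (simp add: ennreal_mult[symmetric] ennreal_leI)
    also have "\<dots> = ennreal (1 - e) * (ennreal (?d y) * emeasure lborel S)"
      unfolding S_def using ellipsoid_volume[OF y, of \<rho>] \<rho> by simp
    also have "\<dots> = ennreal ((1 - e) * ?d y) * emeasure lborel S"
      using e dp by (simp add: ennreal_mult mult.assoc)
    also have "\<dots> = (\<integral>\<^sup>+z. ennreal ((1 - e) * ?d y) * indicator S z \<partial>lborel)"
      using S by (subst nn_integral_cmult_indicator) auto
    also have "\<dots> \<le> (\<integral>\<^sup>+z\<in>S. ennreal (?d z) \<partial>lborel)"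
      by (intro nn_integral_mono) (use dens in \<open>auto simp: indicator_def intro!: ennreal_leI\<close>)
    finally show "\<exists>B. open B \<and> B \<subseteq> U \<and> (\<forall>z\<in>B. norm (F z - F y) < r) \<and>
      ennreal (a * unit_ball_vol (real CARD('k)) * r ^ CARD('k)) \<le> (\<integral>\<^sup>+z\<in>B. ennreal (chart_density F z) \<partial>lborel)"
      using S SU close by blast
  qed
qed

end

text \<open>Each point takes the intersection of its neighbourhoods from both orders of every pair,
  so that \<open>G x\<close> lies in \<open>A x y\<close> and \<open>G y\<close> in
  \<open>B x y\<close>.\<close>

lemma finite_separation:
  fixes P :: "'m::t2_space set"
  assumes "finite P"
  obtains G where "\<And>x. x \<in> P \<Longrightarrow> open (G x) \<and> x \<in> G x" "disjoint_family_on G P"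
proof -
  have "\<forall>x y :: 'm. \<exists>A B. x \<noteq> y \<longrightarrow> open A \<and> open B \<and> x \<in> A \<and> y \<in> B \<and> A \<inter> B = {}"
    using hausdorff by metis
  then obtain A B where AB: "\<And>x y :: 'm. x \<noteq> y \<Longrightarrow> open (A x y) \<and> open (B x y) \<and> x \<in> A x y \<and> y \<in> B x y \<and> A x y \<inter> B x y = {}"
    by metis
  define G where "G = (\<lambda>x. \<Inter>y\<in>P - {x}. A x y \<inter> B y x)"
  show thesis
  proof (rule that[of G])
    show "open (G x) \<and> x \<in> G x" for x
    proof
      show "open (G x)" unfolding G_def using assms AB by (intro open_INT open_Int) auto
      have "x \<in> A x y \<inter> B y x" if "y \<in> P - {x}" for y using AB[of x y] AB[of y x] that by blast
      then show "x \<in> G x" unfolding G_def by blast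
    qed
    show "disjoint_family_on G P"
      unfolding disjoint_family_on_def
    proof (intro ballI impI)
      fix x y assume "x \<in> P" "y \<in> P" "x \<noteq> y"
      then have "G x \<subseteq> A x y" "G y \<subseteq> B x y" by (auto simp: G_def)
      then show "G x \<inter> G y = {}" using AB[OF \<open>x \<noteq> y\<close>] by blast
    qed
  qed
qed

context immersed_manifold
begin

text \<open>Every point of \<open>M\<close> has a neighbourhood that meets the fibre in at most one
  point: by \<open>local_injective\<close> on the fibre, by continuity of \<open>f\<close> off it.
  Compactness does the rest.\<close>

lemma finite_fibre: "finite {x \<in> M. f x = p}"
proof -
  let ?P = "{x \<in> M. f x = p}"
  have "\<exists>W. openin (top_of_set M) W \<and> x \<in> W \<and> finite (W \<inter> ?P)" if x: "x \<in> M" for x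
  proof -
    obtain V \<psi> y where c: "(V, \<psi>) \<in> \<A>" "y \<in> V" "x = \<psi> y" using x by (rule point_chart)
    interpret V: immersed_chart V "f \<circ> \<psi>" by (rule immersed_chart[OF c(1)])
    show ?thesis
    proof (cases "f x = p")
      case True
      obtain d where d: "0 < d" "\<And>z. z \<in> ball y d \<Longrightarrow> z \<in> V" "\<And>z. z \<in> ball y d \<Longrightarrow> (f \<circ> \<psi>) z = (f \<circ> \<psi>) y \<Longrightarrow> z = y"
        using V.local_injective[OF c(2)] by blast
      have "openin (top_of_set M) (\<psi> ` ball y d)"
        by (rule chart_image_openin[OF c(1)]) (use d in auto)
      moreover have "x \<in> \<psi> ` ball y d" using c d by auto
      moreover have "\<psi> z = x" if "z \<in> ball y d" "f (\<psi> z) = p" for z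
        using d(3)[OF that(1)] that(2) True c(3) by simp
      then have "\<psi> ` ball y d \<inter> ?P \<subseteq> {x}" by blast
      then have "finite (\<psi> ` ball y d \<inter> ?P)" by (rule finite_subset) simp
      ultimately show ?thesis by blast
    next
      case False
      have "openin (top_of_set M) (M \<inter> f -` (- {p}))"
        by (rule continuous_openin_preimage_gen[OF continuous_f]) auto
      moreover have "M \<inter> f -` (- {p}) \<inter> ?P = {}" by auto
      ultimately show ?thesis using x False by (intro exI[of _ "M \<inter> f -` (- {p})"]) auto
    qed
  qed
  then obtain W where W: "\<And>x. x \<in> M \<Longrightarrow> openin (top_of_set M) (W x) \<and> x \<in> W x \<and> finite (W x \<inter> ?P)" by metis
  have "\<exists>\<D>\<subseteq>W ` M. finite \<D> \<and> M \<subseteq> \<Union>\<D>"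
    by (rule mp[OF spec[OF compact_M[unfolded compact_eq_openin_cover]]]) (use W in auto)
  then obtain \<D> where D: "\<D> \<subseteq> W ` M" "finite \<D>" "M \<subseteq> \<Union>\<D>" by blast
  have "?P \<subseteq> (\<Union>w\<in>\<D>. w \<inter> ?P)" using D(3) by auto
  moreover have "finite (\<Union>w\<in>\<D>. w \<inter> ?P)" using D(1,2) W by (intro finite_UN_I) auto
  ultimately show ?thesis by (rule finite_subset)
qed

text \<open>The open set \<open>G\<close> confines the sheet, so that sheets through different
  preimages can be kept disjoint.\<close>

lemma point_volume:
  assumes x: "x \<in> M" and G: "open G" "x \<in> G" and a: "0 < a" "a < 1"
  shows "\<exists>r0>0. \<forall>r. 0 < r \<and> r < r0 \<longrightarrow> (\<exists>X\<in>sets vol. X \<subseteq> G \<and> (\<forall>z\<in>X. norm (f z - f x) < r) \<and>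
     a * unit_ball_vol (real CARD('k)) * r ^ CARD('k) \<le> measure vol X)"
proof -
  obtain V \<psi> y where c: "(V, \<psi>) \<in> \<A>" "y \<in> V" "x = \<psi> y" using x by (rule point_chart)
  interpret V: immersed_chart V "f \<circ> \<psi>" by (rule immersed_chart[OF c(1)])
  have "open (V \<inter> \<psi> -` G)"
    using continuous_on_open_vimage[OF chart_open[OF c(1)]] chart_continuous[OF c(1)] G(1) by (metis Int_commute)
  then obtain r0 where r0: "r0 > 0" "\<And>r. 0 < r \<Longrightarrow> r < r0 \<Longrightarrow> \<exists>B. open B \<and> B \<subseteq> V \<inter> \<psi> -` G \<and>
     (\<forall>z\<in>B. norm ((f \<circ> \<psi>) z - (f \<circ> \<psi>) y) < r) \<and>
    ennreal (a * unit_ball_vol (real CARD('k)) * r ^ CARD('k)) \<le> (\<integral>\<^sup>+z\<in>B. ennreal (chart_density (f \<circ> \<psi>) z) \<partial>lborel)"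
    using V.local_volume[OF c(2), of "V \<inter> \<psi> -` G" a] a c G(2) by blast
  show ?thesis
  proof (intro exI[of _ r0] conjI allI impI r0(1))
    fix r assume "0 < r \<and> r < r0"
    then obtain B where B: "open B" "B \<subseteq> V \<inter> \<psi> -` G" "\<forall>z\<in>B. norm ((f \<circ> \<psi>) z - (f \<circ> \<psi>) y) < r"
      "ennreal (a * unit_ball_vol (real CARD('k)) * r ^ CARD('k)) \<le> chart_mass V \<psi> B"
      using r0(2)[of r] unfolding chart_mass_def by blast
    have BV: "B \<in> sets borel" "B \<subseteq> V" using B by auto
    have s: "\<psi> ` B \<in> sets vol"
      unfolding sets_vol M_borel_sets_iff
      using chart_image_subset_borel[OF c(1) BV] chart_subset[OF c(1)] BV(2) by auto
    have "ennreal (a * unit_ball_vol (real CARD('k)) * r ^ CARD('k)) \<le> ennreal (measure vol (\<psi> ` B))"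
      using B(4) vol_chart[OF c(1) BV] by (simp add: vol.emeasure_eq_measure)
    then have "a * unit_ball_vol (real CARD('k)) * r ^ CARD('k) \<le> measure vol (\<psi> ` B)"
      by (simp add: ennreal_le_iff)
    then show "\<exists>X\<in>sets vol. X \<subseteq> G \<and> (\<forall>z\<in>X. norm (f z - f x) < r) \<and>
       a * unit_ball_vol (real CARD('k)) * r ^ CARD('k) \<le> measure vol X"
      using s B c(3) by (intro bexI[of _ "\<psi> ` B"]) auto
  qed
qed

lemma near_set_measurable: "{x \<in> M. norm (f x - p) < r} \<in> sets vol"
proof -
  have "(\<lambda>x. norm (f x - p)) \<in> borel_measurable vol"
    unfolding measurable_vol_cong
    by (intro borel_measurable_continuous_on_restrict continuous_intros continuous_f)
  then have "{x \<in> space vol. norm (f x - p) < r} \<in> sets vol" by measurable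
  then show ?thesis by simp
qed

text \<open>Each of the finitely many preimages contributes almost a flat ball, inside disjoint
  neighbourhoods.\<close>

lemma density_volume:
  assumes a: "0 < a" "a < 1"
  shows "\<exists>r0>0. \<forall>r. 0 < r \<and> r < r0 \<longrightarrow>
     real (point_density M f p) * (a * unit_ball_vol (real CARD('k)) * r ^ CARD('k)) \<le> measure vol {x \<in> M. norm (f x - p) < r}"
proof -
  let ?P = "{x \<in> M. f x = p}"
  obtain G where G: "\<And>x. x \<in> ?P \<Longrightarrow> open (G x) \<and> x \<in> G x" "disjoint_family_on G ?P"
    using finite_separation[OF finite_fibre[of p]] by blast
  define Q where "Q = (\<lambda>x r X. X \<subseteq> G x \<and> (\<forall>z\<in>X. norm (f z - f x) < r) \<and>
     a * unit_ball_vol (real CARD('k)) * r ^ CARD('k) \<le> measure vol X)"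
  have "\<exists>r0>0. \<forall>r. 0 < r \<and> r < r0 \<longrightarrow> (\<exists>X\<in>sets vol. Q x r X)" if x: "x \<in> ?P" for x
    unfolding Q_def by (rule point_volume[OF _ _ _ a]) (use x G(1)[OF x] in auto)
  then have "\<forall>x\<in>?P. \<exists>r0. r0 > 0 \<and> (\<forall>r. 0 < r \<and> r < r0 \<longrightarrow> (\<exists>X\<in>sets vol. Q x r X))" by simp
  from bchoice[OF this] obtain R where
    R': "\<forall>x\<in>?P. R x > 0 \<and> (\<forall>r. 0 < r \<and> r < R x \<longrightarrow> (\<exists>X\<in>sets vol. Q x r X))" ..
  have R: "R x > 0" "0 < r \<Longrightarrow> r < R x \<Longrightarrow> \<exists>X\<in>sets vol. Q x r X" if "x \<in> ?P" for x r
    using bspec[OF R' that] by auto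
  \<comment> \<open>Inserting 1 keeps the minimum meaningful when the fibre is empty.\<close>
  define r0 where "r0 = Min (insert 1 (R ` ?P))"
  have r0: "r0 > 0" unfolding r0_def using finite_fibre[of p] R(1) by (subst Min_gr_iff) auto
  show ?thesis
  proof (intro exI[of _ r0] conjI allI impI r0)
    fix r assume "0 < r \<and> r < r0"
    then have r: "0 < r" "r < r0" by auto
    have "r < R x" if "x \<in> ?P" for x
    proof -
      have "r0 \<le> R x" unfolding r0_def using that finite_fibre[of p] by (intro Min_le) auto
      then show ?thesis using r by simp
    qed
    then have "\<forall>x\<in>?P. \<exists>X. X \<in> sets vol \<and> Q x r X" using R(2) r(1) by (auto simp: Bex_def)
    from bchoice[OF this] obtain X where "\<forall>x\<in>?P. X x \<in> sets vol \<and> Q x r (X x)" ..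
    then have X: "X x \<in> sets vol \<and> X x \<subseteq> G x \<and> (\<forall>z\<in>X x. norm (f z - f x) < r) \<and>
      a * unit_ball_vol (real CARD('k)) * r ^ CARD('k) \<le> measure vol (X x)" if "x \<in> ?P" for x
      using that unfolding Q_def by simp
    have disj: "disjoint_family_on X ?P"
      using G(2) X unfolding disjoint_family_on_def by blast
    have "real (point_density M f p) * (a * unit_ball_vol (real CARD('k)) * r ^ CARD('k)) =
      (\<Sum>x\<in>?P. a * unit_ball_vol (real CARD('k)) * r ^ CARD('k))"
      by (simp add: point_density_def)
    also have "\<dots> \<le> (\<Sum>x\<in>?P. measure vol (X x))" using X by (intro sum_mono) blast
    also have "\<dots> = measure vol (\<Union>x\<in>?P. X x)"
      by (rule vol.finite_measure_finite_Union[OF finite_fibre _ disj, symmetric]) (use X in blast)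
    also have "\<dots> \<le> measure vol {x \<in> M. norm (f x - p) < r}"
    proof (rule vol.finite_measure_mono)
      show "(\<Union>x\<in>?P. X x) \<subseteq> {x \<in> M. norm (f x - p) < r}"
      proof
        fix z assume "z \<in> (\<Union>x\<in>?P. X x)"
        then obtain x where x: "x \<in> ?P" "z \<in> X x" by blast
        then have "z \<in> M" using X[OF x(1)] sets.sets_into_space[of "X x" vol] by auto
        then show "z \<in> {x \<in> M. norm (f x - p) < r}" using X[OF x(1)] x by auto
      qed
      show "{x \<in> M. norm (f x - p) < r} \<in> sets vol" by (rule near_set_measurable)
    qed
    finally show "real (point_density M f p) * (a * unit_ball_vol (real CARD('k)) * r ^ CARD('k)) \<le> measure vol {x \<in> M. norm (f x - p) < r}" .
  qed
qed

end

section \<open>The monotonicity inequality\<close>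

text \<open>At 1 - d the profile has denominator (d (2 - d))^(k/2), and the ball factor is (2 (d -
  d^2))^(k/2). Their quotient tends to 1, and the remaining \<open>sin_int\<close> term tends to
  0.\<close>

lemma profile_limit:
  assumes k: "1 \<le> k" and C: "0 \<le> C"
    and le: "\<And>d. 0 < d \<Longrightarrow> d < d0 \<Longrightarrow> real k * (1 - d) * profile k C (1 - d) * (b * sqrt (2 * (d - d\<^sup>2)) ^ k) \<le> K"
    and d0: "0 < d0" "d0 \<le> 1"
  shows "real k * C * b \<le> K"
proof (rule tendsto_upperbound)
  let ?g = "\<lambda>d. real k * (1 - d) * (C - sin_int k (arccos (1 - d))) * (b * sqrt (2 * (1 - d) / (2 - d)) ^ k)"
  have "((\<lambda>d. arccos (1 - d)) \<longlongrightarrow> arccos (1 - 0)) (at_right 0)"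
  proof (rule continuous_on_tendsto_compose[OF continuous_on_arccos'])
    show "((\<lambda>d. 1 - d) \<longlongrightarrow> 1 - (0::real)) (at_right 0)" by (intro tendsto_intros)
    show "\<forall>\<^sub>F d in at_right 0. 1 - d \<in> {-1..1::real}"
      using eventually_at_right_real[of 0 "1::real"] by (rule eventually_mono) auto
  qed auto
  then have a: "((\<lambda>d. arccos (1 - d)) \<longlongrightarrow> 0) (at_right 0)" by simp
  have "((\<lambda>d. sin_int k (arccos (1 - d))) \<longlongrightarrow> sin_int k 0) (at_right 0)"
  proof (rule continuous_on_tendsto_compose[OF sin_int_cont[of pi] a])
    show "\<forall>\<^sub>F d in at_right 0. arccos (1 - d) \<in> {0..pi}"
      using eventually_at_right_real[of 0 "1::real"]
      by (rule eventually_mono) (auto intro!: arccos_lbound arccos_ubound)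
  qed auto
  then have "(?g \<longlongrightarrow> real k * (1 - 0) * (C - sin_int k 0) * (b * sqrt (2 * (1 - 0) / (2 - 0)) ^ k)) (at_right 0)"
    by (intro tendsto_intros) auto
  then show "(?g \<longlongrightarrow> real k * C * b) (at_right 0)" by simp
  show "\<forall>\<^sub>F d in at_right 0. ?g d \<le> K"
    using eventually_at_right_real[OF d0(1)]
  proof (rule eventually_mono)
    fix d assume "d \<in> {0<..<d0}"
    then have d: "0 < d" "d < d0" "d < 1" using d0 by auto
    have s: "1 - (1 - d)\<^sup>2 = d * (2 - d)" by (simp add: power2_eq_square algebra_simps)
    have "sqrt (2 * (d - d\<^sup>2)) / sqrt (1 - (1 - d)\<^sup>2) = sqrt (2 * (1 - d) / (2 - d))"
      using d unfolding s real_sqrt_divide[symmetric] by (simp add: power2_eq_square divide_simps, simp add: algebra_simps)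
    then have "sqrt (2 * (1 - d) / (2 - d)) ^ k = sqrt (2 * (d - d\<^sup>2)) ^ k / sqrt (1 - (1 - d)\<^sup>2) ^ k"
      by (metis power_divide)
    then have "?g d = real k * (1 - d) * profile k C (1 - d) * (b * sqrt (2 * (d - d\<^sup>2)) ^ k)"
      by (simp add: profile_def)
    also have "\<dots> \<le> K" by (rule le[OF d(1,2)])
    finally show "?g d \<le> K" .
  qed
qed simp

context minimal_manifold
begin

text \<open>The integrand of the height inequality is at most \<open>\<kappa>\<close> everywhere and
  very negative near \<open>p\<close>; nonnegativity of its integral bounds the volume near
  \<open>p\<close>, and with it the number of sheets. The case \<open>\<kappa>\<close> = 1 is for an
  image that avoids the open ball of radius t about \<open>- p\<close>.\<close>

lemma monotonicity:
  assumes p: "norm p = 1" and t: "0 < t" "t < pi/2"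
    and \<kappa>: "\<kappa> = 1 / cos t \<or> \<kappa> = 1 \<and> (\<forall>x\<in>M. - cos t \<le> f x \<bullet> p)"
  shows "real (point_density M f p) * omega (CARD('k) - 1) * (cap_fun CARD('k) t + sin_int CARD('k) (pi/2)) \<le> \<kappa> * measure vol M"
proof -
  let ?k = "CARD('k)" and ?m = "real (point_density M f p)" and ?\<beta> = "unit_ball_vol (real CARD('k))"
  define C where "C = cap_fun ?k t + sin_int ?k (pi/2)"
  have k: "1 \<le> ?k" by (simp add: Suc_leI)
  have C0: "0 \<le> C"
    using cap_fun_mono[OF k, of 0 t] cap_fun_0[OF k] sin_int_nonneg[of "pi/2" ?k] t by (simp add: C_def)
  have \<kappa>0: "0 \<le> \<kappa>" using \<kappa> cos_gt_zero_pi[of t] t by auto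
  have bound: "real ?k * C * (?m * a * ?\<beta>) \<le> \<kappa> * measure vol M" if a: "0 < a" "a < 1" for a
  proof -
    obtain r0 where r0: "r0 > 0" "\<And>r. 0 < r \<Longrightarrow> r < r0 \<Longrightarrow>
       ?m * (a * ?\<beta> * r ^ ?k) \<le> measure vol {x \<in> M. norm (f x - p) < r}"
      using density_volume[OF a, of p] by blast
    \<comment> \<open>This ensures r^2 = 2 (d - d^2) < 2 d <= r0^2, so that the volume bound is
      available at radius r.\<close>
    define d0 where "d0 = min 1 (r0\<^sup>2 / 2)"
    have d0: "0 < d0" "d0 \<le> 1" using r0(1) by (auto simp: d0_def)
    show ?thesis
    proof (rule profile_limit[OF k C0 _ d0])
      fix d assume d: "0 < d" "d < d0"
      define b where "b = 1 - d"
      \<comment> \<open>Since |f x - p|^2 = 2 - 2 u, the ball of radius r is the region u > 1 - d +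
        d^2, where the ramp of length d^2 starting at 1 - d has ended.\<close>
      define r where "r = sqrt (2 * (d - d\<^sup>2))"
      have d1: "d < 1" "d\<^sup>2 < d" using d d0 by (auto simp: power2_eq_square)
      have b: "0 < b" "b < 1" "0 < d\<^sup>2" "b + d\<^sup>2 \<le> 1" using d d1 by (auto simp: b_def)
      have r2: "r\<^sup>2 = 2 * (d - d\<^sup>2)" using d1 by (simp add: r_def)
      have r: "0 < r" using d1 by (simp add: r_def)
      have "r\<^sup>2 < 2 * d" using r2 b(3) by simp
      also have "\<dots> \<le> r0\<^sup>2" using d by (simp add: d0_def)
      finally have rr0: "r < r0" using r0(1) power2_less_imp_less[of r r0] by simp
      obtain h h' where h: "\<And>u. -1 \<le> u \<Longrightarrow> u \<le> 1 \<Longrightarrow> (h has_real_derivative h' u) (at u)"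
        and h': "continuous_on UNIV h'" and nn: "\<And>u. 0 \<le> h' u"
        and \<Phi>1: "\<And>u. -1 \<le> u \<Longrightarrow> u \<le> 1 \<Longrightarrow> h' u * (1 - u\<^sup>2) - real ?k * u * h u \<le> 1 / cos t"
        and \<Phi>2: "\<And>u. - cos t \<le> u \<Longrightarrow> u \<le> 1 \<Longrightarrow> h' u * (1 - u\<^sup>2) - real ?k * u * h u \<le> 1"
        and \<Phi>3: "\<And>u. b + d\<^sup>2 \<le> u \<Longrightarrow> u \<le> 1 \<Longrightarrow> h' u * (1 - u\<^sup>2) - real ?k * u * h u \<le> - real ?k * b * profile ?k C b"
        by (rule test_function[OF k t C_def b(1,2,3,4)]) (rule that)
      define \<Phi> where "\<Phi> = (\<lambda>u. h' u * (1 - u\<^sup>2) - real ?k * u * h u)"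
      let ?Q = "real ?k * b * profile ?k C b" and ?Y = "{x \<in> M. norm (f x - p) < r}"
      have i: "integrable vol (\<lambda>x. \<Phi> (f x \<bullet> p))" and ge: "0 \<le> (\<integral>x. \<Phi> (f x \<bullet> p) \<partial>vol)"
        using height_inequality[OF p h h' nn] unfolding \<Phi>_def by auto
      have up: "\<Phi> (f x \<bullet> p) \<le> \<kappa>" if "x \<in> M" for x
        using \<kappa> \<Phi>1[of "f x \<bullet> p"] \<Phi>2[of "f x \<bullet> p"] height_bounds[OF p that] that by (auto simp: \<Phi>_def)
      have near: "\<Phi> (f x \<bullet> p) \<le> - ?Q" if "x \<in> ?Y" for x
      proof -
        have x: "x \<in> M" "norm (f x - p) < r" using that by auto
        have "(norm (f x - p))\<^sup>2 < r\<^sup>2" using x(2) by (intro power_strict_mono) auto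
        moreover have "(norm (f x - p))\<^sup>2 = 2 - 2 * (f x \<bullet> p)"
          using p f_unit[OF x(1)]
          by (simp add: power2_norm_eq_inner inner_diff_left inner_diff_right inner_commute norm_eq_1)
        ultimately have "b + d\<^sup>2 \<le> f x \<bullet> p" using r2 by (simp add: b_def)
        then show ?thesis using \<Phi>3 height_bounds[OF p x(1)] by (simp add: \<Phi>_def)
      qed
      have Y: "?Y \<in> sets vol" by (rule near_set_measurable)
      have Q0: "0 \<le> ?Q"
      proof -
        have "sin_int ?k (arccos b) \<le> sin_int ?k (pi/2)"
          using b(1,2) by (intro sin_int_mono arccos_lbound arccos_le_pi2) auto
        moreover have "0 \<le> cap_fun ?k t"
          using cap_fun_mono[OF k, of 0 t] cap_fun_0[OF k] sin_int_nonneg[of "pi/2" ?k] t by simp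
        moreover have "0 \<le> sqrt (1 - b\<^sup>2)" using b(1,2) by (simp add: power_le_one)
        ultimately have "0 \<le> profile ?k C b" unfolding profile_def C_def by (intro divide_nonneg_nonneg zero_le_power) auto
        then show ?thesis using b by simp
      qed
      have "0 \<le> (\<integral>x. \<Phi> (f x \<bullet> p) \<partial>vol)" by (rule ge)
      also have "\<dots> \<le> (\<integral>x. \<kappa> - ?Q * indicator ?Y x \<partial>vol)"
      proof (rule integral_mono[OF i])
        show "integrable vol (\<lambda>x. \<kappa> - ?Q * indicator ?Y x)"
          using Y by (intro Bochner_Integration.integrable_diff integrable_mult_right integrable_real_indicator)
            (auto simp: vol.emeasure_eq_measure)
        fix x assume "x \<in> space vol"
        then have x: "x \<in> M" by simp
        show "\<Phi> (f x \<bullet> p) \<le> \<kappa> - ?Q * indicator ?Y x"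
        proof (cases "x \<in> ?Y")
          case True
          then have "indicator ?Y x = (1 :: real)" by (rule indicator_simps(1))
          then show ?thesis using near[OF True] \<kappa>0 by (simp only: mult_1_right)
        next
          case False
          then have "indicator ?Y x = (0 :: real)" by (rule indicator_simps(2))
          then show ?thesis using up[OF x] by (simp only: mult_zero_right diff_zero)
        qed
      qed
      also have "\<dots> = \<kappa> * measure vol M - ?Q * measure vol ?Y"
        using Y Int_absorb2[of ?Y M] by (subst Bochner_Integration.integral_diff)
          (auto intro!: integrable_real_indicator simp: vol.emeasure_eq_measure mult.commute)
      finally have "?Q * measure vol ?Y \<le> \<kappa> * measure vol M" by simp
      moreover have "?Q * (?m * (a * ?\<beta> * r ^ ?k)) \<le> ?Q * measure vol ?Y"
        by (rule mult_left_mono[OF r0(2)[OF r rr0] Q0])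
      ultimately have "?Q * (?m * (a * ?\<beta> * r ^ ?k)) \<le> \<kappa> * measure vol M" by linarith
      then show "real ?k * (1 - d) * profile ?k C (1 - d) * (?m * a * ?\<beta> * sqrt (2 * (d - d\<^sup>2)) ^ ?k) \<le> \<kappa> * measure vol M"
        by (simp add: b_def r_def mult.assoc)
    qed
  qed
  \<comment> \<open>The sheets are flat balls only up to the factor \<open>a\<close>, which now
    tends to 1.\<close>
  have "real ?k * C * (?m * 1 * ?\<beta>) \<le> \<kappa> * measure vol M"
  proof (rule tendsto_upperbound)
    show "((\<lambda>a. real ?k * C * (?m * a * ?\<beta>)) \<longlongrightarrow> real ?k * C * (?m * 1 * ?\<beta>)) (at_left 1)"
      by (intro tendsto_intros)
    show "\<forall>\<^sub>F a in at_left 1. real ?k * C * (?m * a * ?\<beta>) \<le> \<kappa> * measure vol M"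
      using eventually_at_left_real[of 0 "1::real"] by (rule eventually_mono) (use bound in auto)
  qed simp
  moreover have "omega (?k - 1) = real ?k * ?\<beta>"
  proof -
    have "real (?k - 1) + 1 = real ?k" using k by simp
    then show ?thesis using omega_unit_ball_vol[of "?k - 1"] by simp
  qed
  ultimately show ?thesis by (simp add: C_def mult_ac)
qed

section \<open>Distance to the antipode\<close>

lemma fibre_pos:
  assumes "p \<in> f ` M" shows "0 < point_density M f p"
  unfolding point_density_def using finite_fibre[of p] assms by (auto simp: card_gt_0_iff)

text \<open>\<open>monotonicity\<close> is used twice: in its general form as t tends to 0, and in
  its sharp form at the distance from \<open>- p\<close> to the image, which a nearest point attains
  by compactness.\<close>

lemma density_estimates:
  assumes p: "p \<in> f ` M"
  defines "a \<equiv> measure vol M / real (point_density M f p)"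
  shows "omega CARD('k) \<le> a" "\<exists>x\<in>M. sdist (- p) (f x) \<le> eps a CARD('k)"
proof -
  let ?k = "CARD('k)" and ?w = "omega (CARD('k) - 1)"
  have k: "1 \<le> ?k" by (simp add: Suc_leI)
  then obtain j where j: "?k = Suc j" by (cases "CARD('k)") auto
  have m: "0 < real (point_density M f p)" using fibre_pos[OF p] by simp
  have w: "0 < ?w" by (rule omega_pos)
  have np: "norm p = 1" using p f_unit by auto
  have half: "?w * sin_int ?k (pi/2) = omega ?k / 2" using omega_sin_int[of j] by (simp add: j)
  have main: "?w * cap_fun ?k t + omega ?k / 2 \<le> \<kappa> * a"
    if "0 < t" "t < pi/2" "\<kappa> = 1 / cos t \<or> \<kappa> = 1 \<and> (\<forall>x\<in>M. - cos t \<le> f x \<bullet> p)" for t \<kappa>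
  proof -
    have "real (point_density M f p) * (?w * cap_fun ?k t + omega ?k / 2) \<le> \<kappa> * measure vol M"
      using monotonicity[OF np that] unfolding half[symmetric] by (simp add: algebra_simps)
    then show ?thesis using m by (simp add: a_def pos_le_divide_eq mult.commute)
  qed
  \<comment> \<open>For small t the left-hand side is at least its value with \<open>cap_fun\<close>
    at 0, where both halves equal omega_k / 2.\<close>
  show 1: "omega ?k \<le> a"
  proof (rule tendsto_lowerbound)
    show "((\<lambda>t. 1 / cos t * a) \<longlongrightarrow> a) (at_right 0)"
      by (rule tendsto_eq_intros | simp)+
    show "\<forall>\<^sub>F t in at_right 0. omega ?k \<le> 1 / cos t * a"
      using eventually_at_right_real[OF pi_half_gt_zero]
    proof (rule eventually_mono)
      fix t assume "t \<in> {0<..<pi/2}"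
      then have t: "0 < t" "t < pi/2" by auto
      have "cap_fun ?k 0 \<le> cap_fun ?k t" using cap_fun_mono[OF k, of 0 t] t by simp
      then have "?w * cap_fun ?k 0 \<le> ?w * cap_fun ?k t" using w by (intro mult_left_mono) auto
      then show "omega ?k \<le> 1 / cos t * a"
        using main[OF t, of "1 / cos t"] half cap_fun_0[OF k] by simp
    qed
  qed simp
  have "continuous_on M (\<lambda>x. sdist (- p) (f x))"
    unfolding sdist_def
  proof (rule continuous_on_compose2[OF continuous_on_arccos'])
    show "continuous_on M (\<lambda>x. - p \<bullet> f x)" by (intro continuous_intros continuous_f)
    show "(\<lambda>x. - p \<bullet> f x) ` M \<subseteq> {-1..1}" using height_bounds[OF np] by (force simp: inner_commute)
  qed
  then obtain x where x: "x \<in> M" "\<And>z. z \<in> M \<Longrightarrow> sdist (- p) (f x) \<le> sdist (- p) (f z)"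
    using continuous_attains_inf[OF compact_M M_nonempty] by blast
  let ?d = "sdist (- p) (f x)"
  have in1: "\<bar>- p \<bullet> f z\<bar> \<le> 1" if "z \<in> M" for z
    using height_bounds[OF np that] by (simp add: inner_commute abs_le_iff)
  have d0: "0 \<le> ?d" unfolding sdist_def using in1[OF x(1)] by (intro arccos_lbound) (auto simp: abs_le_iff)
  \<comment> \<open>For t up to the distance \<open>?d\<close> all heights are at least - cos t, so
    the factor \<open>\<kappa>\<close> = 1 is allowed.\<close>
  have cap: "cap_fun ?k t \<le> inverse ?w * (a - omega ?k / 2)" if t: "0 < t" "t < pi/2" "t \<le> ?d" for t
  proof -
    have "- cos t \<le> f z \<bullet> p" if z: "z \<in> M" for z
    proof -
      have "t \<le> arccos (- p \<bullet> f z)" using t x(2)[OF z] by (simp add: sdist_def)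
      then have "cos (arccos (- p \<bullet> f z)) \<le> cos t"
        using t in1[OF z] by (intro cos_monotone_0_pi_le arccos_ubound) (auto simp: abs_le_iff)
      moreover have "cos (arccos (- p \<bullet> f z)) = - p \<bullet> f z" using in1[OF z] by (intro cos_arccos_abs)
      ultimately show ?thesis by (simp add: inner_commute)
    qed
    then have "?w * cap_fun ?k t + omega ?k / 2 \<le> a" using main[OF t(1,2), of 1] by simp
    then have "inverse ?w * (?w * cap_fun ?k t) \<le> inverse ?w * (a - omega ?k / 2)"
      using w by (intro mult_left_mono) auto
    moreover have "inverse ?w * (?w * cap_fun ?k t) = cap_fun ?k t" using w by simp
    ultimately show ?thesis by (simp only:)
  qed
  \<comment> \<open>Otherwise \<open>cap\<close> would bound \<open>cap_fun\<close> on the whole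
    open interval up to pi/2, where it is unbounded.\<close>
  have "?d < pi/2"
  proof (rule ccontr)
    assume d: "\<not> ?d < pi/2"
    obtain t where t: "pi/4 \<le> t" "t < pi/2" "inverse ?w * (a - omega ?k / 2) < cap_fun ?k t"
      using cap_fun_unbounded[OF k, of "pi/4"] by auto
    have "0 < t" using t(1) pi_gt_zero by linarith
    then show False using cap[of t] t d by simp
  qed
  moreover have "cap_fun ?k ?d \<le> inverse ?w * (a - omega ?k / 2)"
  \<comment> \<open>\<open>cap\<close> needs a positive angle; at distance 0 the claim is the volume
    bound just proved.\<close>
  proof (cases "?d = 0")
    case True
    have "inverse ?w * (omega ?k / 2) \<le> inverse ?w * (a - omega ?k / 2)"
      using w 1 by (intro mult_left_mono) auto
    moreover have "inverse ?w * (omega ?k / 2) = cap_fun ?k 0"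
      using w unfolding half[symmetric] cap_fun_0[OF k] by simp
    ultimately show ?thesis using True by simp
  qed (use cap[of ?d] d0 \<open>?d < pi/2\<close> in simp)
  ultimately have "?d \<le> eps a ?k" using d0 by (intro le_eps[OF k 1])
  then show "\<exists>x\<in>M. sdist (- p) (f x) \<le> eps a ?k" using x(1) by blast
qed

lemma sdist_set_le:
  assumes "norm q = 1" "x \<in> M" "sdist q (f x) \<le> r"
  shows "sdist_set q (f ` M) \<le> r"
proof -
  have "bdd_below ((\<lambda>y. sdist q y) ` (f ` M))"
  proof (rule bdd_belowI2)
    fix y assume "y \<in> f ` M"
    then have "\<bar>q \<bullet> y\<bar> \<le> 1" using Cauchy_Schwarz_ineq2[of q y] assms(1) f_unit by auto
    then show "0 \<le> sdist q y" unfolding sdist_def by (intro arccos_lbound) (auto simp: abs_le_iff)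
  qed
  then have "sdist_set q (f ` M) \<le> sdist q (f x)"
    unfolding sdist_set_def using assms(2) by (intro cINF_lower) auto
  then show ?thesis using assms(3) by simp
qed

end

theorem proposition4p6:
  fixes M :: "'m::t2_space set"
    and \<A> :: "('k::finite, 'm) atlas"
    and f :: "'m \<Rightarrow> 'a::euclidean_space"
    and k n :: nat
    and A :: real
  assumes "CARD('k) = k" and "DIM('a) = n + 1"
    and "closed_manifold M \<A>"
    and "minimal_immersion M \<A> f"
    and "immersed_volume M \<A> f = A"
  shows "(omega k \<le> A \<and> antipodal_within (eps A k) (f ` M)) \<and>
    (\<forall>p m. p \<in> f ` M \<and> point_density M f p = m \<longrightarrow>
       omega k \<le> A / real m \<and>
       f ` M \<inter> scball (- p) (eps (A / real m) k) \<noteq> {} \<and>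
       sdist_set (- p) (f ` M) \<le> eps (A / real m) k)"
proof -
  interpret minimal_manifold M \<A> f
    using assms(3,4) by unfold_locales (auto simp: minimal_immersion_def)
  have A: "measure vol M = A" using assms(5) by (simp add: immersed_volume_def)
  have k: "1 \<le> k" using assms(1) by (metis Suc_leI One_nat_def zero_less_card_finite)
  have main: "omega k \<le> A / real m \<and> f ` M \<inter> scball (- p) (eps (A / real m) k) \<noteq> {} \<and>
      sdist_set (- p) (f ` M) \<le> eps (A / real m) k"
    if p: "p \<in> f ` M" and m: "point_density M f p = m" for p m
  proof -
    have np: "norm (- p) = 1" using p f_unit by auto
    obtain x where x: "x \<in> M" "sdist (- p) (f x) \<le> eps (A / real m) k"
      using density_estimates(2)[OF p] by (auto simp: A m assms(1))
    have "f x \<in> f ` M \<inter> scball (- p) (eps (A / real m) k)"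
      using x f_unit by (auto simp: scball_def)
    moreover have "sdist_set (- p) (f ` M) \<le> eps (A / real m) k" by (rule sdist_set_le[OF np x])
    ultimately show ?thesis using density_estimates(1)[OF p] by (auto simp: A m assms(1))
  qed
  \<comment> \<open>Since m >= 1, the estimates with A / m imply those with A by monotonicity of
    \<open>eps\<close>. This yields the first assertion from the second.\<close>
  have less: "A / real m \<le> A" if "p \<in> f ` M" "point_density M f p = m" for p m
  proof -
    have m: "1 \<le> real m" using fibre_pos[OF that(1)] that(2) by simp
    have "A / real m \<le> A / 1" using m measure_nonneg[of vol M] A by (intro divide_left_mono) auto
    then show ?thesis by simp
  qed
  have "omega k \<le> A"
  proof -
    obtain x where "x \<in> M" using M_nonempty by auto
    then have "f x \<in> f ` M" by simp
    then show ?thesis using main[OF _ refl] less[OF _ refl] order_trans by metis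
  qed
  moreover have "antipodal_within (eps A k) (f ` M)"
    unfolding antipodal_within_def
  proof
    fix p assume p: "p \<in> f ` M"
    have "eps (A / real (point_density M f p)) k \<le> eps A k"
      using main[OF p refl] less[OF p refl] by (intro eps_mono[OF k]) auto
    then show "sdist_set (- p) (f ` M) \<le> eps A k" using main[OF p refl] by linarith
  qed
  ultimately show ?thesis using main by blast
qed

end
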